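(* Let $k \in \{0,1,2,3\}$ and $c \geq k+1$. If $X \subset \mathbb{P}^{n+c}$ is an $n$-dimensional nondegenerate irreducible projective variety with $a_2(X) = \binom{c+1}{2} - k$, then $X$ is the only nondegenerate irreducible component of $\mathsf{Q}(X)$ of dimension $\geq n$.
   Context: Work over an algebraically closed field of characteristic zero. For a closed subscheme $Z \subset \mathbb{P}^r$, $a_2(Z) := h^0(\mathbb{P}^r, \mathcal{I}_Z(2))$. $\mathsf{Q}(X)$ denotes the base locus $\operatorname{Bs}(|\mathcal{I}_X(2)|)$, i.e. the common zero set in $\mathbb{P}^{n+c}$ of all quadratic forms vanishing on $X$ (the degree-2 part $I(X)_2$ of the homogeneous ideal). Nondegenerate means not contained in any hyperplane. *)

theory Defs
  imports Main "HOL-Library.Function_Algebras" "HOL-Computational_Algebra.Polynomial"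
begin

text \<open>Projective space P^N over a field 'a is modelled through its affine cone:
  points are nonzero vectors x :: 'v \<Rightarrow> 'a, with CARD('v) = N + 1 coordinates.
  All closed sets considered are unions of punctured lines, so Zariski topology,
  irreducibility and chains of irreducible closed subsets agree with those of P^N.\<close>

definition alg_closed :: "'a::field itself \<Rightarrow> bool" where
  "alg_closed _ \<longleftrightarrow> (\<forall>p :: 'a poly. degree p \<ge> 1 \<longrightarrow> (\<exists>z. poly p z = 0))"

definition hom_form :: "nat \<Rightarrow> (('v::finite \<Rightarrow> nat) \<Rightarrow> 'a::field) \<Rightarrow> bool" where
  "hom_form d f \<longleftrightarrow> (\<forall>m. f m \<noteq> 0 \<longrightarrow> sum m UNIV = d)"

definition heval :: "nat \<Rightarrow> (('v::finite \<Rightarrow> nat) \<Rightarrow> 'a::field) \<Rightarrow> ('v \<Rightarrow> 'a) \<Rightarrow> 'a" where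
  "heval d f x = (\<Sum>m\<in>{m. sum m UNIV = d}. f m * (\<Prod>v\<in>UNIV. x v ^ m v))"

definition proj_closed :: "('v::finite \<Rightarrow> 'a::field) set \<Rightarrow> bool" where
  "proj_closed S \<longleftrightarrow> (\<exists>F :: (nat \<times> (('v \<Rightarrow> nat) \<Rightarrow> 'a)) set.
      (\<forall>(d, f)\<in>F. hom_form d f) \<and>
      S = {x. x \<noteq> 0 \<and> (\<forall>(d, f)\<in>F. heval d f x = 0)})"

definition proj_irreducible :: "('v::finite \<Rightarrow> 'a::field) set \<Rightarrow> bool" where
  "proj_irreducible S \<longleftrightarrow> proj_closed S \<and> S \<noteq> {} \<and>
     (\<forall>A B. proj_closed A \<longrightarrow> proj_closed B \<longrightarrow> S \<subseteq> A \<union> B \<longrightarrow> S \<subseteq> A \<or> S \<subseteq> B)"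

definition dim_ge :: "('v::finite \<Rightarrow> 'a::field) set \<Rightarrow> nat \<Rightarrow> bool" where
  "dim_ge S n \<longleftrightarrow> (\<exists>Z :: nat \<Rightarrow> ('v \<Rightarrow> 'a) set.
      (\<forall>i\<le>n. proj_irreducible (Z i) \<and> Z i \<subseteq> S) \<and> (\<forall>i<n. Z i \<subset> Z (Suc i)))"

definition proj_dim_eq :: "('v::finite \<Rightarrow> 'a::field) set \<Rightarrow> nat \<Rightarrow> bool" where
  "proj_dim_eq S n \<longleftrightarrow> dim_ge S n \<and> \<not> dim_ge S (Suc n)"

definition nondegenerate :: "('v::finite \<Rightarrow> 'a::field) set \<Rightarrow> bool" where
  "nondegenerate S \<longleftrightarrow> \<not> (\<exists>l :: 'v \<Rightarrow> 'a. l \<noteq> 0 \<and> (\<forall>x\<in>S. (\<Sum>v\<in>UNIV. l v * x v) = 0))"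

definition quadrics_through :: "('v::finite \<Rightarrow> 'a::field) set \<Rightarrow> (('v \<Rightarrow> nat) \<Rightarrow> 'a) set" where
  "quadrics_through X = {f. hom_form 2 f \<and> (\<forall>x\<in>X. heval 2 f x = 0)}"

definition a2 :: "('v::finite \<Rightarrow> 'a::field) set \<Rightarrow> nat" where
  "a2 X = vector_space.dim (\<lambda>(a::'a) (f :: ('v \<Rightarrow> nat) \<Rightarrow> 'a). (\<lambda>m. a * f m)) (quadrics_through X)"

definition quadric_hull :: "('v::finite \<Rightarrow> 'a::field) set \<Rightarrow> ('v \<Rightarrow> 'a) set" where
  "quadric_hull X = {x. x \<noteq> 0 \<and> (\<forall>f\<in>quadrics_through X. heval 2 f x = 0)}"

definition irred_component :: "('v::finite \<Rightarrow> 'a::field) set \<Rightarrow> ('v \<Rightarrow> 'a) set \<Rightarrow> bool" where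
  "irred_component Y S \<longleftrightarrow> proj_irreducible Y \<and> Y \<subseteq> S \<and>
     (\<forall>Y'. proj_irreducible Y' \<longrightarrow> Y \<subseteq> Y' \<longrightarrow> Y' \<subseteq> S \<longrightarrow> Y' = Y)"

end

theory Submission
  imports Defs "Jordan_Normal_Form.Determinant"
begin

hide_const (open) Module.smult

text \<open>Let \<open>W\<close> be the space of quadrics through \<open>X\<close>. For a general linear section \<open>\<Lambda>\<close> of codimension
  \<open>n\<close>, the restriction of \<open>W\<close> to \<open>\<Lambda>\<close> is injective and \<open>\<Lambda>\<close> is spanned by \<open>c + 1\<close> points of \<open>X\<close>; this
  gives \<open>dim W \<le> binomial (c + 1) 2\<close>, and the same bound with \<open>c - 1\<close> for \<open>c\<close> rules out components of
  dimension larger than \<open>n\<close> that contain \<open>X\<close>. If \<open>Y \<noteq> X\<close> is another nondegenerate component of dimension at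
  least \<open>n\<close>, then \<open>\<Lambda>\<close> is also spanned by points \<open>y\<^sub>l = \<Sum>\<^sub>i a\<^sub>l\<^sub>i x\<^sub>i\<close> of \<open>Y\<close>. Each \<open>y\<^sub>l\<close> imposes the
  relation \<open>\<Sum>\<^sub>i\<^sub><\<^sub>j a\<^sub>l\<^sub>i a\<^sub>l\<^sub>j q(x\<^sub>i, x\<^sub>j) = 0\<close> on \<open>q \<in> W\<close>. Every \<open>y\<^sub>l\<close> involves at least three of the
  \<open>x\<^sub>i\<close>, because \<open>x\<^sub>i \<notin> Y\<close> and some quadric of \<open>W\<close> contains none of the lines \<open>x\<^sub>i x\<^sub>j\<close>; it follows that at
  least two thirds of the \<open>c + 1\<close> relations are independent. So \<open>3 k \<ge> 2 (c + 1)\<close>, which is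
  impossible for \<open>k \<le> 3\<close> and \<open>k < c\<close>.\<close>

subsection \<open>Polynomial functions and irreducibility\<close>

text \<open>The obstacle is to find spanning points of \<open>X\<close> and of \<open>Y\<close> in
  the same section. Density of the combinations of points of \<open>X\<close> does not place such
  points in a given section; Chevalley's theorem does, for all sections outside a hypersurface. A
  section is therefore described by a tuple \<open>w\<close> of \<open>c + 1\<close> vectors rather
  than by \<open>n\<close> equations, "general" means \<open>P w \<noteq> 0\<close> for a polynomial
  function \<open>P\<close>, and the conditions coming from \<open>X\<close> and from
  \<open>Y\<close> are met together because affine space is irreducible. Dimension enters only
  through chains of irreducible closed sets: they show that joins eventually fill the space. The
  fraction two thirds arises because independence can be lost only along rows of \<open>a\<close>
  with pairwise disjoint supports. Each support occupies at least three of the \<open>c + 1\<close>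
  columns, so at most one third of the rows is lost. The bound on \<open>k\<close> is then sharp for
  the argument: with \<open>c \<ge> k + 1\<close>, the inequality
  \<open>3 k \<ge> 2 (c + 1) \<ge> 2 k + 4\<close> needs \<open>k \<ge> 4\<close>.\<close>

inductive_set polyfun :: "'i set \<Rightarrow> (('i \<Rightarrow> 'a::field) \<Rightarrow> 'a) set" for C where
  polyfun_const: "(\<lambda>_. a) \<in> polyfun C"
| polyfun_var: "i \<in> C \<Longrightarrow> (\<lambda>x. x i) \<in> polyfun C"
| polyfun_add: "f \<in> polyfun C \<Longrightarrow> g \<in> polyfun C \<Longrightarrow> (\<lambda>x. f x + g x) \<in> polyfun C"
| polyfun_mult: "f \<in> polyfun C \<Longrightarrow> g \<in> polyfun C \<Longrightarrow> (\<lambda>x. f x * g x) \<in> polyfun C"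

lemma polyfun_uminus: "f \<in> polyfun C \<Longrightarrow> (\<lambda>x. - f x) \<in> polyfun C"
  using polyfun_mult[OF polyfun_const[of "-1"], of f C] by simp

lemma polyfun_diff: "f \<in> polyfun C \<Longrightarrow> g \<in> polyfun C \<Longrightarrow> (\<lambda>x. f x - g x) \<in> polyfun C"
  using polyfun_add[OF _ polyfun_uminus, of f C g] by simp

lemma polyfun_sum: "(\<And>i. i \<in> I \<Longrightarrow> f i \<in> polyfun C) \<Longrightarrow> (\<lambda>x. \<Sum>i\<in>I. f i x) \<in> polyfun C"
proof (induction I rule: infinite_finite_induct)
  case (insert i I)
  then show ?case using polyfun_add[of "f i" C "\<lambda>x. \<Sum>i\<in>I. f i x"] by simp
qed (auto intro: polyfun_const)

lemma polyfun_prod: "(\<And>i. i \<in> I \<Longrightarrow> f i \<in> polyfun C) \<Longrightarrow> (\<lambda>x. \<Prod>i\<in>I. f i x) \<in> polyfun C"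
proof (induction I rule: infinite_finite_induct)
  case (insert i I)
  then show ?case using polyfun_mult[of "f i" C "\<lambda>x. \<Prod>i\<in>I. f i x"] by simp
qed (auto intro: polyfun_const)

lemma polyfun_power: "f \<in> polyfun C \<Longrightarrow> (\<lambda>x. f x ^ n) \<in> polyfun C"
  by (induction n) (auto intro: polyfun_const polyfun_mult)

lemmas polyfun_intros = polyfun_const polyfun_var polyfun_add polyfun_mult polyfun_uminus
  polyfun_diff polyfun_sum polyfun_prod polyfun_power

lemma polyfun_mono: "f \<in> polyfun C \<Longrightarrow> C \<subseteq> C' \<Longrightarrow> f \<in> polyfun C'"
  by (induction rule: polyfun.induct) (auto intro: polyfun_intros)

lemma polyfun_cong: "f \<in> polyfun C \<Longrightarrow> (\<And>i. i \<in> C \<Longrightarrow> x i = y i) \<Longrightarrow> f x = f y"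
  by (induction rule: polyfun.induct) auto

lemma polyfun_compose:
  assumes "f \<in> polyfun C" "\<And>i. i \<in> C \<Longrightarrow> (\<lambda>x. \<phi> x i) \<in> polyfun C'"
  shows "(\<lambda>x. f (\<phi> x)) \<in> polyfun C'"
  using assms by (induction rule: polyfun.induct) (auto intro: polyfun_intros)

lemma polyfun_line:
  fixes f :: "('i \<Rightarrow> 'a::field) \<Rightarrow> 'a"
  assumes "f \<in> polyfun C"
  shows "\<exists>p. \<forall>t. f (\<lambda>i. x i + t * y i) = poly p t"
  using assms
proof (induction rule: polyfun.induct)
  case (polyfun_const a)
  show ?case by (rule exI[of _ "[:a:]"]) simp
next
  case (polyfun_var i)
  show ?case by (rule exI[of _ "[:x i, y i:]"]) simp
next
  case (polyfun_add f g)
  then obtain p q where "\<forall>t. f (\<lambda>i. x i + t * y i) = poly p t" "\<forall>t. g (\<lambda>i. x i + t * y i) = poly q t" by blast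
  then show ?case by (intro exI[of _ "p + q"]) simp
next
  case (polyfun_mult f g)
  then obtain p q where "\<forall>t. f (\<lambda>i. x i + t * y i) = poly p t" "\<forall>t. g (\<lambda>i. x i + t * y i) = poly q t" by blast
  then show ?case by (intro exI[of _ "p * q"]) simp
qed

text \<open>The functions in \<open>polyfun C\<close> vanishing on \<open>S\<close> form a prime ideal.\<close>

definition irr :: "'i set \<Rightarrow> ('i \<Rightarrow> 'a::field) set \<Rightarrow> bool" where
  "irr C S \<longleftrightarrow> S \<noteq> {} \<and> (\<forall>f\<in>polyfun C. \<forall>g\<in>polyfun C.
     (\<exists>x\<in>S. f x \<noteq> 0) \<longrightarrow> (\<exists>x\<in>S. g x \<noteq> 0) \<longrightarrow> (\<exists>x\<in>S. f x \<noteq> 0 \<and> g x \<noteq> 0))"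

lemma irrD:
  assumes "irr C S" "f \<in> polyfun C" "g \<in> polyfun C" "\<exists>x\<in>S. f x \<noteq> 0" "\<exists>x\<in>S. g x \<noteq> 0"
  obtains x where "x \<in> S" "f x \<noteq> 0" "g x \<noteq> 0"
  using assms unfolding irr_def by blast

lemma irr_prod:
  assumes "irr C S" "finite I" "\<And>i. i \<in> I \<Longrightarrow> f i \<in> polyfun C" "\<And>i. i \<in> I \<Longrightarrow> \<exists>x\<in>S. f i x \<noteq> 0"
  shows "\<exists>x\<in>S. \<forall>i\<in>I. f i x \<noteq> 0"
  using assms(2,3,4)
proof (induction I rule: finite_induct)
  case empty
  then show ?case using assms(1) by (auto simp: irr_def)
next
  case (insert i I)
  let ?g = "\<lambda>x. \<Prod>i\<in>I. f i x"
  have "?g \<in> polyfun C" using insert by (intro polyfun_prod) auto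
  moreover have "\<exists>x\<in>S. ?g x \<noteq> 0" using insert by auto
  ultimately obtain x where "x \<in> S" "f i x \<noteq> 0" "?g x \<noteq> 0"
    using irrD[OF assms(1), of "f i" ?g] insert by blast
  then show ?case using insert.hyps by auto
qed

text \<open>On the line joining a nonzero of \<open>f\<close> to a nonzero of \<open>g\<close> both
  restrict to nonzero univariate polynomials, whose product has finitely many roots in an infinite
  field. This is how generic conditions from different sources are satisfied together.\<close>

lemma irr_UNIV: "irr C (UNIV :: ('i \<Rightarrow> 'a::field_char_0) set)"
  unfolding irr_def
proof (intro conjI ballI impI)
  fix f g :: "('i \<Rightarrow> 'a) \<Rightarrow> 'a"
  assume f: "f \<in> polyfun C" and g: "g \<in> polyfun C" and "\<exists>x\<in>UNIV. f x \<noteq> 0" "\<exists>x\<in>UNIV. g x \<noteq> 0"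
  then obtain x y where x: "f x \<noteq> 0" and y: "g y \<noteq> 0" by blast
  define z where "z i = y i - x i" for i
  obtain p q where p: "\<forall>t. f (\<lambda>i. x i + t * z i) = poly p t" and q: "\<forall>t. g (\<lambda>i. x i + t * z i) = poly q t"
    using polyfun_line[OF f] polyfun_line[OF g] by meson
  have "poly p 0 \<noteq> 0" using x p[rule_format, of 0] by simp
  moreover have "poly q 1 \<noteq> 0" using y q[rule_format, of 1] by (simp add: z_def)
  ultimately have "p * q \<noteq> 0" by auto
  then have "finite {t. poly (p * q) t = 0}" by (rule poly_roots_finite)
  then obtain t where "poly (p * q) t \<noteq> 0"
    using infinite_UNIV_char_0[where 'a='a] by (metis (mono_tags, lifting) UNIV_eq_I mem_Collect_eq)
  then show "\<exists>x\<in>UNIV. f x \<noteq> 0 \<and> g x \<noteq> 0" using p q by (metis UNIV_I mult_eq_0_iff poly_mult)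
qed auto

lemma irr_image:
  assumes "irr C S" "\<And>i. i \<in> C' \<Longrightarrow> (\<lambda>x. \<phi> x i) \<in> polyfun C"
  shows "irr C' (\<phi> ` S)"
  unfolding irr_def
proof (intro conjI ballI impI)
  show "\<phi> ` S \<noteq> {}" using assms by (auto simp: irr_def)
  fix f g assume f: "f \<in> polyfun C'" and g: "g \<in> polyfun C'"
    and "\<exists>x\<in>\<phi> ` S. f x \<noteq> 0" "\<exists>x\<in>\<phi> ` S. g x \<noteq> 0"
  then have "\<exists>x\<in>S. f (\<phi> x) \<noteq> 0" "\<exists>x\<in>S. g (\<phi> x) \<noteq> 0" by auto
  then obtain x where "x \<in> S" "f (\<phi> x) \<noteq> 0" "g (\<phi> x) \<noteq> 0"
    using irrD[OF assms(1) polyfun_compose[of f C' \<phi>, OF f assms(2)]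
          polyfun_compose[of g C' \<phi>, OF g assms(2)]] by blast
  then show "\<exists>x\<in>\<phi> ` S. f x \<noteq> 0 \<and> g x \<noteq> 0" by blast
qed

lemma irr_mono_coords: "irr C S \<Longrightarrow> C' \<subseteq> C \<Longrightarrow> irr C' S"
  unfolding irr_def using polyfun_mono by blast

subsection \<open>Elimination\<close>

text \<open>Coefficients live in the ring of all functions, and degrees refer to that ring. A
  leading coefficient may vanish on the set \<open>D\<close> under study without being zero, which
  is why \<open>strip_leading\<close> is needed below.\<close>

definition coeffs_in :: "'i set \<Rightarrow> (('i \<Rightarrow> 'a::field) \<Rightarrow> 'a) poly \<Rightarrow> bool" where
  "coeffs_in K p \<longleftrightarrow> (\<forall>n. coeff p n \<in> polyfun K)"

lemma zero_polyfun: "0 \<in> polyfun C" and one_polyfun: "1 \<in> polyfun C"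
  using polyfun_const[of 0 C] polyfun_const[of 1 C] by (auto simp: zero_fun_def one_fun_def)

lemma plus_polyfun: "f \<in> polyfun C \<Longrightarrow> g \<in> polyfun C \<Longrightarrow> f + g \<in> polyfun C"
  and times_polyfun: "f \<in> polyfun C \<Longrightarrow> g \<in> polyfun C \<Longrightarrow> f * g \<in> polyfun C"
  and minus_polyfun: "f \<in> polyfun C \<Longrightarrow> g \<in> polyfun C \<Longrightarrow> f - g \<in> polyfun C"
  by (auto simp: plus_fun_def times_fun_def fun_diff_def intro: polyfun_intros)

lemma sum_polyfun: "(\<And>i. i \<in> I \<Longrightarrow> f i \<in> polyfun C) \<Longrightarrow> sum f I \<in> polyfun C"
  by (induction I rule: infinite_finite_induct) (auto intro: zero_polyfun plus_polyfun)

lemma power_polyfun: "f \<in> polyfun C \<Longrightarrow> f ^ n \<in> polyfun C"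
  by (induction n) (auto intro: one_polyfun times_polyfun)

lemma coeffs_in_zero: "coeffs_in K 0" by (simp add: coeffs_in_def zero_polyfun)

lemma coeffs_in_add: "coeffs_in K p \<Longrightarrow> coeffs_in K q \<Longrightarrow> coeffs_in K (p + q)"
  and coeffs_in_diff: "coeffs_in K p \<Longrightarrow> coeffs_in K q \<Longrightarrow> coeffs_in K (p - q)"
  and coeffs_in_smult: "a \<in> polyfun K \<Longrightarrow> coeffs_in K p \<Longrightarrow> coeffs_in K (smult a p)"
  and coeffs_in_mult: "coeffs_in K p \<Longrightarrow> coeffs_in K q \<Longrightarrow> coeffs_in K (p * q)"
  and coeffs_in_monom: "a \<in> polyfun K \<Longrightarrow> coeffs_in K (monom a n)"
  by (auto simp: coeffs_in_def coeff_mult plus_polyfun minus_polyfun times_polyfun zero_polyfun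
      intro!: sum_polyfun)

definition peval :: "(('i \<Rightarrow> 'a::field) \<Rightarrow> 'a) poly \<Rightarrow> ('i \<Rightarrow> 'a) \<Rightarrow> 'a \<Rightarrow> 'a" where
  "peval p x s = poly (map_poly (\<lambda>f. f x) p) s"

lemma peval_eq_sum: "degree p \<le> n \<Longrightarrow> peval p x s = (\<Sum>i\<le>n. coeff p i x * s ^ i)"
proof -
  assume n: "degree p \<le> n"
  have c: "coeff (map_poly (\<lambda>f. f x) p) i = coeff p i x" for i by (rule coeff_map_poly) simp
  have "degree (map_poly (\<lambda>f. f x) p) \<le> n"
    by (rule degree_le) (use n in \<open>auto simp: c coeff_eq_0\<close>)
  then have "poly (map_poly (\<lambda>f. f x) p) s = (\<Sum>i\<le>n. coeff (map_poly (\<lambda>f. f x) p) i * s ^ i)"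
    unfolding poly_altdef by (intro sum.mono_neutral_left) (auto simp: coeff_eq_0)
  then show ?thesis by (simp add: peval_def c)
qed

lemma map_poly_at:
  "map_poly (\<lambda>f. f x) (p + q) = map_poly (\<lambda>f. f x) p + map_poly (\<lambda>f. f x) q"
  "map_poly (\<lambda>f. f x) (p - q) = map_poly (\<lambda>f. f x) p - map_poly (\<lambda>f. f x) (q :: ('b \<Rightarrow> 'a::field) poly)"
  "map_poly (\<lambda>f. f x) (p * q) = map_poly (\<lambda>f. f x) p * map_poly (\<lambda>f. f x) q"
  "map_poly (\<lambda>f. f x) (smult a p) = smult (a x) (map_poly (\<lambda>f. f x) p)"
  "map_poly (\<lambda>f. f x) (monom a n) = monom (a x) n"
proof -
  have c: "coeff (map_poly (\<lambda>f. f x) p) i = coeff p i x" for i and p :: "('b \<Rightarrow> 'a) poly"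
    by (rule coeff_map_poly) simp
  have s: "(sum f A) x = (\<Sum>i\<in>A. f i x)" for f :: "nat \<Rightarrow> 'b \<Rightarrow> 'a" and A
    by (induction A rule: infinite_finite_induct) auto
  show "map_poly (\<lambda>f. f x) (p + q) = map_poly (\<lambda>f. f x) p + map_poly (\<lambda>f. f x) q"
    "map_poly (\<lambda>f. f x) (p - q) = map_poly (\<lambda>f. f x) p - map_poly (\<lambda>f. f x) q"
    "map_poly (\<lambda>f. f x) (p * q) = map_poly (\<lambda>f. f x) p * map_poly (\<lambda>f. f x) q"
    "map_poly (\<lambda>f. f x) (smult a p) = smult (a x) (map_poly (\<lambda>f. f x) p)"
    "map_poly (\<lambda>f. f x) (monom a n) = monom (a x) n"
    by (auto simp: poly_eq_iff c coeff_mult s)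
qed

lemma peval_simps:
  "peval (p + q) x s = peval p x s + peval q x s"
  "peval (p - q) x s = peval p x s - peval q x s"
  "peval (p * q) x s = peval p x s * peval q x s"
  "peval (smult a p) x s = a x * peval p x s"
  "peval (monom a n) x s = a x * s ^ n"
  "peval 0 x s = 0"
  by (simp_all add: peval_def map_poly_at poly_monom)

lemma polyfun_imp_peval:
  assumes "f \<in> polyfun (insert j K)" "j \<notin> K"
  shows "\<exists>p. coeffs_in K p \<and> (\<forall>x. f x = peval p x (x j))"
  using assms(1)
proof (induction rule: polyfun.induct)
  case (polyfun_const a)
  show ?case by (rule exI[of _ "monom (\<lambda>_. a) 0"])
      (auto simp: peval_simps intro!: coeffs_in_monom polyfun_intros)
next
  case (polyfun_var i)
  show ?case
  proof (cases "i = j")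
    case True
    then show ?thesis by (intro exI[of _ "monom (\<lambda>_. 1) 1"])
      (auto simp: peval_simps intro!: coeffs_in_monom polyfun_intros)
  next
    case False
    then show ?thesis using polyfun_var by (intro exI[of _ "monom (\<lambda>x. x i) 0"])
      (auto simp: peval_simps intro!: coeffs_in_monom polyfun_intros)
  qed
next
  case (polyfun_add f g)
  then obtain p q where "coeffs_in K p" "\<forall>x. f x = peval p x (x j)" "coeffs_in K q" "\<forall>x. g x = peval q x (x j)" by blast
  then show ?case by (intro exI[of _ "p + q"]) (simp add: peval_simps coeffs_in_add)
next
  case (polyfun_mult f g)
  then obtain p q where "coeffs_in K p" "\<forall>x. f x = peval p x (x j)" "coeffs_in K q" "\<forall>x. g x = peval q x (x j)" by blast
  then show ?case by (intro exI[of _ "p * q"]) (simp add: peval_simps coeffs_in_mult)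
qed

lemma peval_imp_polyfun:
  assumes "coeffs_in K p"
  shows "(\<lambda>x. peval p x (x j)) \<in> polyfun (insert j K)"
proof -
  have "coeff p i \<in> polyfun (insert j K)" for i
    using assms polyfun_mono[of "coeff p i" K "insert j K"] by (auto simp: coeffs_in_def)
  then show ?thesis unfolding peval_eq_sum[OF order_refl]
    by (intro polyfun_intros) auto
qed

text \<open>The leading coefficient of \<open>P\<close> is not invertible, so each cancellation of a
  leading term costs a factor of it. The bound on \<open>degree q\<close> is used in
  \<open>eliminate_one\<close>, where a quotient must have smaller degree than a minimal
  equation.\<close>

lemma pseudo_division:
  assumes "coeffs_in K P" "degree P = m" "0 < m" "coeffs_in K p" "degree p \<le> d"
  shows "\<exists>k q r. smult (lead_coeff P ^ k) p = P * q + r \<and> coeffs_in K q \<and> coeffs_in K r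
           \<and> degree r < m \<and> degree q \<le> d - m"
  using assms(4,5)
proof (induction d arbitrary: p rule: less_induct)
  case (less d)
  show ?case
  proof (cases "degree p < m")
    case True
    then show ?thesis using less.prems
      by (intro exI[of _ 0] exI[of _ 0] exI[of _ p]) (auto simp: coeffs_in_zero simp flip: one_fun_def)
  next
    case False
    let ?e = "degree p" let ?M = "monom (lead_coeff p) (?e - m)"
    define p' where "p' = smult (lead_coeff P) p - P * ?M"
    have cM: "coeffs_in K ?M" using less.prems by (intro coeffs_in_monom) (auto simp: coeffs_in_def)
    have lP: "lead_coeff P \<in> polyfun K" using assms(1) by (auto simp: coeffs_in_def)
    have cp': "coeffs_in K p'" unfolding p'_def
      using less.prems cM lP assms(1) by (intro coeffs_in_diff coeffs_in_smult coeffs_in_mult)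
    have dPM: "degree (P * ?M) \<le> ?e"
      using degree_mult_le[of P ?M] degree_monom_le[of "lead_coeff p" "?e - m"] False assms(2) by linarith
    have "coeff (P * ?M) ?e = lead_coeff P * lead_coeff p"
      using False assms(2) by (simp add: mult.commute[of P] coeff_monom_mult)
    then have "coeff p' ?e = 0" by (simp add: p'_def)
    moreover have "degree p' \<le> ?e" unfolding p'_def
      by (intro degree_diff_le dPM degree_smult_le)
    ultimately have dp': "degree p' < ?e"
      using False assms(3) by (metis le_neq_implies_less leading_coeff_0_iff degree_0 not_gr_zero linorder_not_less)
    then obtain k q r where kqr: "smult (lead_coeff P ^ k) p' = P * q + r" "coeffs_in K q" "coeffs_in K r"
        "degree r < m" "degree q \<le> (?e - 1) - m"
      using less.IH[of "?e - 1" p'] cp' less.prems by force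
    let ?q = "q + smult (lead_coeff P ^ k) ?M"
    have "smult (lead_coeff P ^ Suc k) p = smult (lead_coeff P ^ k) (p' + P * ?M)"
      by (simp add: p'_def mult.commute)
    also have "\<dots> = P * ?q + r" using kqr(1) by (simp add: smult_add_right algebra_simps)
    finally have 1: "smult (lead_coeff P ^ Suc k) p = P * ?q + r" .
    have 2: "coeffs_in K ?q" using kqr cM lP by (intro coeffs_in_add coeffs_in_smult power_polyfun)
    have "degree ?q \<le> ?e - m"
    proof (rule degree_add_le)
      show "degree q \<le> ?e - m" using kqr(5) by linarith
      show "degree (smult (lead_coeff P ^ k) ?M) \<le> ?e - m"
        using degree_monom_le degree_smult_le le_trans by blast
    qed
    then have "degree ?q \<le> d - m" using less.prems by linarith
    then show ?thesis using 1 2 kqr by blast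
  qed
qed

text \<open>For \<open>K\<close> smaller than \<open>UNIV\<close> this is a cylinder: the Zariski
  closure of the projection of \<open>S\<close> to the coordinates in \<open>K\<close>, with all
  other coordinates free.\<close>

definition zcl :: "'i set \<Rightarrow> ('i \<Rightarrow> 'a::field) set \<Rightarrow> ('i \<Rightarrow> 'a) set" where
  "zcl K S = {b. \<forall>f\<in>polyfun K. (\<forall>x\<in>S. f x = 0) \<longrightarrow> f b = 0}"

lemma zclD: "b \<in> zcl K S \<Longrightarrow> f \<in> polyfun K \<Longrightarrow> (\<And>x. x \<in> S \<Longrightarrow> f x = 0) \<Longrightarrow> f b = 0"
  by (auto simp: zcl_def)

lemma subset_zcl: "S \<subseteq> zcl K S"
  by (auto simp: zcl_def)

lemma peval_fun_upd:
  assumes "coeffs_in K p" "j \<notin> K"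
  shows "peval p (b(j := s)) t = peval p b t"
proof -
  have "coeff p i (b(j := s)) = coeff p i b" for i
    by (rule polyfun_cong[of _ K]) (use assms in \<open>auto simp: coeffs_in_def\<close>)
  then show ?thesis by (simp add: peval_eq_sum[OF order_refl])
qed

text \<open>Truncation after the last coefficient that does not vanish identically on
  \<open>D\<close> leaves the values over \<open>D\<close> unchanged and makes the degree meaningful
  for minimality arguments.\<close>

lemma strip_leading:
  assumes "coeffs_in K p" "\<exists>i. \<exists>x\<in>D. coeff p i x \<noteq> 0"
  obtains p' where "coeffs_in K p'" "degree p' \<le> degree p" "\<exists>x\<in>D. lead_coeff p' x \<noteq> 0"
    "\<And>x t. x \<in> D \<Longrightarrow> peval p' x t = peval p x t"
proof -
  define A where "A = {i. \<exists>x\<in>D. coeff p i x \<noteq> 0}"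
  have "A \<subseteq> {..degree p}"
  proof
    fix i assume "i \<in> A"
    then have "coeff p i \<noteq> 0" by (auto simp: A_def)
    then show "i \<in> {..degree p}" using le_degree by auto
  qed
  then have fin: "finite A" using finite_subset by blast
  define n where "n = Max A"
  have n: "n \<in> A" using fin assms(2) Max_in[of A] by (auto simp: n_def A_def)
  define p' where "p' = poly_cutoff (Suc n) p"
  have c: "coeff p' i = (if i \<le> n then coeff p i else 0)" for i
    by (simp add: p'_def coeff_poly_cutoff less_Suc_eq_le)
  have "coeff p' n \<noteq> 0" using n by (auto simp: A_def c)
  then have deg: "degree p' = n"
    by (intro antisym le_degree degree_le) (auto simp: c)
  have ndeg: "n \<le> degree p" using n \<open>A \<subseteq> {..degree p}\<close> by auto
  show ?thesis
  proof
    show "coeffs_in K p'" using assms(1) by (auto simp: coeffs_in_def c zero_polyfun)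
    show "degree p' \<le> degree p" using deg ndeg by simp
    show "\<exists>x\<in>D. lead_coeff p' x \<noteq> 0" using n by (auto simp: deg c A_def)
    fix x t assume x: "x \<in> D"
    have "coeff p i x = 0" if "i > n" for i
      using that x Max_ge[OF fin, of i] by (auto simp: n_def A_def)
    then have "coeff p' i x = coeff p i x" for i by (simp add: c)
    then show "peval p' x t = peval p x t"
      using peval_eq_sum[of p' "degree p"] peval_eq_sum[of p "degree p"] deg ndeg by simp
  qed
qed

lemma exists_root:
  assumes "alg_closed TYPE('a::field)" "coeff p m x \<noteq> (0::'a)" "0 < m"
  shows "\<exists>s. peval p x s = 0"
proof -
  have "coeff (map_poly (\<lambda>f. f x) p) m = coeff p m x" by (rule coeff_map_poly) simp
  then have "degree (map_poly (\<lambda>f. f x) p) \<ge> 1"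
    using assms le_degree[of "map_poly (\<lambda>f. f x) p" m] by simp
  then show ?thesis using assms(1) unfolding alg_closed_def peval_def by blast
qed

lemma exists_nonroot:
  assumes "coeff p m x \<noteq> (0::'a::field_char_0)"
  shows "\<exists>s. peval p x s \<noteq> 0"
proof -
  have "coeff (map_poly (\<lambda>f. f x) p) m = coeff p m x" by (rule coeff_map_poly) simp
  then have "map_poly (\<lambda>f. f x) p \<noteq> 0" using assms by auto
  then have "finite {t. poly (map_poly (\<lambda>f. f x) p) t = 0}" by (rule poly_roots_finite)
  then show ?thesis unfolding peval_def
    using infinite_UNIV_char_0[where 'a='a] by (metis (mono_tags, lifting) UNIV_eq_I mem_Collect_eq)
qed

text \<open>Forgetting the coordinate \<open>j\<close>. The ideal \<open>I\<close> of \<open>D\<close> is, up to leading coefficients, generated by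
  an element \<open>P\<close> of least degree in the coordinate \<open>j\<close>, so that the roots of \<open>P\<close> over \<open>b\<close> give points of the
  closure of \<open>D\<close>. A nonzero element \<open>R\<close> of least degree in the ideal generated by \<open>I\<close> and \<open>g\<close> does not
  involve the coordinate \<open>j\<close>, and \<open>R(b) \<noteq> 0\<close> forces \<open>g\<close> to be nonzero over \<open>b\<close>.\<close>

lemma eliminate_one:
  fixes D :: "('i \<Rightarrow> 'a::field_char_0) set"
  assumes ac: "alg_closed TYPE('a)" and j: "j \<notin> K" and D: "irr (insert j K) D"
    and g: "g \<in> polyfun (insert j K)" and gD: "\<exists>x\<in>D. g x \<noteq> 0"
  shows "\<exists>h\<in>polyfun K. (\<exists>x\<in>D. h x \<noteq> 0) \<and>
     (\<forall>b\<in>zcl K D. h b \<noteq> 0 \<longrightarrow> (\<exists>s. b(j := s) \<in> zcl (insert j K) D \<and> g (b(j := s)) \<noteq> 0))"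
proof -
  define I where "I p \<longleftrightarrow> coeffs_in K p \<and> (\<forall>x\<in>D. peval p x (x j) = 0)" for p
  define nz where "nz f \<longleftrightarrow> (\<exists>x\<in>D. f x \<noteq> 0)" for f :: "('i \<Rightarrow> 'a) \<Rightarrow> 'a"
  have nz_mult: "nz (\<lambda>x. f x * f' x)" if "f \<in> polyfun (insert j K)" "f' \<in> polyfun (insert j K)" "nz f" "nz f'" for f f'
  proof -
    obtain x where "x \<in> D" "f x \<noteq> 0" "f' x \<noteq> 0"
      using irrD[OF D \<open>f \<in> _\<close> \<open>f' \<in> _\<close>] \<open>nz f\<close> \<open>nz f'\<close> unfolding nz_def by blast
    then show ?thesis unfolding nz_def by auto
  qed
  have up: "f \<in> polyfun (insert j K)" if "f \<in> polyfun K" for f using polyfun_mono[OF that] by blast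
  obtain pg where pg: "coeffs_in K pg" "\<And>x. g x = peval pg x (x j)"
    using polyfun_imp_peval[OF g j] by blast
  have upd: "peval p (b(j := s)) ((b(j := s)) j) = peval p b s" if "coeffs_in K p" for p b s
    using peval_fun_upd[OF that j] by simp
  have nz_coeff: "\<exists>i. \<exists>x\<in>D. coeff p i x \<noteq> 0" if "coeffs_in K p" "\<not> I p" for p
  proof (rule ccontr)
    assume "\<not> ?thesis"
    then have "peval p x t = 0" if "x \<in> D" for x t
      using that by (simp add: peval_eq_sum[OF order_refl])
    then show False using \<open>coeffs_in K p\<close> \<open>\<not> I p\<close> by (simp add: I_def)
  qed
  show ?thesis
  proof (cases "\<forall>p. I p \<longrightarrow> (\<forall>i. \<not> nz (coeff p i))")
    \<comment> \<open>Every equation of \<open>D\<close> has coefficients vanishing on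
      \<open>D\<close>, so the coordinate \<open>j\<close> is free: the whole line over
      \<open>b\<close> lies in the closure, and some point of it is not a zero of
      \<open>g\<close>.\<close>
    case True
    have "\<not> I pg" using gD pg by (auto simp: I_def)
    then obtain i where i: "nz (coeff pg i)" using nz_coeff[OF pg(1)] unfolding nz_def by blast
    show ?thesis
    proof (intro bexI[of _ "coeff pg i"] conjI ballI impI)
      show "coeff pg i \<in> polyfun K" using pg by (simp add: coeffs_in_def)
      show "\<exists>x\<in>D. coeff pg i x \<noteq> 0" using i by (simp add: nz_def)
      fix b assume b: "b \<in> zcl K D" "coeff pg i b \<noteq> 0"
      obtain s where s: "peval pg b s \<noteq> 0" using exists_nonroot[OF b(2)] by blast
      have "b(j := s) \<in> zcl (insert j K) D"
        unfolding zcl_def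
      proof (intro CollectI ballI impI)
        fix f assume f: "f \<in> polyfun (insert j K)" "\<forall>x\<in>D. f x = 0"
        obtain p where p: "coeffs_in K p" "\<And>x. f x = peval p x (x j)"
          using polyfun_imp_peval[OF f(1) j] by blast
        then have "I p" using f by (simp add: I_def)
        then have "coeff p l x = 0" if "x \<in> D" for l x using True that by (auto simp: nz_def)
        then have "coeff p l b = 0" for l
          by (intro zclD[OF b(1), of "coeff p l"]) (use p(1) in \<open>auto simp: coeffs_in_def\<close>)
        then have "peval p b s = 0" by (simp add: peval_eq_sum[OF order_refl])
        then show "f (b(j := s)) = 0" using p upd[OF p(1)] by simp
      qed
      moreover have "g (b(j := s)) \<noteq> 0" using s pg upd[OF pg(1)] by simp
      ultimately show "\<exists>s. b(j := s) \<in> zcl (insert j K) D \<and> g (b(j := s)) \<noteq> 0" by blast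
    qed
  next
    case False
    define M where "M m \<longleftrightarrow> (\<exists>p. I p \<and> nz (lead_coeff p) \<and> degree p = m)" for m
    have "\<exists>m. M m"
    proof -
      obtain p i where "I p" "nz (coeff p i)" using False by blast
      then obtain p' where "coeffs_in K p'" "nz (lead_coeff p')" "\<And>x t. x \<in> D \<Longrightarrow> peval p' x t = peval p x t"
        using strip_leading[of K p D] unfolding I_def nz_def by metis
      then show ?thesis using \<open>I p\<close> unfolding M_def I_def by auto
    qed
    define m where "m = (LEAST m. M m)"
    have "M m" using \<open>\<exists>m. M m\<close> unfolding m_def by (rule LeastI_ex)
    then obtain P where P: "I P" "nz (lead_coeff P)" "degree P = m" unfolding M_def by blast
    have minP: "coeff r i x = 0" if "I r" "degree r < m" "x \<in> D" for r i x
    proof (rule ccontr)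
      assume "coeff r i x \<noteq> 0"
      then obtain p' where "coeffs_in K p'" "degree p' \<le> degree r" "nz (lead_coeff p')"
          "\<And>x t. x \<in> D \<Longrightarrow> peval p' x t = peval r x t"
        using strip_leading[of K r D] \<open>I r\<close> \<open>x \<in> D\<close> unfolding I_def nz_def by metis
      then have "M (degree p')" using \<open>I r\<close> unfolding M_def I_def by auto
      then have "m \<le> degree p'" unfolding m_def by (rule Least_le)
      then show False using that \<open>degree p' \<le> degree r\<close> by simp
    qed
    have cP: "coeffs_in K P" using P by (simp add: I_def)
    have m0: "0 < m"
    proof (rule ccontr)
      assume "\<not> 0 < m"
      then have "peval P x t = lead_coeff P x" for x t using P(3) peval_eq_sum[of P 0 x t] by simp
      then show False using P by (auto simp: I_def nz_def)
    qed
    define a where "a = lead_coeff P"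
    have aK: "a \<in> polyfun K" using cP by (simp add: a_def coeffs_in_def)
    have nza: "nz a" using P by (simp add: a_def)
    have pwr: "(f ^ k) x = f x ^ k" for f :: "('i \<Rightarrow> 'a) \<Rightarrow> 'a" and k x by (induction k) auto
    have nz_pow: "nz (\<lambda>x. f x ^ k)" if "nz f" for f :: "('i \<Rightarrow> 'a) \<Rightarrow> 'a" and k
      using that by (auto simp: nz_def)
    \<comment> \<open>The ideal generated by \<open>g\<close> and the equations of \<open>D\<close>:
      polynomials that agree on \<open>D\<close> with a multiple of \<open>g\<close>.\<close>
    define Q where "Q p \<longleftrightarrow> coeffs_in K p \<and> (\<exists>u. coeffs_in K u \<and> (\<forall>x\<in>D. peval p x (x j) = peval u x (x j) * g x))" for p
    define N where "N r \<longleftrightarrow> (\<exists>p. Q p \<and> \<not> I p \<and> nz (lead_coeff p) \<and> degree p = r)" for r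
    have stripQ: "\<exists>r. N r \<and> r \<le> degree p" if "Q p" "\<not> I p" for p
    proof -
      have cp: "coeffs_in K p" using that by (simp add: Q_def)
      obtain p' where p': "coeffs_in K p'" "degree p' \<le> degree p" "nz (lead_coeff p')"
          "\<And>x t. x \<in> D \<Longrightarrow> peval p' x t = peval p x t"
        using strip_leading[OF cp nz_coeff[OF cp \<open>\<not> I p\<close>]] unfolding nz_def by metis
      then have "Q p'" "\<not> I p'" using that by (auto simp: Q_def I_def)
      then show ?thesis using p' unfolding N_def by blast
    qed
    have "Q pg" unfolding Q_def using pg
      by (auto intro!: exI[of _ "monom (\<lambda>_. 1) 0"] coeffs_in_monom polyfun_intros simp: peval_simps)
    moreover have "\<not> I pg" using gD pg by (auto simp: I_def)
    ultimately have "\<exists>r. N r" using stripQ by blast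
    define r where "r = (LEAST r. N r)"
    have "N r" using \<open>\<exists>r. N r\<close> unfolding r_def by (rule LeastI_ex)
    then obtain R where R: "Q R" "\<not> I R" "nz (lead_coeff R)" "degree R = r" unfolding N_def by blast
    have minR: "r \<le> degree p" if "Q p" "\<not> I p" for p
    proof -
      obtain r' where "N r'" "r' \<le> degree p" using stripQ[OF \<open>Q p\<close> \<open>\<not> I p\<close>] by blast
      then show ?thesis unfolding r_def using Least_le[of N r'] by simp
    qed
    have cR: "coeffs_in K R" using R by (simp add: Q_def)
    obtain u where u: "coeffs_in K u" "\<And>x. x \<in> D \<Longrightarrow> peval R x (x j) = peval u x (x j) * g x"
      using R(1) unfolding Q_def by blast
    define \<beta> where "\<beta> = lead_coeff R"
    have bK: "\<beta> \<in> polyfun K" using cR by (simp add: \<beta>_def coeffs_in_def)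
    have nzR: "nz (\<lambda>x. peval R x (x j))" using R(2) cR by (auto simp: I_def nz_def)
    have r0: "r = 0"
    proof (rule ccontr)
      assume "r \<noteq> 0"
      then have rpos: "0 < r" by simp
      obtain k q \<rho> where 1: "Polynomial.smult (a ^ k) R = P * q + \<rho>" "coeffs_in K q" "coeffs_in K \<rho>" "degree \<rho> < m"
        using pseudo_division[OF cP P(3) m0 cR order_refl] unfolding a_def by blast
      have \<rho>: "peval \<rho> x (x j) = a x ^ k * peval R x (x j)" if "x \<in> D" for x
        using arg_cong[OF 1(1), of "\<lambda>p. peval p x (x j)"] P(1) that by (simp add: peval_simps I_def pwr)
      have "Q \<rho>" unfolding Q_def
      proof (intro conjI exI[of _ "Polynomial.smult (a ^ k) u"] ballI)
        show "coeffs_in K (Polynomial.smult (a ^ k) u)" using u aK by (intro coeffs_in_smult power_polyfun)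
        show "peval \<rho> x (x j) = peval (Polynomial.smult (a ^ k) u) x (x j) * g x" if "x \<in> D" for x
          using \<rho>[OF that] u(2)[OF that] by (simp add: peval_simps pwr)
      qed (use 1 in simp)
      moreover have "nz (\<lambda>x. a x ^ k * peval R x (x j))"
        by (intro nz_mult up polyfun_power aK nz_pow nza nzR peval_imp_polyfun cR)
      then have "\<not> I \<rho>" using \<rho> by (auto simp: I_def nz_def)
      ultimately have "r < m" using minR 1(4) by force
      obtain k q \<rho> where 2: "Polynomial.smult (\<beta> ^ k) P = R * q + \<rho>" "coeffs_in K q" "coeffs_in K \<rho>" "degree \<rho> < r" "degree q \<le> m - r"
        using pseudo_division[OF cR R(4) rpos cP] P(3) unfolding \<beta>_def by blast
      have \<rho>: "peval \<rho> x (x j) = - (peval R x (x j) * peval q x (x j))" if "x \<in> D" for x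
        using arg_cong[OF 2(1), of "\<lambda>p. peval p x (x j)"] P(1) that
        by (simp add: peval_simps I_def pwr) (metis add_eq_0_iff2 add.commute)
      have "Q \<rho>" unfolding Q_def
      proof (intro conjI exI[of _ "0 - q * u"] ballI)
        show "coeffs_in K (0 - q * u)" using u 2 by (intro coeffs_in_diff coeffs_in_mult coeffs_in_zero)
        show "peval \<rho> x (x j) = peval (0 - q * u) x (x j) * g x" if "x \<in> D" for x
          using \<rho>[OF that] u(2)[OF that] by (simp only: peval_simps) (simp add: mult_ac)
      qed (use 2 in simp)
      then have "I \<rho>" using minR[of \<rho>] 2(4) by fastforce
      have "I q"
      proof (rule ccontr)
        assume "\<not> I q"
        then have "nz (\<lambda>x. peval q x (x j))" using 2 by (auto simp: I_def nz_def)
        then have "nz (\<lambda>x. peval R x (x j) * peval q x (x j))"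
          by (intro nz_mult nzR peval_imp_polyfun cR 2)
        then show False using \<rho> \<open>I \<rho>\<close> by (auto simp: I_def nz_def)
      qed
      have q0: "coeff q i x = 0" if "x \<in> D" for i x
        using minP[OF \<open>I q\<close> _ that] 2(5) rpos \<open>r < m\<close> by simp
      have "\<beta> x ^ k * a x = 0" if "x \<in> D" for x
      proof -
        have "coeff (Polynomial.smult (\<beta> ^ k) P) m = coeff (R * q) m"
          unfolding 2(1) using 2(4) \<open>r < m\<close> by (simp add: coeff_eq_0)
        moreover have s: "(sum f A) x = (\<Sum>i\<in>A. f i x)" for f :: "nat \<Rightarrow> ('i \<Rightarrow> 'a) \<Rightarrow> 'a" and A
          by (induction A rule: infinite_finite_induct) auto
        moreover have "coeff (R * q) m x = 0" using that by (simp add: coeff_mult s q0)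
        moreover have "coeff (Polynomial.smult (\<beta> ^ k) P) m x = \<beta> x ^ k * a x" by (simp add: a_def P(3) pwr)
        ultimately show ?thesis by metis
      qed
      moreover have "nz (\<lambda>x. \<beta> x ^ k * a x)"
        by (intro nz_mult up polyfun_power bK aK nz_pow nza) (use R in \<open>simp add: \<beta>_def\<close>)
      ultimately show False by (auto simp: nz_def)
    qed
    have Rb: "peval R x t = \<beta> x" for x t using peval_eq_sum[of R 0 x t] R(4) r0 by (simp add: \<beta>_def)
    show ?thesis
    proof (intro bexI[of _ "\<lambda>x. a x * \<beta> x"] conjI ballI impI)
      show "(\<lambda>x. a x * \<beta> x) \<in> polyfun K" by (intro polyfun_intros aK bK)
      show "\<exists>x\<in>D. a x * \<beta> x \<noteq> 0"
        using nz_mult[OF up[OF aK] up[OF bK] nza] R(3) unfolding nz_def \<beta>_def by simp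
      fix b assume b: "b \<in> zcl K D" and ab: "a b * \<beta> b \<noteq> 0"
      obtain s where s: "peval P b s = 0"
        using exists_root[OF ac, of P m b] ab m0 P(3) unfolding a_def by auto
      have cl: "b(j := s) \<in> zcl (insert j K) D"
        unfolding zcl_def
      proof (intro CollectI ballI impI)
        fix f assume f: "f \<in> polyfun (insert j K)" "\<forall>x\<in>D. f x = 0"
        obtain p where p: "coeffs_in K p" "\<And>x. f x = peval p x (x j)"
          using polyfun_imp_peval[OF f(1) j] by blast
        obtain k q \<rho> where 1: "Polynomial.smult (a ^ k) p = P * q + \<rho>" "coeffs_in K q" "coeffs_in K \<rho>" "degree \<rho> < m"
          using pseudo_division[OF cP P(3) m0 p(1) order_refl] unfolding a_def by blast
        have "peval \<rho> x (x j) = 0" if "x \<in> D" for x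
          using arg_cong[OF 1(1), of "\<lambda>p. peval p x (x j)"] P(1) that f(2) p(2) by (simp add: peval_simps I_def pwr)
        then have "I \<rho>" using 1 by (simp add: I_def)
        then have "coeff \<rho> l b = 0" for l
          by (intro zclD[OF b, of "coeff \<rho> l"]) (use 1 minP in \<open>auto simp: coeffs_in_def\<close>)
        then have "peval \<rho> b s = 0" by (simp add: peval_eq_sum[OF order_refl])
        then have "a b ^ k * peval p b s = 0"
          using arg_cong[OF 1(1), of "\<lambda>p. peval p b s"] s by (simp add: peval_simps pwr)
        then show "f (b(j := s)) = 0" using p upd[OF p(1)] ab by simp
      qed
      have "peval (R - u * pg) (b(j := s)) ((b(j := s)) j) = 0"
        by (rule zclD[OF cl peval_imp_polyfun])
          (use u pg cR in \<open>auto simp: peval_simps intro!: coeffs_in_diff coeffs_in_mult\<close>)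
      then have "\<beta> (b(j := s)) = peval u (b(j := s)) s * g (b(j := s))"
        by (simp add: peval_simps Rb pg(2))
      moreover have "\<beta> (b(j := s)) = \<beta> b" by (rule polyfun_cong[OF bK]) (use j in auto)
      ultimately show "\<exists>s. b(j := s) \<in> zcl (insert j K) D \<and> g (b(j := s)) \<noteq> 0" using cl ab by auto
    qed
  qed
qed

text \<open>The coordinates in \<open>J\<close> are eliminated one at a time; the nonvanishing
  condition produced by one elimination is the \<open>g\<close> of the next. The points found lie in
  the closure of \<open>D\<close>, which suffices for properties expressed by equations.\<close>

lemma chevalley:
  fixes D :: "('i \<Rightarrow> 'a::field_char_0) set"
  assumes ac: "alg_closed TYPE('a)" and "finite J" "J \<inter> K = {}" "irr (K \<union> J) D"
    and "g \<in> polyfun (K \<union> J)" "\<exists>x\<in>D. g x \<noteq> 0"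
  shows "\<exists>h\<in>polyfun K. (\<exists>x\<in>D. h x \<noteq> 0) \<and>
     (\<forall>b\<in>zcl K D. h b \<noteq> 0 \<longrightarrow> (\<exists>b'\<in>zcl (K \<union> J) D. (\<forall>i. i \<notin> J \<longrightarrow> b' i = b i) \<and> g b' \<noteq> 0))"
  using assms(2-)
proof (induction J arbitrary: g rule: finite_induct)
  case empty
  then show ?case by (intro bexI[of _ g]) auto
next
  case (insert j J)
  have "j \<notin> K \<union> J" "insert j (K \<union> J) = K \<union> insert j J" using insert by auto
  then have *: "j \<notin> K \<union> J" "irr (insert j (K \<union> J)) D" "g \<in> polyfun (insert j (K \<union> J))"
    using insert.prems by auto
  obtain h1 where h1: "h1 \<in> polyfun (K \<union> J)" "\<exists>x\<in>D. h1 x \<noteq> 0"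
    "\<And>b. b \<in> zcl (K \<union> J) D \<Longrightarrow> h1 b \<noteq> 0 \<Longrightarrow> \<exists>s. b(j := s) \<in> zcl (K \<union> insert j J) D \<and> g (b(j := s)) \<noteq> 0"
    using eliminate_one[OF ac * insert.prems(4)] unfolding Un_insert_right by meson
  have "irr (K \<union> J) D" using insert.prems(2) by (rule irr_mono_coords) auto
  from insert.IH[OF _ this h1(1,2)] insert.prems obtain h where h: "h\<in>polyfun K" "\<exists>x\<in>D. h x \<noteq> 0"
    "\<And>b. b\<in>zcl K D \<Longrightarrow> h b \<noteq> 0 \<Longrightarrow> (\<exists>b'\<in>zcl (K \<union> J) D. (\<forall>i. i \<notin> J \<longrightarrow> b' i = b i) \<and> h1 b' \<noteq> 0)" by auto
  show ?case
  proof (intro bexI[of _ h] conjI ballI impI h(1,2))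
    fix b assume "b \<in> zcl K D" "h b \<noteq> 0"
    with h(3) obtain b' where b': "b' \<in> zcl (K \<union> J) D" "\<forall>i. i \<notin> J \<longrightarrow> b' i = b i" "h1 b' \<noteq> 0" by blast
    with h1(3) obtain s where "b'(j := s) \<in> zcl (K \<union> insert j J) D" "g (b'(j := s)) \<noteq> 0" by blast
    moreover have "\<forall>i. i \<notin> insert j J \<longrightarrow> (b'(j := s)) i = b i" using b' by auto
    ultimately show "\<exists>b'\<in>zcl (K \<union> insert j J) D. (\<forall>i. i \<notin> insert j J \<longrightarrow> b' i = b i) \<and> g b' \<noteq> 0" by blast
  qed
qed

text \<open>Gaussian elimination. Both dimension counts rest on it: that of functions of given
  degree and that of spaces of quadrics.\<close>

lemma homogeneous_system:
  fixes a :: "'b \<Rightarrow> 'p \<Rightarrow> 'a::field"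
  assumes "finite P" "finite I" "card P < card I"
  shows "\<exists>c. (\<exists>i\<in>I. c i \<noteq> 0) \<and> (\<forall>p\<in>P. (\<Sum>i\<in>I. c i * a i p) = 0)"
  using assms
proof (induction P arbitrary: I a rule: finite_induct)
  case empty
  then obtain i where "i \<in> I" by fastforce
  then show ?case by (intro exI[of _ "\<lambda>_. 1"]) auto
next
  case (insert p P)
  show ?case
  proof (cases "\<forall>i\<in>I. a i p = 0")
    case True
    then show ?thesis using insert.IH[of I a] insert.prems insert.hyps by auto
  next
    case False
    then obtain k where k: "k \<in> I" "a k p \<noteq> 0" by blast
    define a' where "a' i q = a i q - a i p / a k p * a k q" for i q
    have "card P < card (I - {k})" using insert k by simp
    then obtain c where c: "\<exists>i\<in>I - {k}. c i \<noteq> 0" "\<forall>q\<in>P. (\<Sum>i\<in>I - {k}. c i * a' i q) = 0"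
      using insert.IH[of "I - {k}" a'] insert.prems by auto
    define d where "d = - (\<Sum>i\<in>I - {k}. c i * a i p) / a k p"
    define c' where "c' i = (if i = k then d else c i)" for i
    have s: "(\<Sum>i\<in>I. c' i * a i q) = d * a k q + (\<Sum>i\<in>I - {k}. c i * a i q)" for q
      using sum.remove[OF insert.prems(1) k(1), of "\<lambda>i. c' i * a i q"] by (simp add: c'_def)
    have "(\<Sum>i\<in>I. c' i * a i q) = 0" if "q \<in> insert p P" for q
    proof (cases "q = p")
      case True
      then show ?thesis unfolding s using k by (simp add: d_def)
    next
      case False
      then have "(\<Sum>i\<in>I - {k}. c i * a' i q) = 0" using c that by auto
      moreover have "(\<Sum>i\<in>I - {k}. c i * a' i q)
          = (\<Sum>i\<in>I - {k}. c i * a i q) - (\<Sum>i\<in>I - {k}. c i * a i p) / a k p * a k q"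
      proof -
        have "(\<Sum>i\<in>I - {k}. c i * a' i q) = (\<Sum>i\<in>I - {k}. c i * a i q - c i * a i p * (a k q / a k p))"
          by (intro sum.cong refl) (simp add: a'_def right_diff_distrib)
        also have "\<dots> = (\<Sum>i\<in>I - {k}. c i * a i q) - (\<Sum>i\<in>I - {k}. c i * a i p) * (a k q / a k p)"
          by (simp only: sum_subtractf sum_distrib_right)
        finally show ?thesis by simp
      qed
      ultimately show ?thesis unfolding s d_def by simp
    qed
    moreover have "\<exists>i\<in>I. c' i \<noteq> 0" using c(1) by (auto simp: c'_def)
    ultimately show ?thesis by blast
  qed
qed

subsection \<open>Dimension\<close>

text \<open>Bounding each exponent separately, rather than the total degree, makes the exponents a
  product of intervals, which is trivial to count; boxes still add under multiplication.\<close>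

definition expo :: "nat \<Rightarrow> ('v \<Rightarrow> nat) set" where
  "expo d = {m. \<forall>v. m v \<le> d}"

definition monomial :: "('v::finite \<Rightarrow> nat) \<Rightarrow> ('v \<Rightarrow> 'a::field) \<Rightarrow> 'a" where
  "monomial m x = (\<Prod>v\<in>UNIV. x v ^ m v)"

lemma expo_PiE: "expo d = Pi\<^sub>E UNIV (\<lambda>_. {..d})"
  by (auto simp: expo_def PiE_UNIV_domain)

lemma finite_expo: "finite (expo d :: ('v::finite \<Rightarrow> nat) set)"
  unfolding expo_PiE by (intro finite_PiE) auto

lemma card_expo: "card (expo d :: ('v::finite \<Rightarrow> nat) set) = Suc d ^ card (UNIV :: 'v set)"
  unfolding expo_PiE by (simp add: card_PiE)

lemma expo_mono: "d \<le> e \<Longrightarrow> expo d \<subseteq> expo e"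
  by (auto simp: expo_def intro: order_trans)

definition boxpoly :: "nat \<Rightarrow> (('v::finite \<Rightarrow> 'a::field) \<Rightarrow> 'a) set" where
  "boxpoly d = {f. \<exists>c. \<forall>x. f x = (\<Sum>m\<in>expo d. c m * monomial m x)}"

lemma boxpoly_monomial: "m \<in> expo d \<Longrightarrow> (\<lambda>x. a * monomial m x) \<in> boxpoly d"
  unfolding boxpoly_def
  by (auto intro!: exI[of _ "\<lambda>m'. if m' = m then a else 0"] simp: finite_expo if_distrib[of "\<lambda>z. z * _"] sum.delta cong: if_cong)

lemma boxpoly_add:
  assumes "f \<in> boxpoly d" "g \<in> boxpoly d" shows "(\<lambda>x. f x + g x) \<in> boxpoly d"
proof -
  obtain c c' where "\<forall>x. f x = (\<Sum>m\<in>expo d. c m * monomial m x)" "\<forall>x. g x = (\<Sum>m\<in>expo d. c' m * monomial m x)"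
    using assms unfolding boxpoly_def by blast
  then show ?thesis unfolding boxpoly_def
    by (auto intro!: exI[of _ "\<lambda>m. c m + c' m"] simp: algebra_simps sum.distrib)
qed

lemma boxpoly_sum:
  "(\<And>i. i \<in> I \<Longrightarrow> f i \<in> boxpoly d) \<Longrightarrow> (\<lambda>x. \<Sum>i\<in>I. f i x) \<in> boxpoly d"
proof (induction I rule: infinite_finite_induct)
  case (insert i I)
  then show ?case using boxpoly_add[of "f i" d "\<lambda>x. \<Sum>i\<in>I. f i x"] by simp
qed (auto simp: boxpoly_def intro!: exI[of _ "\<lambda>_. 0"])

lemma boxpoly_mono: assumes "f \<in> boxpoly d" "d \<le> e" shows "f \<in> boxpoly e"
proof -
  obtain c where f: "f = (\<lambda>x. \<Sum>m\<in>expo d. c m * monomial m x)" using assms unfolding boxpoly_def by blast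
  show ?thesis unfolding f using expo_mono[OF assms(2)] by (intro boxpoly_sum boxpoly_monomial) auto
qed

lemma boxpoly_mult:
  assumes "f \<in> boxpoly d" "g \<in> boxpoly e" shows "(\<lambda>x. f x * g x) \<in> boxpoly (d + e)"
proof -
  obtain c where f: "\<And>x. f x = (\<Sum>m\<in>expo d. c m * monomial m x)" using assms unfolding boxpoly_def by blast
  obtain c' where g: "\<And>x. g x = (\<Sum>m\<in>expo e. c' m * monomial m x)" using assms unfolding boxpoly_def by blast
  have "f x * g x = (\<Sum>m\<in>expo d. \<Sum>m'\<in>expo e. (c m * c' m') * monomial (\<lambda>v. m v + m' v) x)" for x
    unfolding f g sum_product by (intro sum.cong refl) (simp add: monomial_def power_add prod.distrib mult_ac)
  moreover have "(\<lambda>v. m v + m' v) \<in> expo (d + e)" if "m \<in> expo d" "m' \<in> expo e" for m m' :: "'a \<Rightarrow> nat"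
    using that by (auto simp: expo_def add_mono)
  ultimately show ?thesis by (simp only:) (intro boxpoly_sum boxpoly_monomial)
qed

lemma polyfun_imp_boxpoly: "f \<in> polyfun UNIV \<Longrightarrow> \<exists>d. f \<in> boxpoly d"
proof (induction rule: polyfun.induct)
  case (polyfun_const a)
  have "(\<lambda>x. a * monomial (\<lambda>_. 0) x) \<in> boxpoly 0" by (rule boxpoly_monomial) (simp add: expo_def)
  then show ?case by (auto simp: monomial_def)
next
  case (polyfun_var i)
  have "(\<lambda>x :: 'a \<Rightarrow> 'b. 1 * monomial (\<lambda>v. if v = i then 1 else 0) x) \<in> boxpoly 1" by (rule boxpoly_monomial) (simp add: expo_def)
  moreover have "(\<lambda>x. 1 * monomial (\<lambda>v. if v = i then 1 else 0) x) = (\<lambda>x :: 'a \<Rightarrow> 'b. x i)"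
    unfolding monomial_def by (rule ext) (simp, subst prod.remove[of _ i], auto intro: prod.neutral)
  ultimately show ?case by (intro exI[of _ 1]) (simp only:)
next
  case (polyfun_add f g)
  then obtain d e where "f \<in> boxpoly d" "g \<in> boxpoly e" by blast
  then have "f \<in> boxpoly (d + e)" "g \<in> boxpoly (d + e)" by (auto elim: boxpoly_mono)
  then show ?case using boxpoly_add by blast
next
  case (polyfun_mult f g)
  then show ?case using boxpoly_mult by blast
qed

text \<open>A lower bound \<open>r\<close> for the Hilbert function of \<open>A\<close> at
  \<open>d\<close>, with the box degree in place of the total degree.\<close>

definition indep_on :: "('v::finite \<Rightarrow> 'a::field) set \<Rightarrow> nat \<Rightarrow> nat \<Rightarrow> bool" where
  "indep_on A d r \<longleftrightarrow> (\<exists>fs. (\<forall>i<r. fs i \<in> boxpoly d) \<and>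
      (\<forall>c. (\<forall>x\<in>A. (\<Sum>i<r. c i * fs i x) = 0) \<longrightarrow> (\<forall>i<r. c i = 0)))"

lemma indep_on_bound:
  assumes "indep_on (A :: ('v::finite \<Rightarrow> 'a::field) set) d r"
  shows "r \<le> Suc d ^ card (UNIV :: 'v set)"
proof (rule ccontr)
  assume "\<not> ?thesis"
  then have c: "card (expo d :: ('v \<Rightarrow> nat) set) < card {..<r}" by (simp add: card_expo)
  obtain fs where fs: "\<And>i. i < r \<Longrightarrow> fs i \<in> boxpoly d"
    "\<And>c. \<forall>x\<in>A. (\<Sum>i<r. c i * fs i x) = 0 \<Longrightarrow> \<forall>i<r. c i = 0" using assms unfolding indep_on_def by blast
  have "\<forall>i. \<exists>a. i < r \<longrightarrow> (\<forall>x. fs i x = (\<Sum>m\<in>expo d. a m * monomial m x))" using fs(1) unfolding boxpoly_def by blast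
  then obtain a where a: "\<And>i x. i < r \<Longrightarrow> fs i x = (\<Sum>m\<in>expo d. a i m * monomial m x)" by metis
  obtain c where c: "\<exists>i\<in>{..<r}. c i \<noteq> 0" "\<forall>m\<in>expo d. (\<Sum>i<r. c i * a i m) = 0"
    using homogeneous_system[OF finite_expo finite_lessThan c, of a] by blast
  have "(\<Sum>i<r. c i * fs i x) = 0" for x
  proof -
    have "(\<Sum>i<r. c i * fs i x) = (\<Sum>i<r. \<Sum>m\<in>expo d. c i * a i m * monomial m x)"
      by (intro sum.cong) (auto simp: a sum_distrib_left mult.assoc)
    also have "\<dots> = (\<Sum>m\<in>expo d. (\<Sum>i<r. c i * a i m) * monomial m x)"
      by (subst sum.swap) (simp add: sum_distrib_right)
    also have "\<dots> = 0" using c by simp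
    finally show ?thesis .
  qed
  then show False using fs(2)[of c] c(1) by auto
qed

lemma boxpoly_imp_polyfun: "f \<in> boxpoly d \<Longrightarrow> f \<in> polyfun UNIV"
proof -
  assume "f \<in> boxpoly d"
  then obtain c where f: "f = (\<lambda>x. \<Sum>m\<in>expo d. c m * monomial m x)" unfolding boxpoly_def by blast
  show ?thesis unfolding f monomial_def by (intro polyfun_intros) auto
qed

text \<open>Multiplication by an equation \<open>g\<close> of \<open>A\<close> in \<open>B\<close> embeds the functions on \<open>B\<close> into the functions on \<open>B\<close>
  that vanish on \<open>A\<close>. Along a chain the number of independent functions of degree \<open>d\<close> therefore grows by
  one power of \<open>d\<close> in each step.\<close>

lemma indep_on_step:
  assumes "indep_on A d a" "indep_on B d' b" "A \<subseteq> B" "irr UNIV B"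
    "g \<in> boxpoly e" "g \<in> polyfun UNIV" "\<And>x. x \<in> A \<Longrightarrow> g x = 0" "\<exists>x\<in>B. g x \<noteq> 0" "e + d' \<le> d"
  shows "indep_on B d (a + b)"
proof -
  obtain fs where fs: "\<And>i. i < a \<Longrightarrow> fs i \<in> boxpoly d"
    "\<And>c. \<forall>x\<in>A. (\<Sum>i<a. c i * fs i x) = 0 \<Longrightarrow> \<forall>i<a. c i = 0" using assms(1) unfolding indep_on_def by blast
  obtain hs where hs: "\<And>i. i < b \<Longrightarrow> hs i \<in> boxpoly d'"
    "\<And>c. \<forall>x\<in>B. (\<Sum>i<b. c i * hs i x) = 0 \<Longrightarrow> \<forall>i<b. c i = 0" using assms(2) unfolding indep_on_def by blast
  define ks where "ks i = (if i < a then fs i else (\<lambda>x. g x * hs (i - a) x))" for i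
  have s: "(\<Sum>i<a + b. c i * ks i x) = (\<Sum>i<a. c i * fs i x) + g x * (\<Sum>i<b. c (a + i) * hs i x)" for c x
  proof -
    have "(\<Sum>i<a + b. c i * ks i x) = (\<Sum>i<a. c i * ks i x) + (\<Sum>i<b. c (a + i) * ks (a + i) x)"
      by (induction b) (auto simp: add.assoc)
    then show ?thesis by (simp add: ks_def sum_distrib_left mult_ac)
  qed
  show ?thesis unfolding indep_on_def
  proof (intro exI[of _ ks] conjI allI impI)
    fix i assume "i < a + b"
    then show "ks i \<in> boxpoly d"
      using fs(1) boxpoly_mono[OF boxpoly_mult[OF assms(5) hs(1)[of "i - a"]] assms(9)] by (auto simp: ks_def)
  next
    fix c i assume c: "\<forall>x\<in>B. (\<Sum>i<a + b. c i * ks i x) = 0" and i: "i < a + b"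
    have "\<forall>x\<in>A. (\<Sum>i<a. c i * fs i x) = 0" using c assms(3,7) unfolding s by force
    then have 1: "\<forall>i<a. c i = 0" by (rule fs(2))
    let ?h = "\<lambda>x. \<Sum>i<b. c (a + i) * hs i x"
    have "\<forall>x\<in>B. ?h x = 0"
    proof (rule ccontr)
      assume "\<not> ?thesis"
      then have "\<exists>x\<in>B. ?h x \<noteq> 0" by blast
      moreover have "hs i \<in> polyfun UNIV" if "i < b" for i using hs(1)[OF that] by (rule boxpoly_imp_polyfun)
      then have "?h \<in> polyfun UNIV" by (intro polyfun_sum polyfun_mult polyfun_const) simp
      ultimately obtain x where "x \<in> B" "g x \<noteq> 0" "?h x \<noteq> 0" using irrD[OF assms(4,6) _ assms(8)] by blast
      then show False using c 1 unfolding s by auto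
    qed
    then have "\<forall>i<b. c (a + i) = 0" using hs(2)[of "\<lambda>i. c (a + i)"] by blast
    then show "c i = 0" using 1 i by (metis add_diff_inverse_nat nat_add_left_cancel_less)
  qed
qed

definition zclosed :: "('i \<Rightarrow> 'a::field) set \<Rightarrow> bool" where
  "zclosed S \<longleftrightarrow> zcl UNIV S = S"

lemma zcl_zcl: "zcl K (zcl K S) = zcl K S"
  by (auto simp: zcl_def)

lemma zclosed_zcl: "zclosed (zcl UNIV S)"
  by (simp add: zclosed_def zcl_zcl)

lemma zclosed_UNIV: "zclosed UNIV"
  using subset_zcl[of UNIV UNIV] by (auto simp: zclosed_def)

lemma irr_zcl: "irr K S \<Longrightarrow> irr K (zcl K S)"
  unfolding irr_def
proof (elim conjE, intro conjI ballI impI)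
  assume "S \<noteq> {}"
  then show "zcl K S \<noteq> {}" using subset_zcl[of S K] by blast
next
  fix f g assume S: "\<forall>f\<in>polyfun K. \<forall>g\<in>polyfun K.
     (\<exists>x\<in>S. f x \<noteq> 0) \<longrightarrow> (\<exists>x\<in>S. g x \<noteq> 0) \<longrightarrow> (\<exists>x\<in>S. f x \<noteq> 0 \<and> g x \<noteq> 0)"
    and fg: "f \<in> polyfun K" "g \<in> polyfun K" "\<exists>x\<in>zcl K S. f x \<noteq> 0" "\<exists>x\<in>zcl K S. g x \<noteq> 0"
  have "\<exists>x\<in>S. f x \<noteq> 0" "\<exists>x\<in>S. g x \<noteq> 0" using fg zclD by blast+
  with S fg obtain x where "x \<in> S" "f x \<noteq> 0 \<and> g x \<noteq> 0" by blast
  then show "\<exists>x\<in>zcl K S. f x \<noteq> 0 \<and> g x \<noteq> 0" using subset_zcl by blast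
qed

text \<open>Along a chain the set \<open>B i\<close> carries at least
  \<open>(M + i) choose i\<close> independent functions of degree \<open>E * M\<close>, which grows
  like \<open>M ^ i\<close>, while \<open>N\<close> variables allow at most
  \<open>(E * M + 1) ^ N\<close>. A chain of length \<open>N + 1\<close> contradicts this for large
  \<open>M\<close>.\<close>

lemma chain_length_bound:
  fixes B :: "nat \<Rightarrow> ('v::finite \<Rightarrow> 'a::field) set"
  assumes B: "\<And>i. i \<le> m \<Longrightarrow> irr UNIV (B i) \<and> zclosed (B i)" and str: "\<And>i. i < m \<Longrightarrow> B i \<subset> B (Suc i)"
  shows "m \<le> card (UNIV :: 'v set)"
proof (rule ccontr)
  let ?N = "card (UNIV :: 'v set)"
  assume "\<not> m \<le> ?N"
  then have m: "Suc ?N \<le> m" by simp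
  have "\<exists>g e. g \<in> boxpoly e \<and> g \<in> polyfun UNIV \<and> (\<forall>x\<in>B i. g x = 0) \<and> (\<exists>x\<in>B (Suc i). g x \<noteq> 0)" if i: "i < m" for i
  proof -
    obtain x where x: "x \<in> B (Suc i)" "x \<notin> zcl UNIV (B i)"
      using str[OF i] B[of i] i unfolding zclosed_def by auto
    then obtain g where "g \<in> polyfun UNIV" "\<forall>x\<in>B i. g x = 0" "g x \<noteq> 0" unfolding zcl_def by blast
    then show ?thesis using x polyfun_imp_boxpoly by blast
  qed
  then obtain g e where ge: "\<And>i. i < m \<Longrightarrow> g i \<in> boxpoly (e i) \<and> g i \<in> polyfun UNIV \<and> (\<forall>x\<in>B i. g i x = 0) \<and> (\<exists>x\<in>B (Suc i). g i x \<noteq> 0)"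
    by metis
  \<comment> \<open>A common degree for all separating equations \<open>g i\<close>; the successor
    keeps it positive.\<close>
  define E where "E = Suc (\<Sum>i<m. e i)"
  have gE: "g i \<in> boxpoly E" if "i < m" for i
    using ge[OF that] boxpoly_mono[of "g i" "e i" E] member_le_sum[of i "{..<m}" e] that by (auto simp: E_def)
  have one: "indep_on (B i) d 1" if "i \<le> m" for i d
  proof -
    have "B i \<noteq> {}" using B[OF that] by (auto simp: irr_def)
    then obtain x where "x \<in> B i" by blast
    moreover have "(\<lambda>x. 1 * monomial (\<lambda>_. 0) x) \<in> boxpoly d" by (rule boxpoly_monomial) (simp add: expo_def)
    ultimately show ?thesis unfolding indep_on_def by (intro exI[of _ "\<lambda>_ x. 1"]) (auto simp: monomial_def)
  qed
  have count: "indep_on (B i) (E * M) ((M + i) choose i)" if "i \<le> m" for i M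
    using that
  proof (induction i arbitrary: M)
    case 0
    then show ?case using one by simp
  next
    case (Suc i)
    then have i: "i < m" "i \<le> m" by auto
    note IHi = Suc.IH
    show ?case
    proof (induction M)
      case 0
      then show ?case using one[OF Suc.prems] by simp
    next
      case (Suc M)
      \<comment> \<open>Pascal's rule: functions for \<open>B i\<close> in degree
        \<open>E * Suc M\<close>, together with \<open>g i\<close> times functions for
        \<open>B (Suc i)\<close> in degree \<open>E * M\<close>.\<close>
      have "indep_on (B (Suc i)) (E * Suc M) ((Suc M + i choose i) + (M + Suc i choose Suc i))"
      proof (rule indep_on_step[OF IHi[OF i(2)] Suc])
        show "B i \<subseteq> B (Suc i)" using str[OF i(1)] by blast
        show "irr UNIV (B (Suc i))" using B[of "Suc i"] i(1) by simp
        show "g i \<in> boxpoly E" by (rule gE[OF i(1)])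
      qed (use ge[OF i(1)] in \<open>simp_all add: boxpoly_imp_polyfun\<close>)
      then show ?case by simp
    qed
  qed
  define K where "K = Suc ?N"
  have bnd: "((M + K) choose K) \<le> Suc (E * M) ^ ?N" for M
    using indep_on_bound[OF count[of K M]] m by (simp add: K_def)
  \<comment> \<open>For \<open>T = M + K\<close> the two bounds say that \<open>T ^ K\<close> is at
    most a constant times \<open>T ^ N\<close>; since \<open>K = N + 1\<close>, this bounds
    \<open>T\<close> itself.\<close>
  have key: "real T \<le> real E ^ ?N * real K ^ K" if "T \<ge> K" for T
  proof -
    define M where "M = T - K"
    have T: "T = M + K" using that by (simp add: M_def)
    have "(real T / real K) ^ K \<le> real (T choose K)"
      using binomial_ge_n_over_k_pow_k[of K T, where 'a=real] that by simp
    also have "\<dots> \<le> real (Suc (E * M) ^ ?N)" using bnd[of M] T by (metis of_nat_le_iff)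
    also have "\<dots> \<le> real ((E * T) ^ ?N)"
    proof -
      have "Suc (E * M) \<le> E * T" unfolding T by (simp add: algebra_simps E_def K_def)
      then show ?thesis using power_mono by (metis of_nat_le_iff zero_le)
    qed
    finally have "(real T / real K) ^ K \<le> real E ^ ?N * real T ^ ?N" by (simp add: power_mult_distrib)
    then have "real T ^ K \<le> (real E ^ ?N * real K ^ K) * real T ^ ?N"
      by (simp add: power_divide K_def divide_simps mult_ac)
    then have "real T ^ ?N * real T \<le> real T ^ ?N * (real E ^ ?N * real K ^ K)" by (simp add: K_def mult_ac)
    moreover have "real T ^ ?N > 0" using that by (simp add: K_def)
    ultimately show ?thesis by simp
  qed
  let ?T = "E ^ ?N * K ^ K + K + 1"
  have "real ?T \<le> real (E ^ ?N * K ^ K)" using key[of ?T] by simp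
  then show False unfolding of_nat_le_iff by simp
qed

text \<open>Chains of affine sets: the cone over a projective set has dimension one more than the set.\<close>

definition adim_ge :: "('v::finite \<Rightarrow> 'a::field) set \<Rightarrow> nat \<Rightarrow> bool" where
  "adim_ge A m \<longleftrightarrow> (\<exists>B. (\<forall>i\<le>m. irr UNIV (B i) \<and> zclosed (B i) \<and> B i \<subseteq> A) \<and> (\<forall>i<m. B i \<subset> B (Suc i)))"

lemma adim_ge_Suc:
  assumes "adim_ge A m" "A \<subset> A'" "irr UNIV A'" "zclosed A'"
  shows "adim_ge A' (Suc m)"
proof -
  obtain B where B: "\<forall>i\<le>m. irr UNIV (B i) \<and> zclosed (B i) \<and> B i \<subseteq> A" "\<forall>i<m. B i \<subset> B (Suc i)"
    using assms unfolding adim_ge_def by blast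
  define B' where "B' i = (if i \<le> m then B i else A')" for i
  have "B' i \<subset> B' (Suc i)" if "i < Suc m" for i
  proof (cases "i = m")
    case True
    then have "B' i \<subseteq> A" "B' (Suc i) = A'" using B(1) by (auto simp: B'_def)
    then show ?thesis using assms(2) by blast
  qed (use that B in \<open>auto simp: B'_def\<close>)
  moreover have "irr UNIV (B' i) \<and> zclosed (B' i) \<and> B' i \<subseteq> A'" for i
    using B(1) psubset_imp_subset[OF assms(2)] assms(3,4) by (auto simp: B'_def)
  ultimately show ?thesis unfolding adim_ge_def by blast
qed

text \<open>If \<open>A\<close> were proper, appending the whole space would produce a chain longer
  than \<open>chain_length_bound\<close> permits.\<close>

lemma adim_ge_full:
  fixes A :: "('v::finite \<Rightarrow> 'a::field_char_0) set"
  assumes "adim_ge A (card (UNIV :: 'v set))"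
  shows "A = UNIV"
proof (rule ccontr)
  assume "A \<noteq> UNIV"
  then have "A \<subset> UNIV" by blast
  from adim_ge_Suc[OF assms this irr_UNIV zclosed_UNIV]
  show False unfolding adim_ge_def using chain_length_bound Suc_n_not_le_n by meson
qed

subsection \<open>Joins and density\<close>

definition lin_closed :: "('v \<Rightarrow> 'a::field) set \<Rightarrow> bool" where
  "lin_closed T \<longleftrightarrow> (\<forall>x\<in>T. \<forall>y\<in>T. \<forall>a b. (\<lambda>v. a * x v + b * y v) \<in> T)"

definition spans :: "('v \<Rightarrow> 'a::field) set \<Rightarrow> bool" where
  "spans S \<longleftrightarrow> (\<forall>T. lin_closed T \<longrightarrow> S \<subseteq> T \<longrightarrow> T = UNIV)"

lemma spans_UNIV: "spans UNIV" by (auto simp: spans_def)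

text \<open>For a closed cone \<open>A\<close> these are the points of its vertex, the ones whose
  join with \<open>A\<close> is \<open>A\<close> itself.\<close>

definition vertex :: "('v \<Rightarrow> 'a::field) set \<Rightarrow> ('v \<Rightarrow> 'a) \<Rightarrow> bool" where
  "vertex A p \<longleftrightarrow> (\<forall>z\<in>A. \<forall>s. (\<lambda>v. z v + s * p v) \<in> A)"

lemma vertexD: "vertex A p \<Longrightarrow> z \<in> A \<Longrightarrow> (\<lambda>v. z v + s * p v) \<in> A"
  by (auto simp: vertex_def)

lemma lin_closed_vertex: "lin_closed {p. vertex A p}"
  unfolding lin_closed_def
proof (intro ballI allI)
  fix x y a b assume x: "x \<in> {p. vertex A p}" and y: "y \<in> {p. vertex A p}"
  show "(\<lambda>v. a * x v + b * y v) \<in> {p. vertex A p}"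
    unfolding vertex_def mem_Collect_eq
  proof (intro ballI allI)
    fix z s assume "z \<in> A"
    then have "(\<lambda>v. z v + (s * a) * x v) \<in> A" using vertexD x by blast
    then have "(\<lambda>v. (z v + (s * a) * x v) + (s * b) * y v) \<in> A"
      using vertexD[of A y "\<lambda>v. z v + (s * a) * x v"] y by blast
    then show "(\<lambda>v. z v + s * (a * x v + b * y v)) \<in> A" by (simp add: algebra_simps)
  qed
qed

text \<open>The vertex points form a linear subspace; if it contained the spanning set
  \<open>B\<close>, translations would carry one point of \<open>A\<close> everywhere.\<close>

lemma exists_non_vertex:
  assumes "spans B" "A \<noteq> UNIV" "A \<noteq> {}"
  shows "\<exists>p\<in>B. \<not> vertex A p"
proof (rule ccontr)
  assume "\<not> ?thesis"
  then have "B \<subseteq> {p. vertex A p}" by blast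
  then have U: "{p. vertex A p} = UNIV" using assms(1) lin_closed_vertex unfolding spans_def by blast
  obtain z where "z \<in> A" using assms by blast
  have "x \<in> A" for x
  proof -
    have "(\<lambda>v. z v + 1 * (x v - z v)) \<in> A"
      by (rule vertexD[OF _ \<open>z \<in> A\<close>]) (use U in blast)
    then show ?thesis by simp
  qed
  then show False using assms(2) by blast
qed

definition join :: "('v \<Rightarrow> 'a::field) set \<Rightarrow> ('v \<Rightarrow> 'a) \<Rightarrow> ('v \<Rightarrow> 'a) set" where
  "join A p = zcl UNIV {\<lambda>v. z v + s * p v | z s. z \<in> A}"

lemma subset_join: "A \<subseteq> join A p"
proof
  fix z assume "z \<in> A"
  then have "(\<lambda>v. z v + 0 * p v) \<in> {\<lambda>v. z v + s * p v | z s. z \<in> A}" by blast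
  then show "z \<in> join A p" unfolding join_def using subset_zcl by fastforce
qed

lemma psubset_join: "\<not> vertex A p \<Longrightarrow> A \<subset> join A p"
proof -
  assume "\<not> vertex A p"
  then obtain z s where z: "z \<in> A" "(\<lambda>v. z v + s * p v) \<notin> A" unfolding vertex_def by blast
  then have "(\<lambda>v. z v + s * p v) \<in> join A p" unfolding join_def using subset_zcl by fastforce
  then show ?thesis using z subset_join[of A p] by blast
qed

text \<open>Each function is a nonzero polynomial in the parameter over some point of
  \<open>A\<close>, so one value \<open>t\<close> serves both; translation by \<open>t\<close> times
  \<open>p\<close> then reduces the claim to irreducibility of \<open>A\<close>.\<close>

lemma irr_join:
  fixes A :: "('v \<Rightarrow> 'a::field_char_0) set"
  assumes "irr UNIV A"
  shows "irr UNIV (join A p)"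
  unfolding join_def
proof (rule irr_zcl, unfold irr_def, intro conjI ballI impI)
  show "{\<lambda>v. z v + s * p v | z s. z \<in> A} \<noteq> {}" using assms unfolding irr_def by blast
  fix f g assume f: "f \<in> polyfun UNIV" and g: "g \<in> polyfun UNIV"
    and "\<exists>x\<in>{\<lambda>v. z v + s * p v | z s. z \<in> A}. f x \<noteq> 0" "\<exists>x\<in>{\<lambda>v. z v + s * p v | z s. z \<in> A}. g x \<noteq> 0"
  then obtain z s z' s' where z: "z \<in> A" "f (\<lambda>v. z v + s * p v) \<noteq> 0" "z' \<in> A" "g (\<lambda>v. z' v + s' * p v) \<noteq> 0" by blast
  obtain P Q where P: "\<forall>t. f (\<lambda>i. z i + t * p i) = poly P t" and Q: "\<forall>t. g (\<lambda>i. z' i + t * p i) = poly Q t"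
    using polyfun_line[OF f] polyfun_line[OF g] by meson
  have "P \<noteq> 0" "Q \<noteq> 0" using z P Q by auto
  then have "finite {t. poly (P * Q) t = 0}" by (intro poly_roots_finite) simp
  then obtain t where "poly (P * Q) t \<noteq> 0"
    using infinite_UNIV_char_0[where 'a='a] by (metis (mono_tags, lifting) UNIV_eq_I mem_Collect_eq)
  then have t: "f (\<lambda>i. z i + t * p i) \<noteq> 0" "g (\<lambda>i. z' i + t * p i) \<noteq> 0" using P Q by auto
  have "(\<lambda>x. f (\<lambda>i. x i + t * p i)) \<in> polyfun UNIV" "(\<lambda>x. g (\<lambda>i. x i + t * p i)) \<in> polyfun UNIV"
    by (rule polyfun_compose[OF f] polyfun_compose[OF g]; intro polyfun_intros UNIV_I)+
  from irrD[OF assms this] z t obtain x where "x \<in> A" "f (\<lambda>i. x i + t * p i) \<noteq> 0" "g (\<lambda>i. x i + t * p i) \<noteq> 0" by blast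
  then show "\<exists>x\<in>{\<lambda>v. z v + s * p v | z s. z \<in> A}. f x \<noteq> 0 \<and> g x \<noteq> 0" by blast
qed

section \<open>Tuples of points\<close>

definition block :: "(nat \<times> 'v \<Rightarrow> 'a) \<Rightarrow> nat \<Rightarrow> 'v \<Rightarrow> 'a" where
  "block u i = (\<lambda>v. u (i, v))"

definition set_block :: "(nat \<times> 'v \<Rightarrow> 'a) \<Rightarrow> nat \<Rightarrow> ('v \<Rightarrow> 'a) \<Rightarrow> nat \<times> 'v \<Rightarrow> 'a" where
  "set_block u i x = (\<lambda>(l, v). if l = i then x v else u (l, v))"

lemma block_set_block [simp]: "block (set_block u i x) l = (if l = i then x else block u l)"
  by (auto simp: block_def set_block_def)

lemma set_block_block [simp]: "set_block u i (block u i) = u"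
  by (auto simp: block_def set_block_def)

lemma polyfun_set_block:
  assumes "F \<in> polyfun UNIV" "\<And>v. (\<lambda>x. \<phi> x v) \<in> polyfun C" "\<And>i. (\<lambda>x. u x i) \<in> polyfun C"
  shows "(\<lambda>x. F (set_block (u x) i (\<phi> x))) \<in> polyfun C"
proof (rule polyfun_compose[OF assms(1)])
  fix k :: "nat \<times> 'a"
  obtain l v where k: "k = (l, v)" by fastforce
  show "(\<lambda>x. set_block (u x) i (\<phi> x) k) \<in> polyfun C"
    using assms(2)[of v] assms(3)[of "(l, v)"] by (cases "l = i") (simp_all add: k set_block_def)
qed

text \<open>Each join with a point that is not a vertex lengthens a chain of irreducible closed sets, so joining
  \<open>Z\<close> with sufficiently many general points gives the whole space.\<close>

lemma vanish_on_join:
  fixes Z :: "('v::finite \<Rightarrow> 'a::field_char_0) set" and F :: "(nat \<times> 'v \<Rightarrow> 'a) \<Rightarrow> 'a"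
  assumes "finite I" "j \<notin> I" "irr UNIV Z" "zclosed Z" "adim_ge Z m" "m + card I = card (UNIV :: 'v set)"
    "\<And>i. i \<in> I \<Longrightarrow> irr UNIV (A i) \<and> spans (A i)" "F \<in> polyfun UNIV"
    "\<And>u z s. \<forall>i\<in>I. block u i \<in> A i \<Longrightarrow> z \<in> Z \<Longrightarrow> block u j = (\<lambda>v. z v + (\<Sum>l\<in>I. s l * u (l, v))) \<Longrightarrow> F u = 0"
    "\<forall>i\<in>I. block u i \<in> A i"
  shows "F u = 0"
  using assms
proof (induction I arbitrary: Z m F u rule: finite_induct)
  case empty
  have "Z = UNIV" using adim_ge_full[of Z] empty.prems(4,5) by simp
  show ?case
  proof (rule empty.prems(8)[OF empty.prems(9)])
    show "block u j \<in> Z" unfolding \<open>Z = UNIV\<close> by (rule UNIV_I)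
    show "block u j = (\<lambda>v. block u j v + (\<Sum>l\<in>{}. 0 * u (l, v)))" by (rule ext) simp
  qed
next
  case (insert i I)
  have ij: "i \<noteq> j" "j \<notin> I" "i \<notin> I" using insert.hyps insert.prems(1) by auto
  show ?case
  proof (cases "Z = UNIV")
    case True
    show ?thesis
    proof (rule insert.prems(8)[OF insert.prems(9)])
      show "block u j \<in> Z" unfolding \<open>Z = UNIV\<close> by (rule UNIV_I)
      show "block u j = (\<lambda>v. block u j v + (\<Sum>l\<in>insert i I. 0 * u (l, v)))" by (rule ext) simp
    qed
  next
    case False
    have "Z \<noteq> {}" using insert.prems(2) by (auto simp: irr_def)
    then obtain o0 where o0: "o0 \<in> A i" "\<not> vertex Z o0"
      using exists_non_vertex[of "A i" Z] insert.prems(6)[of i] False by auto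
    then obtain z0 s0 where z0: "z0 \<in> Z" "(\<lambda>v. z0 v + s0 * o0 v) \<notin> Z" unfolding vertex_def by blast
    then obtain f where f: "f \<in> polyfun UNIV" "\<And>x. x \<in> Z \<Longrightarrow> f x = 0" "f (\<lambda>v. z0 v + s0 * o0 v) \<noteq> 0"
      using insert.prems(3) unfolding zclosed_def zcl_def by blast
    \<comment> \<open>Nonvanishing of \<open>p\<close> certifies that a point is not a vertex of
      \<open>Z\<close>, and \<open>o0\<close> shows that this open condition can be met on
      \<open>A i\<close>.\<close>
    define p where "p x = f (\<lambda>v. z0 v + s0 * x v)" for x
    have p: "p \<in> polyfun UNIV" unfolding p_def by (rule polyfun_compose[OF f(1)]) (intro polyfun_intros UNIV_I)
    have claim: "F u = 0" if u: "\<forall>l\<in>insert i I. block u l \<in> A l" and "p (block u i) \<noteq> 0" for u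
    proof -
      let ?o = "block u i"
      have nv: "\<not> vertex Z ?o"
      proof
        assume "vertex Z ?o"
        then have "(\<lambda>v. z0 v + s0 * ?o v) \<in> Z" by (rule vertexD[OF _ z0(1)])
        then show False using f(2) that(2) unfolding p_def by blast
      qed
      \<comment> \<open>The point \<open>?o\<close> is absorbed into the join: one index of
        \<open>I\<close> is traded for one more step of the chain, and block \<open>i\<close> is
        frozen in \<open>F\<close>.\<close>
      have "(\<lambda>w. F (set_block w i ?o)) u = 0"
      proof (rule insert.IH[where F = "\<lambda>w. F (set_block w i ?o)" and Z = "join Z ?o" and m = "Suc m"])
        show "j \<notin> I" by fact
        show "irr UNIV (join Z ?o)" by (rule irr_join[OF insert.prems(2)])
        show "zclosed (join Z ?o)" unfolding join_def by (rule zclosed_zcl)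
        show "adim_ge (join Z ?o) (Suc m)"
          by (rule adim_ge_Suc[OF insert.prems(4) psubset_join[OF nv]]) fact+
        show "Suc m + card I = card (UNIV :: 'v set)" using insert.prems(5) insert.hyps by simp
        show "irr UNIV (A l) \<and> spans (A l)" if "l \<in> I" for l using insert.prems(6) that by blast
        show "(\<lambda>w. F (set_block w i ?o)) \<in> polyfun UNIV"
          by (rule polyfun_set_block[OF insert.prems(7)]; intro polyfun_intros UNIV_I)
        show "\<forall>l\<in>I. block u l \<in> A l" using u by blast
        fix w z' s
        assume w: "\<forall>l\<in>I. block w l \<in> A l" and z': "z' \<in> join Z ?o"
          and wj: "block w j = (\<lambda>v. z' v + (\<Sum>l\<in>I. s l * w (l, v)))"
        define w' where "w' = set_block w i ?o"
        \<comment> \<open>As a function of the join point alone, \<open>G\<close> vanishes on the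
          sums \<open>z + t ?o\<close>, hence on their closure.\<close>
        define G where "G x = F (set_block w' j (\<lambda>v. x v + (\<Sum>l\<in>I. s l * w (l, v))))" for x
        have G: "G \<in> polyfun UNIV" unfolding G_def
          by (rule polyfun_set_block[OF insert.prems(7)]; intro polyfun_intros UNIV_I)
        have "G x = 0" if "x \<in> {\<lambda>v. z v + t * ?o v | z t. z \<in> Z}" for x
        proof -
          obtain z t where x: "x = (\<lambda>v. z v + t * ?o v)" "z \<in> Z" using \<open>x \<in> _\<close> by blast
          let ?w = "set_block w' j (\<lambda>v. x v + (\<Sum>l\<in>I. s l * w (l, v)))"
          have 1: "\<forall>l\<in>insert i I. block ?w l \<in> A l"
          proof
            fix l assume "l \<in> insert i I"
            then show "block ?w l \<in> A l" using w u ij by (cases "l = i") (auto simp: w'_def)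
          qed
          have 2: "?w (l, v) = (if l = i then ?o v else w (l, v))" if "l \<in> insert i I" for l v
            using that ij by (auto simp: set_block_def w'_def)
          have s: "(\<Sum>l\<in>insert i I. (s(i := t)) l * ?w (l, v)) = t * ?o v + (\<Sum>l\<in>I. s l * w (l, v))" for v
          proof -
            have "(\<Sum>l\<in>I. (s(i := t)) l * ?w (l, v)) = (\<Sum>l\<in>I. s l * w (l, v))"
            proof (rule sum.cong[OF refl])
              fix l assume "l \<in> I"
              then have "l \<noteq> i" using ij by blast
              then show "(s(i := t)) l * ?w (l, v) = s l * w (l, v)" using 2[of l v] \<open>l \<in> I\<close> by simp
            qed
            then show ?thesis using 2[of i v] insert.hyps by simp
          qed
          have 3: "block ?w j = (\<lambda>v. z v + (\<Sum>l\<in>insert i I. (s(i := t)) l * ?w (l, v)))"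
            unfolding s by (simp add: x add.assoc)
          show ?thesis unfolding G_def by (rule insert.prems(8)[OF 1 x(2) 3])
        qed
        then have "G z' = 0" by (rule zclD[OF z'[unfolded join_def] G])
        moreover have "set_block w' j (\<lambda>v. z' v + (\<Sum>l\<in>I. s l * w (l, v))) = w'"
          unfolding wj[symmetric] using ij set_block_block[of w' j] by (simp add: w'_def)
        ultimately show "F (set_block w i ?o) = 0" unfolding G_def w'_def by simp
      qed
      then show ?thesis by simp
    qed
    \<comment> \<open>The genericity assumption on block \<open>i\<close> is now removed: a nonzero
      value of \<open>F\<close> and the condition \<open>p\<close> would be attained at a common
      point of the irreducible set \<open>A i\<close>.\<close>
    show ?thesis
    proof (rule ccontr)
      assume "F u \<noteq> 0"
      define F' where "F' x = F (set_block u i x)" for x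
      have F': "F' \<in> polyfun UNIV" unfolding F'_def by (rule polyfun_set_block[OF insert.prems(7)]; intro polyfun_intros UNIV_I)
      have "F' (block u i) \<noteq> 0" using \<open>F u \<noteq> 0\<close> by (simp add: F'_def)
      then have F'1: "\<exists>x\<in>A i. F' x \<noteq> 0" using insert.prems(9) by (intro bexI[of _ "block u i"]) simp_all
      have "p o0 \<noteq> 0" unfolding p_def by (rule f(3))
      then have p1: "\<exists>x\<in>A i. p x \<noteq> 0" using o0(1) by (intro bexI[of _ o0])
      have irrA: "irr UNIV (A i)" using insert.prems(6)[of i] by simp
      obtain x where x: "x \<in> A i" "F' x \<noteq> 0" "p x \<noteq> 0" by (rule irrD[OF irrA F' p F'1 p1])
      have "F (set_block u i x) = 0"
      proof (rule claim)
        show "p (block (set_block u i x) i) \<noteq> 0" using x by simp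
        show "\<forall>l\<in>insert i I. block (set_block u i x) l \<in> A l" using insert.prems(9) x(1) by simp
      qed
      then show False using x(2) by (simp add: F'_def)
    qed
  qed
qed

definition combine :: "nat \<Rightarrow> (nat \<times> nat \<Rightarrow> 'a::field) \<Rightarrow> (nat \<times> 'v \<Rightarrow> 'a) \<Rightarrow> nat \<times> 'v \<Rightarrow> 'a" where
  "combine c g u = (\<lambda>(i, v). \<Sum>l\<le>c. g (i, l) * u (l, v))"

text \<open>The points are freed from \<open>A\<close> one at a time. By
  \<open>vanish_on_join\<close> it suffices to treat a \<open>j\<close>-th point that is a point of
  \<open>A\<close> plus a combination of the \<open>c\<close> others, and this combination is
  absorbed into the matrix \<open>g\<close> by a column operation.\<close>

lemma dense_combine:
  fixes A :: "('v::finite \<Rightarrow> 'a::field_char_0) set"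
  assumes A: "irr UNIV A" "zclosed A" "spans A" "adim_ge A m" and card: "m + c = card (UNIV :: 'v set)"
    and P: "P \<in> polyfun UNIV"
    and vanish: "\<And>g u. \<forall>i\<le>c. block u i \<in> A \<Longrightarrow> P (combine c g u) = 0"
  shows "P (combine c g u) = 0"
proof -
  have "\<forall>g u. (\<forall>i<Suc c - d. block u i \<in> A) \<longrightarrow> P (combine c g u) = 0" if "d \<le> Suc c" for d
    using that
  proof (induction d)
    case 0
    then show ?case using vanish by (auto simp: less_Suc_eq_le)
  next
    case (Suc d)
    define j where "j = c - d"
    have j: "Suc c - d = Suc j" "Suc c - Suc d = j" "j \<le> c" using Suc.prems by (auto simp: j_def)
    have IH: "P (combine c g u) = 0" if "\<forall>i<Suc j. block u i \<in> A" for g u using Suc that j by auto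
    show ?case unfolding j
    proof (intro allI impI)
      fix g :: "nat \<times> nat \<Rightarrow> 'a" and u :: "nat \<times> 'v \<Rightarrow> 'a" assume u: "\<forall>i<j. block u i \<in> A"
      \<comment> \<open>Points before \<open>j\<close> are still restricted to \<open>A\<close>;
        those after \<open>j\<close> are already arbitrary.\<close>
      let ?I = "{..c} - {j}" let ?A = "\<lambda>i. if i < j then A else UNIV"
      have "(\<lambda>u. P (combine c g u)) u = 0"
      proof (rule vanish_on_join[where F = "\<lambda>u. P (combine c g u)" and Z = A and j = j and I = ?I and A = ?A])
        show "m + card ?I = card (UNIV :: 'v set)" using card j by simp
        show "(\<lambda>u. P (combine c g u)) \<in> polyfun UNIV"
          by (rule polyfun_compose[OF P]) (auto simp: combine_def split: prod.splits intro!: polyfun_intros)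
        show "\<forall>i\<in>?I. block u i \<in> ?A i" using u by auto
        show "irr UNIV (?A i) \<and> spans (?A i)" if "i \<in> ?I" for i using A irr_UNIV spans_UNIV by auto
        fix u :: "nat \<times> 'v \<Rightarrow> 'a" and z s
        assume u: "\<forall>i\<in>?I. block u i \<in> ?A i" and z: "z \<in> A" and uj: "block u j = (\<lambda>v. z v + (\<Sum>l\<in>?I. s l * u (l, v)))"
        define g' where "g' = (\<lambda>(i, l). if l = j then g (i, j) else g (i, l) + g (i, j) * s l)"
        let ?u = "set_block u j z"
        have "combine c g u (i, v) = combine c g' ?u (i, v)" for i v
        proof -
          have "combine c g u (i, v) = g (i, j) * u (j, v) + (\<Sum>l\<in>?I. g (i, l) * u (l, v))"
            unfolding combine_def using sum.remove[of "{..c}" j] j by simp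
          also have "u (j, v) = z v + (\<Sum>l\<in>?I. s l * u (l, v))" using fun_cong[OF uj, of v] by (simp add: block_def)
          also have "g (i, j) * (z v + (\<Sum>l\<in>?I. s l * u (l, v))) + (\<Sum>l\<in>?I. g (i, l) * u (l, v))
              = g (i, j) * z v + (\<Sum>l\<in>?I. (g (i, l) + g (i, j) * s l) * u (l, v))"
            by (simp add: algebra_simps sum.distrib sum_distrib_left)
          also have "\<dots> = g' (i, j) * ?u (j, v) + (\<Sum>l\<in>?I. g' (i, l) * ?u (l, v))"
            by (intro arg_cong2[where f = "(+)"] sum.cong) (auto simp: g'_def set_block_def)
          also have "\<dots> = combine c g' ?u (i, v)"
            unfolding combine_def using sum.remove[of "{..c}" j "\<lambda>l. g' (i, l) * ?u (l, v)"] j by simp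
          finally show ?thesis .
        qed
        then have "combine c g u = combine c g' ?u" by auto
        moreover have "\<forall>i<Suc j. block ?u i \<in> A"
        proof (intro allI impI)
          fix i assume "i < Suc j"
          show "block ?u i \<in> A"
          proof (cases "i = j")
            case False
            then have "i < j" "i \<in> ?I" using \<open>i < Suc j\<close> j by auto
            then show ?thesis using bspec[OF u \<open>i \<in> ?I\<close>] False by simp
          qed (use z in simp)
        qed
        ultimately show "P (combine c g u) = 0" using IH by metis
      qed (use A in auto)
      then show "P (combine c g u) = 0" .
    qed
  qed
  from this[of "Suc c"] show ?thesis by simp
qed

section \<open>Invertible matrices\<close>

lemma det_mat_eq_0_iff:
  fixes f :: "nat \<times> nat \<Rightarrow> 'a::field"
  shows "det (mat n n f) = 0 \<longleftrightarrow> (\<exists>v. (\<exists>i<n. v i \<noteq> 0) \<and> (\<forall>a<n. (\<Sum>b<n. f (a, b) * v b) = 0))"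
proof -
  have "det (mat n n f) = 0 \<longleftrightarrow> (\<exists>v. v \<in> carrier_vec n \<and> v \<noteq> 0\<^sub>v n \<and> mat n n f *\<^sub>v v = 0\<^sub>v n)"
    by (rule det_0_iff_vec_prod_zero_field) simp
  also have "\<dots> \<longleftrightarrow> (\<exists>v. (\<exists>i<n. v i \<noteq> 0) \<and> (\<forall>a<n. (\<Sum>b<n. f (a, b) * v b) = 0))"
  proof
    assume "\<exists>v. v \<in> carrier_vec n \<and> v \<noteq> 0\<^sub>v n \<and> mat n n f *\<^sub>v v = 0\<^sub>v n"
    then obtain v where v: "v \<in> carrier_vec n" "v \<noteq> 0\<^sub>v n" "mat n n f *\<^sub>v v = 0\<^sub>v n" by blast
    have 1: "\<exists>i<n. v $ i \<noteq> 0" using v(1,2) by (auto simp: vec_eq_iff)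
    have "(\<Sum>b<n. f (a, b) * v $ b) = 0" if "a < n" for a
      using arg_cong[OF v(3), of "\<lambda>w. w $ a"] that v(1) by (simp add: scalar_prod_def atLeast0LessThan)
    then show "\<exists>v. (\<exists>i<n. v i \<noteq> 0) \<and> (\<forall>a<n. (\<Sum>b<n. f (a, b) * v b) = 0)"
      using 1 by (intro exI[of _ "\<lambda>i. v $ i"]) blast
  next
    assume "\<exists>v. (\<exists>i<n. v i \<noteq> 0) \<and> (\<forall>a<n. (\<Sum>b<n. f (a, b) * v b) = 0)"
    then obtain v where v: "\<exists>i<n. v i \<noteq> 0" "\<forall>a<n. (\<Sum>b<n. f (a, b) * v b) = 0" by blast
    have "mat n n f *\<^sub>v vec n v = 0\<^sub>v n"
      by (rule eq_vecI) (use v(2) in \<open>auto simp: scalar_prod_def atLeast0LessThan\<close>)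
    then show "\<exists>v. v \<in> carrier_vec n \<and> v \<noteq> 0\<^sub>v n \<and> mat n n f *\<^sub>v v = 0\<^sub>v n"
      using v(1) by (intro exI[of _ "vec n v"]) (auto simp: vec_eq_iff)
  qed
  finally show ?thesis .
qed

lemma det_mat_inverse:
  fixes f :: "nat \<times> nat \<Rightarrow> 'a::field"
  assumes "det (mat n n f) \<noteq> 0"
  obtains h where "\<And>a b. a < n \<Longrightarrow> b < n \<Longrightarrow> (\<Sum>l<n. f (a, l) * h (l, b)) = (if a = b then 1 else 0)"
    "\<And>a b. a < n \<Longrightarrow> b < n \<Longrightarrow> (\<Sum>l<n. h (a, l) * f (l, b)) = (if a = b then 1 else 0)"
proof -
  let ?M = "mat n n f"
  have "?M \<in> Units (ring_mat TYPE('a) n ())"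
    by (rule det_non_zero_imp_unit[OF _ assms]) simp
  then obtain B where B: "B \<in> carrier_mat n n" "B * ?M = 1\<^sub>m n" "?M * B = 1\<^sub>m n"
    unfolding Units_def ring_mat_def by auto
  show ?thesis
  proof (rule that[of "\<lambda>(i, j). B $$ (i, j)"])
    fix a b assume ab: "a < n" "b < n"
    show "(\<Sum>l<n. f (a, l) * (case (l, b) of (i, j) \<Rightarrow> B $$ (i, j))) = (if a = b then 1 else 0)"
      using arg_cong[OF B(3), of "\<lambda>M. M $$ (a, b)"] ab B(1)
      by (simp add: scalar_prod_def atLeast0LessThan)
    show "(\<Sum>l<n. (case (a, l) of (i, j) \<Rightarrow> B $$ (i, j)) * f (l, b)) = (if a = b then 1 else 0)"
      using arg_cong[OF B(2), of "\<lambda>M. M $$ (a, b)"] ab B(1)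
      by (simp add: scalar_prod_def atLeast0LessThan)
  qed
qed

lemma polyfun_det:
  assumes "\<And>a b. a < n \<Longrightarrow> b < n \<Longrightarrow> (\<lambda>x. f x (a, b)) \<in> polyfun C"
  shows "(\<lambda>x. det (mat n n (f x))) \<in> polyfun C"
proof -
  have "det (mat n n (f x)) = (\<Sum>p | p permutes {0..<n}. signof p * (\<Prod>i = 0..<n. f x (i, p i)))" for x
    unfolding det_def'[of "mat n n (f x)" n, OF mat_carrier]
  proof (intro sum.cong refl arg_cong2[where f = "(*)"] prod.cong)
    fix p i assume "p \<in> {p. p permutes {0..<n}}" "i \<in> {0..<n}"
    then show "mat n n (f x) $$ (i, p i) = f x (i, p i)" using permutes_in_image[of p "{0..<n}" i] by simp
  qed
  moreover have "(\<lambda>x. \<Sum>p | p permutes {0..<n}. signof p * (\<Prod>i = 0..<n. f x (i, p i))) \<in> polyfun C"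
  proof (intro polyfun_sum polyfun_mult polyfun_prod polyfun_const)
    fix p i assume "p \<in> {p. p permutes {0..<n}}" "i \<in> {0..<n}"
    then show "(\<lambda>x. f x (i, p i)) \<in> polyfun C" using permutes_in_image[of p "{0..<n}" i] by (intro assms) auto
  qed
  ultimately show ?thesis by simp
qed

text \<open>Its determinant is the cofactor of \<open>g\<close> at the entry
  \<open>(0, i)\<close>.\<close>

definition replace_row :: "nat \<Rightarrow> (nat \<times> nat \<Rightarrow> 'a::field) \<Rightarrow> nat \<times> nat \<Rightarrow> 'a" where
  "replace_row i g = (\<lambda>(a, b). if a = 0 then if b = i then 1 else 0 else g (a, b))"

text \<open>The factors indexed by \<open>i\<close> are, up to \<open>det g\<close>, the entries of the first column of the inverse of \<open>g\<close>.\<close>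

definition good_det :: "nat \<Rightarrow> (nat \<times> nat \<Rightarrow> 'a::field) \<Rightarrow> 'a" where
  "good_det c g = det (mat (Suc c) (Suc c) g) * (\<Prod>i\<le>c. det (mat (Suc c) (Suc c) (replace_row i g)))"

lemma good_det_polyfun: "good_det c \<in> polyfun ({..c} \<times> {..c})"
proof -
  have 1: "(\<lambda>g. det (mat (Suc c) (Suc c) g)) \<in> polyfun ({..c} \<times> {..c})"
    by (rule polyfun_det) (auto intro!: polyfun_var)
  have 2: "(\<lambda>g. det (mat (Suc c) (Suc c) (replace_row i g))) \<in> polyfun ({..c} \<times> {..c})" for i
  proof (rule polyfun_det)
    fix a b assume "a < Suc c" "b < Suc c"
    then show "(\<lambda>g. replace_row i g (a, b)) \<in> polyfun ({..c} \<times> {..c})"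
      by (cases "a = 0") (auto simp: replace_row_def intro!: polyfun_intros)
  qed
  have "(\<lambda>g. good_det c g) \<in> polyfun ({..c} \<times> {..c})"
    unfolding good_det_def by (intro polyfun_mult polyfun_prod 1 2)
  then show ?thesis .
qed

lemma good_det_nonzero: "\<exists>g :: nat \<times> nat \<Rightarrow> 'a::field_char_0. good_det c g \<noteq> 0"
proof -
  let ?f = "\<lambda>i g. if i = Suc c then det (mat (Suc c) (Suc c) g) else det (mat (Suc c) (Suc c) (replace_row i g)) :: 'a"
  have "\<exists>g\<in>UNIV. \<forall>i\<in>{..Suc c}. ?f i g \<noteq> 0"
  proof (rule irr_prod[OF irr_UNIV])
    fix i assume i: "i \<in> {..Suc c}"
    have "(\<lambda>g. replace_row i g (a, b)) \<in> polyfun UNIV" for a b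
      by (cases "a = 0") (simp_all add: replace_row_def polyfun_const polyfun_var)
    then have "(\<lambda>g. det (mat (Suc c) (Suc c) (replace_row i g))) \<in> polyfun UNIV" by (rule polyfun_det)
    moreover have "(\<lambda>g. det (mat (Suc c) (Suc c) g)) \<in> polyfun UNIV" by (rule polyfun_det) (rule polyfun_var, simp)
    ultimately show "?f i \<in> polyfun UNIV" by (cases "i = Suc c") simp_all
    \<comment> \<open>The index \<open>Suc c\<close> encodes the factor \<open>det g\<close>, tested
      at the identity matrix. Otherwise \<open>g\<close> is the permutation matrix exchanging
      \<open>0\<close> and \<open>i\<close>; its row \<open>0\<close> already is the
      \<open>i\<close>-th unit vector, so the replacement changes nothing.\<close>
    let ?t = "\<lambda>a. if i = Suc c then a else if a = 0 then i else if a = i then 0 else a"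
    define g where "g = (\<lambda>(a, b). if b = ?t a then 1 else (0::'a))"
    have tt: "?t (?t a) = a" for a by auto
    have tl: "?t a < Suc c" if "a < Suc c" for a using that i by auto
    have s: "(\<Sum>b<Suc c. g (a, b) * v b) = v (?t a)" if "a < Suc c" for a v
    proof -
      have "(\<Sum>b<Suc c. g (a, b) * v b) = (\<Sum>b<Suc c. if ?t a = b then v b else 0)"
        by (rule sum.cong) (auto simp: g_def)
      also have "\<dots> = v (?t a)" using tl[OF that] by (subst sum.delta') auto
      finally show ?thesis .
    qed
    have "det (mat (Suc c) (Suc c) g) \<noteq> 0"
    proof
      assume "det (mat (Suc c) (Suc c) g) = 0"
      then obtain v j where v: "j < Suc c" "v j \<noteq> 0" "\<forall>a<Suc c. (\<Sum>b<Suc c. g (a, b) * v b) = 0"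
        unfolding det_mat_eq_0_iff by blast
      have "v (?t (?t j)) = 0" unfolding s[OF tl[OF v(1)], symmetric] by (rule v(3)[rule_format, OF tl[OF v(1)]])
      then show False unfolding tt using v(2) by blast
    qed
    moreover have "replace_row i g = g" if "i \<noteq> Suc c" using that by (auto simp: replace_row_def g_def)
    ultimately have "?f i g \<noteq> 0" by auto
    then show "\<exists>g\<in>UNIV. ?f i g \<noteq> 0" by blast
  qed simp
  then obtain g where g: "\<And>i. i \<le> Suc c \<Longrightarrow> ?f i g \<noteq> 0" by auto
  have "det (mat (Suc c) (Suc c) g) \<noteq> 0" using g[of "Suc c"] by simp
  moreover have "det (mat (Suc c) (Suc c) (replace_row i g)) \<noteq> 0" if "i \<le> c" for i using g[of i] that by simp
  ultimately show ?thesis unfolding good_det_def by (intro exI[of _ g]) simp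
qed

lemma good_det_inverse:
  fixes g :: "nat \<times> nat \<Rightarrow> 'a::field"
  assumes "good_det c g \<noteq> 0"
  obtains h where "\<And>a b. a \<le> c \<Longrightarrow> b \<le> c \<Longrightarrow> (\<Sum>l\<le>c. g (a, l) * h (l, b)) = (if a = b then 1 else 0)"
    "\<And>a b. a \<le> c \<Longrightarrow> b \<le> c \<Longrightarrow> (\<Sum>l\<le>c. h (a, l) * g (l, b)) = (if a = b then 1 else 0)"
    "\<And>i. i \<le> c \<Longrightarrow> h (i, 0) \<noteq> 0"
proof -
  have "det (mat (Suc c) (Suc c) g) \<noteq> 0" and r: "\<And>i. i \<le> c \<Longrightarrow> det (mat (Suc c) (Suc c) (replace_row i g)) \<noteq> 0"
    using assms unfolding good_det_def by auto
  then obtain h where h: "\<And>a b. a < Suc c \<Longrightarrow> b < Suc c \<Longrightarrow> (\<Sum>l<Suc c. g (a, l) * h (l, b)) = (if a = b then 1 else 0)"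
    "\<And>a b. a < Suc c \<Longrightarrow> b < Suc c \<Longrightarrow> (\<Sum>l<Suc c. h (a, l) * g (l, b)) = (if a = b then 1 else 0)"
    using det_mat_inverse[of "Suc c" g] by blast
  show ?thesis
  proof (rule that[of h])
    show "(\<Sum>l\<le>c. g (a, l) * h (l, b)) = (if a = b then 1 else 0)" if "a \<le> c" "b \<le> c" for a b
      using h(1)[of a b] that by (simp add: lessThan_Suc_atMost)
    show "(\<Sum>l\<le>c. h (a, l) * g (l, b)) = (if a = b then 1 else 0)" if "a \<le> c" "b \<le> c" for a b
      using h(2)[of a b] that by (simp add: lessThan_Suc_atMost)
    show "h (i, 0) \<noteq> 0" if i: "i \<le> c" for i
    proof
      assume z: "h (i, 0) = 0"
      have "det (mat (Suc c) (Suc c) (replace_row i g)) = 0"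
        unfolding det_mat_eq_0_iff
      \<comment> \<open>Column \<open>0\<close> of the inverse is orthogonal to every row of
        \<open>g\<close> except row \<open>0\<close>, and \<open>z\<close> makes it orthogonal to
        the unit vector that replaces row \<open>0\<close>.\<close>
      proof (intro exI[of _ "\<lambda>l. h (l, 0)"] conjI allI impI)
        show "\<exists>l<Suc c. h (l, 0) \<noteq> 0"
        proof (rule ccontr)
          assume "\<not> ?thesis"
          then have "(\<Sum>l<Suc c. g (0, l) * h (l, 0)) = 0" by (intro sum.neutral) auto
          then show False using h(1)[of 0 0] by simp
        qed
        fix a assume a: "a < Suc c"
        show "(\<Sum>b<Suc c. replace_row i g (a, b) * h (b, 0)) = 0"
        proof (cases "a = 0")
          case True
          have "(\<Sum>b<Suc c. replace_row i g (a, b) * h (b, 0)) = (\<Sum>b<Suc c. 0)"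
            by (rule sum.cong) (auto simp: replace_row_def True z)
          then show ?thesis by simp
        next
          case False
          have "(\<Sum>b<Suc c. replace_row i g (a, b) * h (b, 0)) = (\<Sum>b<Suc c. g (a, b) * h (b, 0))"
            by (rule sum.cong) (auto simp: replace_row_def False)
          then show ?thesis using h(1)[of a 0] a False by simp
        qed
      qed
      then show False using r[OF i] by blast
    qed
  qed
qed

text \<open>All unknowns share one index type, so that \<open>chevalley\<close> can eliminate the
  points (\<open>Xcoord\<close>) and the matrix (\<open>Gcoord\<close>) and leave a condition on
  their combinations (\<open>Wcoord\<close>).\<close>

datatype 'v idx = Wcoord nat 'v | Xcoord nat 'v | Gcoord nat nat

definition xset :: "('v idx \<Rightarrow> 'a) \<Rightarrow> nat \<Rightarrow> ('v \<Rightarrow> 'a) \<Rightarrow> 'v idx \<Rightarrow> 'a" where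
  "xset b i x = (\<lambda>k. case k of Xcoord l v \<Rightarrow> if l = i then x v else b k | _ \<Rightarrow> b k)"

definition xs_of :: "('v idx \<Rightarrow> 'a) \<Rightarrow> nat \<times> 'v \<Rightarrow> 'a" where
  "xs_of b = (\<lambda>(i, v). b (Xcoord i v))"

definition gs_of :: "('v idx \<Rightarrow> 'a) \<Rightarrow> nat \<times> nat \<Rightarrow> 'a" where
  "gs_of b = (\<lambda>(i, l). b (Gcoord i l))"

lemma block_xset [simp]: "block (xs_of (xset b i x)) l = (if l = i then x else block (xs_of b) l)"
  by (auto simp: block_def xs_of_def xset_def)

lemma xset_block [simp]: "xset b i (block (xs_of b) i) = b"
  by (rule ext) (auto simp: block_def xs_of_def xset_def split: idx.splits)

lemma polyfun_xset:
  assumes "f \<in> polyfun UNIV"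
  shows "(\<lambda>x. f (xset b i x)) \<in> polyfun UNIV" "(\<lambda>b. f (xset b i x)) \<in> polyfun UNIV"
proof -
  show "(\<lambda>x. f (xset b i x)) \<in> polyfun UNIV"
  proof (rule polyfun_compose[OF assms])
    fix k show "(\<lambda>x. xset b i x k) \<in> polyfun UNIV"
    proof (cases k)
      case (Xcoord l v)
      then show ?thesis by (cases "l = i") (simp_all add: xset_def polyfun_const polyfun_var)
    qed (simp_all add: xset_def polyfun_const polyfun_var)
  qed
  show "(\<lambda>b. f (xset b i x)) \<in> polyfun UNIV"
  proof (rule polyfun_compose[OF assms])
    fix k show "(\<lambda>b. xset b i x k) \<in> polyfun UNIV"
    proof (cases k)
      case (Xcoord l v)
      then show ?thesis by (cases "l = i") (simp_all add: xset_def polyfun_const polyfun_var)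
    qed (simp_all add: xset_def polyfun_const polyfun_var)
  qed
qed

text \<open>Given \<open>f b \<noteq> 0\<close> and \<open>g b' \<noteq> 0\<close>, a block
  \<open>d\<close> is first chosen that is good for both functions, the other coordinates still
  coming from \<open>b\<close> and \<open>b'\<close> respectively; then these are varied with block
  \<open>d\<close> fixed.\<close>

lemma irr_tuples:
  fixes A :: "('v \<Rightarrow> 'a::field_char_0) set"
  assumes A: "irr UNIV A"
  shows "irr UNIV {b. \<forall>i<d. block (xs_of b) i \<in> A}"
proof (induction d)
  case 0
  then show ?case using irr_UNIV by simp
next
  case (Suc d)
  let ?S = "{b. \<forall>i<d. block (xs_of b) i \<in> A}" let ?S' = "{b. \<forall>i<Suc d. block (xs_of b) i \<in> A}"
  have up: "xset b d a \<in> ?S'" if "b \<in> ?S" "a \<in> A" for b a using that by (auto simp: less_Suc_eq)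
  show ?case
    unfolding irr_def
  proof (intro conjI ballI impI)
    obtain b a where "b \<in> ?S" "a \<in> A" using Suc.IH A unfolding irr_def by blast
    then show "?S' \<noteq> {}" using up by blast
    fix f g assume f: "f \<in> polyfun UNIV" and g: "g \<in> polyfun UNIV"
      and "\<exists>x\<in>?S'. f x \<noteq> 0" "\<exists>x\<in>?S'. g x \<noteq> 0"
    then obtain b b' where b: "b \<in> ?S'" "f b \<noteq> 0" "b' \<in> ?S'" "g b' \<noteq> 0" by blast
    have 1: "\<exists>a\<in>A. f (xset b d a) \<noteq> 0" using b by (intro bexI[of _ "block (xs_of b) d"]) auto
    have 2: "\<exists>a\<in>A. g (xset b' d a) \<noteq> 0" using b by (intro bexI[of _ "block (xs_of b') d"]) auto
    obtain a where a: "a \<in> A" "f (xset b d a) \<noteq> 0" "g (xset b' d a) \<noteq> 0"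
      by (rule irrD[OF A polyfun_xset(1)[OF f] polyfun_xset(1)[OF g] 1 2])
    have 3: "\<exists>b\<in>?S. f (xset b d a) \<noteq> 0" using a b by (intro bexI[of _ b]) auto
    have 4: "\<exists>b\<in>?S. g (xset b d a) \<noteq> 0" using a b by (intro bexI[of _ b']) auto
    obtain e where "e \<in> ?S" "f (xset e d a) \<noteq> 0" "g (xset e d a) \<noteq> 0"
      by (rule irrD[OF Suc.IH polyfun_xset(2)[OF f] polyfun_xset(2)[OF g] 3 4])
    then show "\<exists>x\<in>?S'. f x \<noteq> 0 \<and> g x \<noteq> 0" using up[OF _ a(1)] by blast
  qed
qed

text \<open>Its image is the graph of the multiplication of a matrix with a tuple of points.\<close>

definition wmap :: "nat \<Rightarrow> ('v idx \<Rightarrow> 'a::field) \<Rightarrow> 'v idx \<Rightarrow> 'a" where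
  "wmap c b = (\<lambda>k. case k of Wcoord i v \<Rightarrow> (\<Sum>l\<le>c. b (Gcoord i l) * b (Xcoord l v)) | _ \<Rightarrow> b k)"

lemma wmap_simps [simp]:
  "wmap c b (Wcoord i v) = (\<Sum>l\<le>c. b (Gcoord i l) * b (Xcoord l v))" "wmap c b (Xcoord l v) = b (Xcoord l v)" "wmap c b (Gcoord i l) = b (Gcoord i l)"
  by (auto simp: wmap_def)

text \<open>The points \<open>w = g x\<close> with \<open>x\<close> a tuple of points of \<open>A\<close> are dense, so that Chevalley's theorem makes
  a general tuple \<open>w\<close> of this form.\<close>

lemma generic_span:
  fixes A :: "('v::finite \<Rightarrow> 'a::field_char_0) set"
  assumes ac: "alg_closed TYPE('a)"
    and A: "irr UNIV A" "zclosed A" "spans A" "adim_ge A m" and card: "m + c = card (UNIV :: 'v set)"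
    and Q: "Q \<in> polyfun ({..c} \<times> UNIV)" "\<forall>i\<le>c. block u0 i \<in> A" "Q u0 \<noteq> 0"
    and H: "H \<in> polyfun ({..c} \<times> {..c})" "H g0 \<noteq> 0"
  shows "\<exists>P\<in>polyfun ({..c} \<times> UNIV). (\<exists>w. P w \<noteq> 0) \<and> (\<forall>w. P w \<noteq> 0 \<longrightarrow>
    (\<exists>x g. (\<forall>i\<le>c. block x i \<in> A) \<and> Q x \<noteq> 0 \<and> H g \<noteq> 0 \<and> (\<forall>i\<le>c. \<forall>v. w (i, v) = (\<Sum>l\<le>c. g (i, l) * x (l, v)))))"
proof -
  let ?K = "(\<lambda>(i, v). Wcoord i v) ` ({..c} \<times> (UNIV :: 'v set))"
  let ?J = "(\<lambda>(i, v). Xcoord i v) ` ({..c} \<times> (UNIV :: 'v set)) \<union> (\<lambda>(i, l). Gcoord i l) ` ({..c} \<times> {..c})"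
  define D where "D = wmap c ` {b. \<forall>i<Suc c. block (xs_of b) i \<in> A}"
  have fin: "finite ?J" by (intro finite_UnI finite_imageI finite_cartesian_product) auto
  have disj: "?J \<inter> ?K = {}" by auto
  have "irr UNIV D"
    unfolding D_def
  proof (rule irr_image[OF irr_tuples[OF A(1)]])
    fix k :: "'v idx"
    show "(\<lambda>x. wmap c x k) \<in> polyfun UNIV"
      by (cases k) (auto intro!: polyfun_intros)
  qed
  then have irrD: "irr (?K \<union> ?J) D" by (rule irr_mono_coords) simp
  let ?g = "\<lambda>b. Q (xs_of b) * H (gs_of b)"
  have gpoly: "?g \<in> polyfun (?K \<union> ?J)"
    by (intro polyfun_mult polyfun_compose[OF Q(1)] polyfun_compose[OF H(1)])
      (auto simp: xs_of_def gs_of_def intro!: polyfun_var)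
  define b0 where "b0 = (\<lambda>k. case k of Wcoord i v \<Rightarrow> 0 | Xcoord i v \<Rightarrow> u0 (i, v) | Gcoord i l \<Rightarrow> g0 (i, l))"
  have x0: "xs_of (wmap c b0) = u0" "gs_of (wmap c b0) = g0" "xs_of b0 = u0"
    by (auto simp: xs_of_def gs_of_def b0_def)
  have "wmap c b0 \<in> D" unfolding D_def using Q(2) x0 by (auto simp: less_Suc_eq_le)
  moreover have "?g (wmap c b0) \<noteq> 0" using Q H x0 by simp
  ultimately have "\<exists>x\<in>D. ?g x \<noteq> 0" by blast
  from chevalley[OF ac fin disj irrD gpoly this]
  obtain h where h: "h \<in> polyfun ?K" "\<exists>x\<in>D. h x \<noteq> 0"
    "\<And>b. b \<in> zcl ?K D \<Longrightarrow> h b \<noteq> 0 \<Longrightarrow> \<exists>b'\<in>zcl (?K \<union> ?J) D. (\<forall>i. i \<notin> ?J \<longrightarrow> b' i = b i) \<and> ?g b' \<noteq> 0"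
    by blast
  define wp where "wp w = (\<lambda>k. case k of Wcoord i v \<Rightarrow> w (i, v) | _ \<Rightarrow> (0::'a))" for w :: "nat \<times> 'v \<Rightarrow> 'a"
  have wpp: "(\<lambda>w. f (wp w)) \<in> polyfun ({..c} \<times> UNIV)" if "f \<in> polyfun ?K" for f
    by (rule polyfun_compose[OF that]) (auto simp: wp_def intro!: polyfun_var)
  \<comment> \<open>A function of the \<open>Wcoord\<close> coordinates that vanishes on
    \<open>D\<close> vanishes on all combinations of points of \<open>A\<close>, hence by
    \<open>dense_combine\<close> on all combinations whatsoever. The identity matrix
    \<open>?d\<close> then reaches every tuple.\<close>
  have all: "b \<in> zcl ?K D" for b
    unfolding zcl_def
  proof (intro CollectI ballI impI)
    fix f assume f: "f \<in> polyfun ?K" "\<forall>x\<in>D. f x = 0"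
    let ?u = "\<lambda>(i, v). b (Wcoord i v)" let ?d = "\<lambda>(i, l). if i = l then 1 else 0"
    have "f (wp (combine c ?d ?u)) = 0"
    proof (rule dense_combine[OF A card, of "\<lambda>w. f (wp w)"])
      show "(\<lambda>w. f (wp w)) \<in> polyfun UNIV" by (rule polyfun_mono[OF wpp[OF f(1)]]) simp
      fix g u assume u: "\<forall>i\<le>c. block u i \<in> A"
      define b1 where "b1 = (\<lambda>k. case k of Wcoord i v \<Rightarrow> 0 | Xcoord i v \<Rightarrow> u (i, v) | Gcoord i l \<Rightarrow> g (i, l))"
      have "xs_of b1 = u" by (auto simp: xs_of_def b1_def)
      then have "wmap c b1 \<in> D" unfolding D_def using u by (auto simp: less_Suc_eq_le)
      then have "f (wmap c b1) = 0" using f by blast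
      moreover have "f (wp (combine c g u)) = f (wmap c b1)"
        by (rule polyfun_cong[OF f(1)]) (auto simp: wp_def combine_def b1_def)
      ultimately show "f (wp (combine c g u)) = 0" by simp
    qed
    moreover have "f (wp (combine c ?d ?u)) = f b"
    proof (rule polyfun_cong[OF f(1)])
      fix k assume "k \<in> ?K"
      then obtain i v where k: "k = Wcoord i v" "i \<le> c" by auto
      have "(\<Sum>l\<le>c. ?d (i, l) * b (Wcoord l v)) = (\<Sum>l\<le>c. if i = l then b (Wcoord l v) else 0)"
        by (rule sum.cong) auto
      then show "wp (combine c ?d ?u) k = b k" using k by (simp add: wp_def combine_def)
    qed
    ultimately show "f b = 0" by simp
  qed
  show ?thesis
  proof (intro bexI[of _ "\<lambda>w. h (wp w)"] conjI allI impI)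
    show "(\<lambda>w. h (wp w)) \<in> polyfun ({..c} \<times> UNIV)" by (rule wpp[OF h(1)])
    obtain b where b: "h b \<noteq> 0" using h(2) by blast
    have "h (wp (\<lambda>(i, v). b (Wcoord i v))) = h b" by (rule polyfun_cong[OF h(1)]) (auto simp: wp_def)
    then show "\<exists>w. h (wp w) \<noteq> 0" using b by metis
    fix w assume "h (wp w) \<noteq> 0"
    from h(3)[OF all this] obtain b' where b': "b' \<in> zcl (?K \<union> ?J) D" "\<And>i. i \<notin> ?J \<Longrightarrow> b' i = wp w i" "?g b' \<noteq> 0" by blast
    show "\<exists>x g. (\<forall>i\<le>c. block x i \<in> A) \<and> Q x \<noteq> 0 \<and> H g \<noteq> 0 \<and> (\<forall>i\<le>c. \<forall>v. w (i, v) = (\<Sum>l\<le>c. g (i, l) * x (l, v)))"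
    proof (intro exI[of _ "xs_of b'"] exI[of _ "gs_of b'"] conjI allI impI)
      show "Q (xs_of b') \<noteq> 0" "H (gs_of b') \<noteq> 0" using b'(3) by auto
      fix i assume i: "i \<le> c"
      \<comment> \<open>Only the closure of \<open>D\<close> is known to contain \<open>b'\<close>,
        but membership in \<open>A\<close> and the relation between \<open>w\<close>, matrix and
        points are given by equations and survive.\<close>
      have "block (xs_of b') i \<in> zcl UNIV A"
        unfolding zcl_def
      proof (intro CollectI ballI impI)
        fix f assume f: "f \<in> polyfun UNIV" "\<forall>x\<in>A. f x = 0"
        have "(\<lambda>b. f (block (xs_of b) i)) \<in> polyfun (?K \<union> ?J)"
          by (rule polyfun_compose[OF f(1)]) (use i in \<open>auto simp: block_def xs_of_def intro!: polyfun_var\<close>)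
        moreover have "f (block (xs_of x) i) = 0" if "x \<in> D" for x
        proof -
          obtain b where "x = wmap c b" "\<forall>i<Suc c. block (xs_of b) i \<in> A" using \<open>x \<in> D\<close> unfolding D_def by blast
          then have "block (xs_of x) i \<in> A" using i by (simp add: block_def xs_of_def)
          then show ?thesis using f(2) by blast
        qed
        ultimately show "f (block (xs_of b') i) = 0" by (rule zclD[OF b'(1)])
      qed
      then show "block (xs_of b') i \<in> A" using A(2) by (simp add: zclosed_def)
      fix v
      have "(\<lambda>b. b (Wcoord i v) - (\<Sum>l\<le>c. b (Gcoord i l) * b (Xcoord l v))) b' = 0"
        by (rule zclD[OF b'(1)])
          (use i in \<open>auto simp: D_def intro!: polyfun_diff polyfun_sum polyfun_mult polyfun_var\<close>)
      moreover have "Wcoord i v \<notin> ?J" by auto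
      then have "b' (Wcoord i v) = w (i, v)" using b'(2)[of "Wcoord i v"] by (simp add: wp_def)
      ultimately show "w (i, v) = (\<Sum>l\<le>c. gs_of b' (i, l) * xs_of b' (l, v))"
        by (simp add: gs_of_def xs_of_def)
    qed
  qed
qed

subsection \<open>From projective sets to affine cones\<close>

lemma finite_exponents: "finite {m :: 'v::finite \<Rightarrow> nat. sum m UNIV = d}"
proof (rule finite_subset[OF _ finite_expo])
  show "{m :: 'v \<Rightarrow> nat. sum m UNIV = d} \<subseteq> expo d"
  proof
    fix m :: "'v \<Rightarrow> nat" assume "m \<in> {m. sum m UNIV = d}"
    then have "m v \<le> d" for v using member_le_sum[of v UNIV m] by simp
    then show "m \<in> expo d" by (simp add: expo_def)
  qed
qed

lemma heval_monomial: "heval d f x = (\<Sum>m | sum m UNIV = d. f m * monomial m x)"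
  by (simp add: heval_def monomial_def)

lemma heval_polyfun: "heval d f \<in> polyfun UNIV"
proof -
  have "(\<lambda>x. heval d f x) \<in> polyfun UNIV"
    unfolding heval_def by (intro polyfun_sum polyfun_mult polyfun_prod polyfun_power polyfun_const polyfun_var UNIV_I)
  then show ?thesis .
qed

lemma heval_scale: "heval d f (\<lambda>v. t * x v) = t ^ d * heval d f x"
proof -
  have "monomial m (\<lambda>v. t * x v) = t ^ d * monomial m x" if "sum m UNIV = d" for m
    unfolding monomial_def that[symmetric] by (simp add: power_mult_distrib prod.distrib power_sum)
  then show ?thesis unfolding heval_monomial sum_distrib_left by (intro sum.cong) (auto simp: mult_ac)
qed

lemma homogeneous_decomposition:
  fixes f :: "('v::finite \<Rightarrow> 'a::field) \<Rightarrow> 'a"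
  assumes "f \<in> polyfun UNIV"
  shows "\<exists>D F. (\<forall>d. hom_form d (F d)) \<and> (\<forall>x. f x = (\<Sum>d\<le>D. heval d (F d) x))"
proof -
  obtain e c where f: "\<And>x. f x = (\<Sum>m\<in>expo e. c m * monomial m x)"
    using polyfun_imp_boxpoly[OF assms] unfolding boxpoly_def by blast
  define F where "F d m = (if m \<in> expo e \<and> sum m UNIV = d then c m else 0)" for d and m :: "'v \<Rightarrow> nat"
  let ?D = "e * card (UNIV :: 'v set)"
  have F: "heval d (F d) x = (\<Sum>m | m \<in> expo e \<and> sum m UNIV = d. c m * monomial m x)" for d x
    unfolding heval_monomial F_def
    by (rule sum.mono_neutral_cong_right[OF finite_exponents]) auto
  have "f x = (\<Sum>d\<le>?D. heval d (F d) x)" for x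
  proof -
    have "sum m UNIV \<le> ?D" if "m \<in> expo e" for m :: "'v \<Rightarrow> nat"
      using sum_bounded_above[of UNIV m e] that by (simp add: expo_def mult.commute)
    then have "(\<lambda>m :: 'v \<Rightarrow> nat. sum m UNIV) ` expo e \<subseteq> {..?D}" by auto
    from sum.group[OF finite_expo _ this, of "\<lambda>m. c m * monomial m x"]
    show ?thesis unfolding f F by simp
  qed
  moreover have "\<forall>d. hom_form d (F d)" by (auto simp: hom_form_def F_def)
  ultimately show ?thesis by blast
qed

lemma proj_closed_scale:
  assumes "proj_closed S" "x \<in> S" "t \<noteq> 0"
  shows "(\<lambda>v. t * x v) \<in> S"
proof -
  obtain F where S: "S = {x. x \<noteq> 0 \<and> (\<forall>(d, f)\<in>F. heval d f x = 0)}"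
    using assms(1) unfolding proj_closed_def by blast
  have "(\<lambda>v. t * x v) \<noteq> 0"
  proof
    assume "(\<lambda>v. t * x v) = 0"
    then have "t * x v = 0" for v by (metis zero_fun_apply)
    then have "x = 0" using assms(3) by (intro ext) simp
    then show False using assms(2) S by blast
  qed
  then show ?thesis using assms(2) unfolding S by (auto simp: heval_scale)
qed

lemma zero_notin_proj_closed: "proj_closed S \<Longrightarrow> 0 \<notin> S"
  by (auto simp: proj_closed_def)

lemma proj_closed_hypersurface:
  "hom_form d f \<Longrightarrow> proj_closed {x. x \<noteq> 0 \<and> heval d f x = 0}"
  unfolding proj_closed_def by (intro exI[of _ "{(d, f)}"]) auto

text \<open>The second point \<open>x\<close> covers degree \<open>0\<close>, where a form is
  constant and need not vanish at the origin.\<close>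

lemma heval_zero: "heval d f 0 = 0 ^ d * heval d f x"
  using heval_scale[of d f 0 x] by (simp add: zero_fun_def)

lemma zclosed_cone:
  assumes "proj_closed S" "S \<noteq> {}"
  shows "zclosed (insert 0 S)"
proof -
  obtain F where S: "S = {x. x \<noteq> 0 \<and> (\<forall>(d, f)\<in>F. heval d f x = 0)}"
    using assms(1) unfolding proj_closed_def by blast
  obtain z where z: "z \<in> S" using assms by blast
  have "x \<in> insert 0 S" if x: "x \<in> zcl UNIV (insert 0 S)" for x
  proof (rule ccontr)
    assume n: "x \<notin> insert 0 S"
    then obtain d f where df: "(d, f) \<in> F" "heval d f x \<noteq> 0" unfolding S by auto
    have "heval d f y = 0" if "y \<in> insert 0 S" for y
    proof -
      have "heval d f z = 0" using z df(1) unfolding S by auto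
      then show ?thesis using that df(1) heval_zero[of d f z] unfolding S by auto
    qed
    then show False using zclD[OF x heval_polyfun] df(2) by blast
  qed
  then show ?thesis unfolding zclosed_def using subset_zcl[of "insert 0 S" UNIV] by blast
qed

text \<open>Irreducibility is given for homogeneous equations only. Each function has a homogeneous
  component that does not vanish on \<open>Z\<close>; two such components are nonzero at a common
  \<open>y\<close>, and on the line through \<open>y\<close> both functions become nonzero
  polynomials in the scaling parameter.\<close>

lemma irr_cone:
  fixes Z :: "('v::finite \<Rightarrow> 'a::field_char_0) set"
  assumes "proj_irreducible Z"
  shows "irr UNIV (insert 0 Z)"
  unfolding irr_def
proof (intro conjI ballI impI)
  have cl: "proj_closed Z" and ne: "Z \<noteq> {}"
    and ir: "\<And>A B. proj_closed A \<Longrightarrow> proj_closed B \<Longrightarrow> Z \<subseteq> A \<union> B \<Longrightarrow> Z \<subseteq> A \<or> Z \<subseteq> B"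
    using assms unfolding proj_irreducible_def by blast+
  obtain z0 where z0: "z0 \<in> Z" using ne by blast
  fix f g assume f: "f \<in> polyfun UNIV" and g: "g \<in> polyfun UNIV"
    and fg: "\<exists>x\<in>insert 0 Z. f x \<noteq> 0" "\<exists>x\<in>insert 0 Z. g x \<noteq> 0"
  have comp: "\<exists>d\<le>D. \<exists>z\<in>Z. heval d (F d) z \<noteq> 0" if h: "\<exists>x\<in>insert 0 Z. (\<Sum>d\<le>D. heval d (F d) x) \<noteq> 0" for D F
  proof -
    obtain x where x: "x \<in> insert 0 Z" "(\<Sum>d\<le>D. heval d (F d) x) \<noteq> 0" using h by blast
    obtain d where "d \<in> {..D}" and d2: "heval d (F d) x \<noteq> 0"
      using sum.not_neutral_contains_not_neutral[OF x(2)] by blast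
    then have d: "d \<le> D" "heval d (F d) x \<noteq> 0" by simp_all
    show ?thesis
    proof (cases "x = 0")
      case True
      have "heval d (F d) z0 \<noteq> 0"
        using d(2) unfolding True heval_zero[of d "F d" z0] by auto
      then show ?thesis using d(1) z0 by blast
    next
      case False
      then show ?thesis using d x(1) by blast
    qed
  qed
  have pol: "\<exists>p. p \<noteq> 0 \<and> (\<forall>t. (\<Sum>d\<le>D. heval d (F d) (\<lambda>v. t * z v)) = poly p t)"
    if "a \<le> D" "heval a (F a) z \<noteq> 0" for D F a z
  proof (intro exI[of _ "\<Sum>d\<le>D. Polynomial.monom (heval d (F d) z) d"] conjI allI)
    let ?p = "\<Sum>d\<le>D. Polynomial.monom (heval d (F d) z) d"
    have "Polynomial.coeff ?p a = heval a (F a) z" using that(1) by (simp add: coeff_sum)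
    then show "?p \<noteq> 0" using that(2) by auto
    show "(\<Sum>d\<le>D. heval d (F d) (\<lambda>v. t * z v)) = poly ?p t" for t
      by (simp add: poly_sum poly_monom heval_scale mult.commute)
  qed
  obtain D F where F: "\<And>d. hom_form d (F d)" "\<And>x. f x = (\<Sum>d\<le>D. heval d (F d) x)"
    using homogeneous_decomposition[OF f] by blast
  obtain D' F' where F': "\<And>d. hom_form d (F' d)" "\<And>x. g x = (\<Sum>d\<le>D'. heval d (F' d) x)"
    using homogeneous_decomposition[OF g] by blast
  obtain a z where a: "a \<le> D" "z \<in> Z" "heval a (F a) z \<noteq> 0" using comp[OF fg(1)[unfolded F(2)]] by blast
  obtain b z' where b: "b \<le> D'" "z' \<in> Z" "heval b (F' b) z' \<noteq> 0" using comp[OF fg(2)[unfolded F'(2)]] by blast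
  let ?A = "{x. x \<noteq> 0 \<and> heval a (F a) x = 0}" let ?B = "{x. x \<noteq> 0 \<and> heval b (F' b) x = 0}"
  have "\<not> Z \<subseteq> ?A \<union> ?B"
    using ir[OF proj_closed_hypersurface[OF F(1)] proj_closed_hypersurface[OF F'(1)]] a b by blast
  then obtain y where y: "y \<in> Z" "heval a (F a) y \<noteq> 0" "heval b (F' b) y \<noteq> 0"
    using zero_notin_proj_closed[OF cl] by auto
  obtain p where p: "p \<noteq> 0" "\<And>t. f (\<lambda>v. t * y v) = poly p t" using pol[of a D F, OF a(1) y(2)] unfolding F(2)[symmetric] by blast
  obtain q where q: "q \<noteq> 0" "\<And>t. g (\<lambda>v. t * y v) = poly q t" using pol[of b D' F', OF b(1) y(3)] unfolding F'(2)[symmetric] by blast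
  \<comment> \<open>The factor \<open>[:0, 1:]\<close> excludes \<open>t = 0\<close>, which would
    leave \<open>Z\<close>.\<close>
  have "finite {t. poly (p * q * [:0, 1:]) t = 0}" by (rule poly_roots_finite) (use p q in simp)
  then obtain t where "poly (p * q * [:0, 1:]) t \<noteq> 0"
    using infinite_UNIV_char_0[where 'a='a] by (metis (mono_tags, lifting) UNIV_eq_I mem_Collect_eq)
  then have "t \<noteq> 0" "f (\<lambda>v. t * y v) \<noteq> 0" "g (\<lambda>v. t * y v) \<noteq> 0" using p q by auto
  then show "\<exists>x\<in>insert 0 Z. f x \<noteq> 0 \<and> g x \<noteq> 0"
    using proj_closed_scale[OF cl y(1), of t] by blast
qed simp

lemma adim_ge_cone:
  fixes Z :: "('v::finite \<Rightarrow> 'a::field_char_0) set"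
  assumes "dim_ge Z n"
  shows "adim_ge (insert 0 Z) (Suc n)"
proof -
  obtain C where C: "\<And>i. i \<le> n \<Longrightarrow> proj_irreducible (C i) \<and> C i \<subseteq> Z" "\<And>i. i < n \<Longrightarrow> C i \<subset> C (Suc i)"
    using assms unfolding dim_ge_def by blast
  \<comment> \<open>The origin, placed below all cones, supplies the extra step of the
    chain.\<close>
  define B where "B i = (case i of 0 \<Rightarrow> {0} | Suc j \<Rightarrow> insert 0 (C j))" for i
  have pc: "proj_closed (C i)" "C i \<noteq> {}" if "i \<le> n" for i
    using C(1)[OF that] unfolding proj_irreducible_def by auto
  have n0: "0 \<notin> C i" if "i \<le> n" for i using zero_notin_proj_closed pc(1)[OF that] by blast
  have z: "zclosed {0 :: 'v \<Rightarrow> 'a}"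
  proof -
    have "x = 0" if x: "x \<in> zcl UNIV {0 :: 'v \<Rightarrow> 'a}" for x
    proof
      fix v
      show "x v = 0 v" using zclD[OF x polyfun_var[of v]] by simp
    qed
    then show ?thesis unfolding zclosed_def using subset_zcl[of "{0 :: 'v \<Rightarrow> 'a}" UNIV] by blast
  qed
  show ?thesis unfolding adim_ge_def
  proof (intro exI[of _ B] conjI allI impI)
    fix i assume i: "i \<le> Suc n"
    show "irr UNIV (B i)"
    proof (cases i)
      case (Suc j)
      then show ?thesis using irr_cone[of "C j"] C(1)[of j] i by (simp add: B_def)
    qed (simp add: B_def irr_def)
    show "zclosed (B i)"
    proof (cases i)
      case (Suc j)
      then show ?thesis using zclosed_cone[of "C j"] pc[of j] i by (simp add: B_def)
    qed (simp add: B_def z)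
    show "B i \<subseteq> insert 0 Z"
    proof (cases i)
      case (Suc j)
      then show ?thesis using C(1)[of j] i by (auto simp: B_def)
    qed (simp add: B_def)
  next
    fix i assume i: "i < Suc n"
    show "B i \<subset> B (Suc i)"
    proof (cases i)
      case 0
      then show ?thesis using pc(2)[of 0] n0[of 0] by (auto simp: B_def)
    next
      case (Suc j)
      then have "C j \<subset> C (Suc j)" "0 \<notin> C (Suc j)" using C(2)[of j] n0[of "Suc j"] i by auto
      then obtain x where "x \<in> C (Suc j)" "x \<notin> C j" "x \<noteq> 0" by blast
      then have "x \<in> B (Suc i)" "x \<notin> B i" by (simp_all add: B_def Suc)
      moreover have "B i \<subseteq> B (Suc i)" using \<open>C j \<subset> C (Suc j)\<close> by (auto simp: B_def Suc)
      ultimately show ?thesis by blast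
    qed
  qed
qed

text \<open>A basis of \<open>T\<close> stays independent when a vector outside \<open>T\<close> is
  added; the functional that is \<open>1\<close> on that vector and \<open>0\<close> on the basis is
  written out in coordinates. This links \<open>nondegenerate\<close> to
  \<open>spans\<close>.\<close>

lemma proper_subspace_functional:
  fixes T :: "('v::finite \<Rightarrow> 'a::field) set"
  assumes T: "lin_closed T" "T \<noteq> UNIV" "T \<noteq> {}"
  shows "\<exists>l. l \<noteq> 0 \<and> (\<forall>x\<in>T. (\<Sum>v\<in>UNIV. l v * x v) = 0)"
proof -
  interpret V: vector_space "\<lambda>(a :: 'a) (x :: 'v \<Rightarrow> 'a) v. a * x v"
    by standard (auto simp: plus_fun_def algebra_simps)
  interpret F: vector_space "(*) :: 'a \<Rightarrow> 'a \<Rightarrow> 'a"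
    by standard (auto simp: algebra_simps)
  interpret VF: vector_space_pair "\<lambda>(a :: 'a) (x :: 'v \<Rightarrow> 'a) v. a * x v" "(*) :: 'a \<Rightarrow> 'a \<Rightarrow> 'a" ..
  have lc: "(\<lambda>v. a * x v + b * y v) \<in> T" if "x \<in> T" "y \<in> T" for a b x y
    using T(1) that unfolding lin_closed_def by blast
  have sub: "V.subspace T"
    unfolding V.subspace_def
  proof (intro conjI ballI allI)
    obtain x where "x \<in> T" using T(3) by blast
    from lc[OF this this, of 0 0] show "0 \<in> T" by (simp add: zero_fun_def)
    show "x + y \<in> T" if "x \<in> T" "y \<in> T" for x y using lc[OF that, of 1 1] by (simp add: plus_fun_def)
    show "(\<lambda>v. a * x v) \<in> T" if "x \<in> T" for a x using lc[OF that that, of a 0] by simp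
  qed
  obtain B where B: "B \<subseteq> T" "V.independent B" "T \<subseteq> V.span B" by (rule V.maximal_independent_subset)
  have sp: "V.span B = T" using B V.span_minimal[OF B(1) sub] by blast
  obtain p where p: "p \<notin> T" using T(2) by blast
  have "V.independent (insert p B)" using V.independent_insertI[of p B] p sp B(2) by blast
  then obtain g where g: "Vector_Spaces.linear (\<lambda>(a :: 'a) (x :: 'v \<Rightarrow> 'a) v. a * x v) (*) g"
    "\<forall>x\<in>insert p B. g x = (if x = p then 1 else 0)"
    using VF.linear_independent_extend[of "insert p B" "\<lambda>x. if x = p then 1 else 0"] by blast
  interpret g: Vector_Spaces.linear "\<lambda>(a :: 'a) (x :: 'v \<Rightarrow> 'a) v. a * x v" "(*) :: 'a \<Rightarrow> 'a \<Rightarrow> 'a" g by (rule g(1))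
  have "p \<notin> B" using p B(1) by blast
  then have "g x = 0" if "x \<in> B" for x using g(2) that by auto
  then have gT: "g x = 0" if "x \<in> T" for x
    using g.eq_0_on_span[of B x] that sp by blast
  define l where "l v = g (\<lambda>w. if w = v then 1 else 0)" for v
  have sum_at: "(sum f A) w = (\<Sum>v\<in>A. f v w)" for f :: "'v \<Rightarrow> 'v \<Rightarrow> 'a" and A w
    by (induction A rule: infinite_finite_induct) auto
  have gl: "g x = (\<Sum>v\<in>UNIV. l v * x v)" for x
  proof -
    have "x = (\<Sum>v\<in>UNIV. (\<lambda>w. x v * (if w = v then 1 else 0)))"
    proof
      fix w
      have "(\<Sum>v\<in>UNIV. (\<lambda>w. x v * (if w = v then 1 else 0))) w = (\<Sum>v\<in>UNIV. x v * (if w = v then 1 else 0))"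
        by (rule sum_at)
      then show "x w = (\<Sum>v\<in>UNIV. (\<lambda>w. x v * (if w = v then 1 else 0))) w"
        by (simp add: if_distrib[of "\<lambda>z. _ * z"] cong: if_cong)
    qed
    then have "g x = (\<Sum>v\<in>UNIV. g (\<lambda>w. x v * (if w = v then 1 else 0)))" by (metis g.sum)
    also have "\<dots> = (\<Sum>v\<in>UNIV. l v * x v)"
      by (intro sum.cong refl) (subst g.scale, simp add: l_def mult.commute)
    finally show ?thesis .
  qed
  have "g p = 1" using g(2) by simp
  then have "l \<noteq> 0" using gl[of p] by auto
  then show ?thesis using gT gl by metis
qed

lemma spans_cone:
  assumes "nondegenerate X"
  shows "spans (insert 0 X)"
  unfolding spans_def
proof (intro allI impI)
  fix T assume T: "lin_closed T" "insert 0 X \<subseteq> T"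
  show "T = UNIV"
  proof (rule ccontr)
    assume "T \<noteq> UNIV"
    then obtain l where "l \<noteq> 0" "\<forall>x\<in>T. (\<Sum>v\<in>UNIV. l v * x v) = 0"
      using proper_subspace_functional[OF T(1)] T(2) by blast
    then show False using assms T(2) unfolding nondegenerate_def by blast
  qed
qed

subsection \<open>Quadratic forms\<close>

lemma exponent_two:
  fixes m :: "'v::finite \<Rightarrow> nat"
  assumes "sum m UNIV = 2"
  shows "\<exists>a b. m = (\<lambda>v. (if v = a then 1 else 0) + (if v = b then 1 else 0))"
proof -
  obtain a where a: "m a \<noteq> 0" using assms sum.neutral[of UNIV m] by fastforce
  define m' where "m' v = m v - (if v = a then 1 else 0)" for v
  have m: "m v = m' v + (if v = a then 1 else 0)" for v using a by (simp add: m'_def)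
  have "sum m UNIV = sum m' UNIV + 1" by (simp add: m sum.distrib)
  then have "sum m' UNIV = 1" using assms by simp
  then obtain b where b: "m' b = 1" "\<And>v. v \<noteq> b \<Longrightarrow> m' v = 0"
    using sum_eq_1_iff[of UNIV m'] by auto
  then have "m v = (if v = a then 1 else 0) + (if v = b then 1 else 0)" for v
    using m[of v] by (cases "v = b") auto
  then show ?thesis by blast
qed

text \<open>Once two variables are chosen for each monomial, bilinearity of \<open>polar\<close> can
  be checked term by term.\<close>

lemma quadratic_form_shape:
  "\<exists>p q. (\<forall>m :: 'v::finite \<Rightarrow> nat. sum m UNIV = 2 \<longrightarrow> m = (\<lambda>v. (if v = p m then 1 else 0) + (if v = q m then 1 else 0))) \<and>
    (\<forall>f (x :: 'v \<Rightarrow> 'a::field). heval 2 f x = (\<Sum>m | sum m UNIV = 2. f m * (x (p m) * x (q m))))"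
proof -
  have "\<forall>m :: 'v \<Rightarrow> nat. \<exists>a b. sum m UNIV = 2 \<longrightarrow> m = (\<lambda>v. (if v = a then 1 else 0) + (if v = b then 1 else 0))"
    using exponent_two by blast
  then obtain p q where pq: "\<And>m :: 'v \<Rightarrow> nat. sum m UNIV = 2 \<Longrightarrow> m = (\<lambda>v. (if v = p m then 1 else 0) + (if v = q m then 1 else 0))"
    by metis
  have one: "(\<Prod>v\<in>UNIV. x v ^ (if v = a then 1 else 0)) = x a" for x :: "'v \<Rightarrow> 'a" and a
    by (subst prod.remove[of _ a]) (auto intro: prod.neutral)
  have "monomial m x = x (p m) * x (q m)" if "sum m UNIV = 2" for m and x :: "'v \<Rightarrow> 'a"
  proof -
    have "monomial m x = (\<Prod>v\<in>UNIV. x v ^ ((if v = p m then 1 else 0) + (if v = q m then 1 else 0)))"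
      unfolding monomial_def by (subst (1) pq[OF that]) simp
    then show ?thesis by (simp only: power_add prod.distrib one)
  qed
  then have "heval 2 f x = (\<Sum>m | sum m UNIV = 2. f m * (x (p m) * x (q m)))" for f and x :: "'v \<Rightarrow> 'a"
    unfolding heval_monomial by (intro sum.cong) auto
  then show ?thesis using pq by blast
qed

definition polar :: "(('v::finite \<Rightarrow> nat) \<Rightarrow> 'a::field) \<Rightarrow> ('v \<Rightarrow> 'a) \<Rightarrow> ('v \<Rightarrow> 'a) \<Rightarrow> 'a" where
  "polar f x y = heval 2 f (\<lambda>v. x v + y v) - heval 2 f x - heval 2 f y"

lemma polar_linear:
  fixes f :: "('v::finite \<Rightarrow> nat) \<Rightarrow> 'a::field"
  shows "polar f (\<lambda>v. a * x v + b * x' v) y = a * polar f x y + b * polar f x' y"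
proof -
  obtain p q where pq: "\<And>f (x :: 'v \<Rightarrow> 'a). heval 2 f x = (\<Sum>m | sum m UNIV = 2. f m * (x (p m) * x (q m)))"
    using quadratic_form_shape[where 'v = 'v and 'a = 'a] by blast
  have P: "polar f x y = (\<Sum>m | sum m UNIV = 2. f m * (x (p m) * y (q m) + y (p m) * x (q m)))" for x y
    unfolding polar_def pq sum_subtractf[symmetric] by (intro sum.cong refl) (simp add: algebra_simps)
  show ?thesis
    unfolding P sum_distrib_left sum.distrib[symmetric] by (intro sum.cong refl) (simp add: algebra_simps)
qed

lemma polar_commute: "polar f x y = polar f y x"
  by (simp add: polar_def add.commute)

lemma heval_add: "heval 2 f (\<lambda>v. x v + y v) = heval 2 f x + heval 2 f y + polar f x y"
  by (simp add: polar_def)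

lemma polar_scale: "polar f (\<lambda>v. a * x v) y = a * polar f x y"
  using polar_linear[of f a x 0 x y] by simp

lemma polar_self: "polar f x x = 2 * heval 2 f x"
proof -
  have "heval 2 f (\<lambda>v. x v + x v) = 2 ^ 2 * heval 2 f x"
    unfolding mult_2[symmetric] by (rule heval_scale)
  then show ?thesis by (simp add: polar_def)
qed

lemma polar_zero: "polar f (\<lambda>_. 0) y = 0"
  using polar_scale[of f 0 0 y] by simp

lemma polar_sum:
  assumes "finite I"
  shows "polar f (\<lambda>v. \<Sum>i\<in>I. u i * x i v) y = (\<Sum>i\<in>I. u i * polar f (x i) y)"
  using assms
proof (induction I rule: finite_induct)
  case empty
  then show ?case by (simp add: polar_zero)
next
  case (insert i I)
  then show ?case using polar_linear[of f "u i" "x i" 1 "\<lambda>v. \<Sum>i\<in>I. u i * x i v" y] by simp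
qed

lemma heval_two_zero: "heval 2 f (\<lambda>_. 0) = 0"
  using heval_scale[of 2 f 0 "\<lambda>_. 0"] by simp

lemma heval_combination:
  fixes c :: nat
  shows "heval 2 f (\<lambda>v. \<Sum>i\<le>c. u i * x i v) =
     (\<Sum>i\<le>c. (u i)\<^sup>2 * heval 2 f (x i)) + (\<Sum>j\<le>c. \<Sum>i<j. u i * u j * polar f (x i) (x j))"
proof (induction c)
  case 0
  then show ?case by (simp add: heval_scale)
next
  case (Suc c)
  have "polar f (\<lambda>v. \<Sum>i\<le>c. u i * x i v) (\<lambda>v. u (Suc c) * x (Suc c) v)
      = (\<Sum>i<Suc c. u i * u (Suc c) * polar f (x i) (x (Suc c)))"
  proof -
    have "polar f y (\<lambda>v. u (Suc c) * x (Suc c) v) = u (Suc c) * polar f y (x (Suc c))" for y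
      by (subst (1 2) polar_commute) (rule polar_scale)
    then show ?thesis by (simp only: polar_sum[OF finite_atMost] sum_distrib_left lessThan_Suc_atMost mult_ac)
  qed
  then show ?case
    unfolding sum.atMost_Suc heval_add Suc.IH by (simp only: heval_scale add_ac)
qed

lemma heval_lincomb:
  "heval d (\<lambda>m. \<Sum>f\<in>B. c f * f m) x = (\<Sum>f\<in>B. c f * heval d f x)"
  unfolding heval_def sum_distrib_right sum_distrib_left by (subst sum.swap) (simp add: mult_ac)

lemma polar_lincomb:
  "polar (\<lambda>m. \<Sum>f\<in>B. c f * f m) x y = (\<Sum>f\<in>B. c f * polar f x y)"
  by (simp add: polar_def heval_lincomb sum_subtractf right_diff_distrib)

text \<open>Indicator vectors suffice: at \<open>{a}\<close> only the square of that variable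
  survives, and at \<open>{a, b}\<close> only the two squares, already known to have coefficient
  zero, and the mixed monomial.\<close>

lemma quadratic_form_zero:
  fixes f :: "('v::finite \<Rightarrow> nat) \<Rightarrow> 'a::field"
  assumes hom: "hom_form 2 f" and zero: "\<And>x. heval 2 f x = 0"
  shows "f = 0"
proof -
  obtain p q where pq: "\<And>m :: 'v \<Rightarrow> nat. sum m UNIV = 2 \<Longrightarrow> m = (\<lambda>v. (if v = p m then 1 else 0) + (if v = q m then 1 else 0))"
    and ev: "\<And>x :: 'v \<Rightarrow> 'a. heval 2 f x = (\<Sum>m | sum m UNIV = 2. f m * (x (p m) * x (q m)))"
    using quadratic_form_shape[where 'v = 'v and 'a = 'a] by blast
  define e where "e a b = (\<lambda>v. (if v = a then 1 else 0) + (if v = b then 1 else (0::nat)))" for a b :: 'v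
  have se: "sum (e a b) UNIV = 2" for a b by (simp add: e_def sum.distrib)
  have me: "m = e (p m) (q m)" if "sum m UNIV = 2" for m using pq[OF that] unfolding e_def .
  have ec: "e a b = e b a" for a b by (auto simp: e_def)
  have ein: "P \<in> {a, b} \<and> Q \<in> {a, b}" if eq: "e P Q = e a b" for P Q a b
  proof -
    have pos: "e P Q P \<noteq> 0" "e P Q Q \<noteq> 0" by (simp_all add: e_def)
    have out: "e a b v = 0" if "v \<notin> {a, b}" for v using that by (simp add: e_def)
    have "P \<in> {a, b}"
      by (rule ccontr) (use out[of P] pos(1)[unfolded eq] in simp)
    moreover have "Q \<in> {a, b}"
      by (rule ccontr) (use out[of Q] pos(2)[unfolded eq] in simp)
    ultimately show ?thesis ..
  qed
  define ind where "ind S v = (if v \<in> S then 1 else (0::'a))" for S and v :: 'v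
  have val: "f (e a b) = 0" if "\<And>m. sum m UNIV = 2 \<Longrightarrow> m \<noteq> e a b \<Longrightarrow> p m \<in> {a, b} \<Longrightarrow> q m \<in> {a, b} \<Longrightarrow> f m = 0" for a b
  proof -
    let ?g = "\<lambda>m. f m * (ind {a, b} (p m) * ind {a, b} (q m))"
    have pe: "p (e a b) \<in> {a, b}" "q (e a b) \<in> {a, b}"
      using ein[OF me[OF se, symmetric], of a b] by simp_all
    have "0 = (\<Sum>m | sum m UNIV = 2. ?g m)" using ev[of "ind {a, b}"] zero by simp
    also have "\<dots> = ?g (e a b) + sum ?g ({m. sum m UNIV = 2} - {e a b})"
      by (rule sum.remove[OF finite_exponents]) (simp add: se)
    also have "sum ?g ({m. sum m UNIV = 2} - {e a b}) = 0"
    proof (rule sum.neutral, rule ballI)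
      fix m assume "m \<in> {m. sum m UNIV = 2} - {e a b}"
      then have m: "sum m UNIV = 2" "m \<noteq> e a b" by auto
      show "?g m = 0"
        using that[OF m] by (cases "p m \<in> {a, b} \<and> q m \<in> {a, b}") (auto simp: ind_def)
    qed
    finally show ?thesis using pe by (simp add: ind_def)
  qed
  have diag: "f (e a a) = 0" for a
  proof (rule val)
    fix m assume m: "sum m UNIV = 2" "m \<noteq> e a a" "p m \<in> {a, a}" "q m \<in> {a, a}"
    have "e (p m) (q m) \<noteq> e a a" using m(2) unfolding me[OF m(1), symmetric] .
    then show "f m = 0" using m(3,4) by simp
  qed
  have fe: "f (e a b) = 0" for a b
  proof (rule val)
    fix m assume m: "sum m UNIV = 2" "m \<noteq> e a b" "p m \<in> {a, b}" "q m \<in> {a, b}"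
    have "e (p m) (q m) \<noteq> e a b" using m(2) unfolding me[OF m(1), symmetric] .
    then have "q m = p m" using m(3,4) ec[of a b] by auto
    then have "f (e (p m) (q m)) = 0" using diag[of "p m"] by simp
    then show "f m = 0" unfolding me[OF m(1), symmetric] .
  qed
  have "f m = 0" if "sum m UNIV = 2" for m
    using fe[of "p m" "q m"] unfolding me[OF that, symmetric] .
  moreover have "f m = 0" if "sum m UNIV \<noteq> 2" for m using hom that unfolding hom_form_def by blast
  ultimately show ?thesis by (metis ext zero_fun_apply)
qed

text \<open>With more basis elements than functionals, a nontrivial combination of the basis is
  killed by all functionals, hence zero, against independence.\<close>

lemma a2_le_functionals:
  fixes Z :: "('v::finite \<Rightarrow> 'a::field) set"
  assumes fin: "finite J"
    and lin: "\<And>p B c. p \<in> J \<Longrightarrow> \<phi> p (\<lambda>m. \<Sum>f\<in>B. c f * f m) = (\<Sum>f\<in>B. c f * \<phi> p f)"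
    and inj: "\<And>f. f \<in> quadrics_through Z \<Longrightarrow> \<forall>p\<in>J. \<phi> p f = 0 \<Longrightarrow> f = 0"
  shows "a2 Z \<le> card J"
proof -
  interpret V: vector_space "\<lambda>(a :: 'a) (f :: ('v \<Rightarrow> nat) \<Rightarrow> 'a) m. a * f m"
    by standard (auto simp: plus_fun_def algebra_simps)
  obtain B where B: "B \<subseteq> quadrics_through Z" "V.independent B" "card B = V.dim (quadrics_through Z)"
    using V.basis_exists by metis
  have "card B \<le> card J"
  proof (rule ccontr)
    assume n: "\<not> card B \<le> card J"
    \<comment> \<open>Infinite sets have cardinality \<open>0\<close>, so exceeding
      \<open>card J\<close> forces finiteness.\<close>
    then have "finite B" by (metis card.infinite zero_le)
    then obtain c where c: "\<exists>f\<in>B. c f \<noteq> 0" "\<forall>p\<in>J. (\<Sum>f\<in>B. c f * \<phi> p f) = 0"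
      using homogeneous_system[OF fin, of B "\<lambda>f p. \<phi> p f"] n by force
    let ?f = "\<lambda>m. \<Sum>f\<in>B. c f * f m"
    have "?f \<in> quadrics_through Z"
      unfolding quadrics_through_def
    proof (intro CollectI conjI ballI)
      have "f m = 0" if "f \<in> B" "sum m UNIV \<noteq> 2" for f m
        using B(1) that unfolding quadrics_through_def hom_form_def by blast
      then have "?f m = 0" if "sum m UNIV \<noteq> 2" for m
        using that by (intro sum.neutral) auto
      then show "hom_form 2 ?f" unfolding hom_form_def by blast
      fix x assume "x \<in> Z"
      then have "heval 2 f x = 0" if "f \<in> B" for f using B(1) that unfolding quadrics_through_def by blast
      then show "heval 2 ?f x = 0" unfolding heval_lincomb by (intro sum.neutral) auto
    qed
    moreover have "\<forall>p\<in>J. \<phi> p ?f = 0" using lin c(2) by simp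
    ultimately have "?f = 0" by (rule inj)
    moreover have "(\<Sum>f\<in>B. (\<lambda>m. c f * f m)) = ?f"
    proof
      fix m
      have "(sum g A) m = (\<Sum>f\<in>A. g f m)" for g :: "(('v \<Rightarrow> nat) \<Rightarrow> 'a) \<Rightarrow> ('v \<Rightarrow> nat) \<Rightarrow> 'a" and A
        by (induction A rule: infinite_finite_induct) auto
      then show "(\<Sum>f\<in>B. (\<lambda>m. c f * f m)) m = ?f m" by simp
    qed
    ultimately have "(\<Sum>f\<in>B. (\<lambda>m. c f * f m)) = 0" by simp
    then show False using V.independentD[OF B(2) \<open>finite B\<close> order_refl, of c] c(1) by blast
  qed
  then show ?thesis using B(3) by (simp add: a2_def)
qed

subsection \<open>Quadrics and general linear sections\<close>

definition matmul :: "nat \<Rightarrow> (nat \<times> nat \<Rightarrow> 'a::field) \<Rightarrow> (nat \<times> nat \<Rightarrow> 'a) \<Rightarrow> nat \<times> nat \<Rightarrow> 'a" where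
  "matmul c g h = (\<lambda>(i, j). \<Sum>l\<le>c. g (i, l) * h (l, j))"

definition mutual_inverses :: "nat \<Rightarrow> (nat \<times> nat \<Rightarrow> 'a::field) \<Rightarrow> (nat \<times> nat \<Rightarrow> 'a) \<Rightarrow> bool" where
  "mutual_inverses c g h \<longleftrightarrow> (\<forall>i\<le>c. \<forall>j\<le>c. matmul c g h (i, j) = (if i = j then 1 else 0) \<and> matmul c h g (i, j) = (if i = j then 1 else 0))"

lemma sum_inverse:
  assumes "\<And>i. i \<le> c \<Longrightarrow> y i = (\<Sum>l\<le>c. g (i, l) * x l)" "mutual_inverses c g h" "i \<le> c"
  shows "x i = (\<Sum>l\<le>c. h (i, l) * (y l :: 'a::field))"
proof -
  have "(\<Sum>l\<le>c. h (i, l) * y l) = (\<Sum>l\<le>c. \<Sum>j\<le>c. h (i, l) * g (l, j) * x j)"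
    by (intro sum.cong) (simp_all add: assms(1) sum_distrib_left mult.assoc)
  also have "\<dots> = (\<Sum>j\<le>c. matmul c h g (i, j) * x j)"
    by (subst sum.swap) (simp add: matmul_def sum_distrib_right)
  also have "\<dots> = (\<Sum>j\<le>c. if i = j then x j else 0)"
    by (intro sum.cong) (use assms(2,3) in \<open>auto simp: mutual_inverses_def\<close>)
  also have "\<dots> = x i" using assms(3) by simp
  finally show ?thesis by simp
qed

lemma matmul_inverse:
  assumes "mutual_inverses c g h" "mutual_inverses c g' h'" "i \<le> c" "j \<le> c"
  shows "matmul c (matmul c h' g) (matmul c h g') (i, j) = (if i = j then 1 else 0)"
proof -
  have "(\<Sum>l\<le>c. g (r, l) * matmul c h g' (l, j)) = g' (r, j)" if "r \<le> c" for r
  proof -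
    have "(\<Sum>l\<le>c. g (r, l) * matmul c h g' (l, j)) = (\<Sum>l\<le>c. \<Sum>s\<le>c. g (r, l) * h (l, s) * g' (s, j))"
      by (simp add: matmul_def sum_distrib_left mult.assoc)
    also have "\<dots> = (\<Sum>s\<le>c. matmul c g h (r, s) * g' (s, j))"
      by (subst sum.swap) (simp add: matmul_def sum_distrib_right)
    also have "\<dots> = (\<Sum>s\<le>c. if r = s then g' (s, j) else 0)"
      by (intro sum.cong) (use assms(1) that in \<open>auto simp: mutual_inverses_def\<close>)
    also have "\<dots> = g' (r, j)" using that by simp
    finally show ?thesis .
  qed
  note 1 = this
  have "matmul c (matmul c h' g) (matmul c h g') (i, j) = (\<Sum>l\<le>c. \<Sum>r\<le>c. h' (i, r) * (g (r, l) * matmul c h g' (l, j)))"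
    by (simp add: matmul_def[of c "matmul c h' g"] sum_distrib_right mult.assoc) (simp add: matmul_def[of c h' g] sum_distrib_right mult.assoc)
  also have "\<dots> = (\<Sum>r\<le>c. h' (i, r) * (\<Sum>l\<le>c. g (r, l) * matmul c h g' (l, j)))"
    by (subst sum.swap) (simp add: sum_distrib_left)
  also have "\<dots> = (\<Sum>r\<le>c. h' (i, r) * g' (r, j))" by (intro sum.cong) (simp_all add: 1)
  also have "\<dots> = matmul c h' g' (i, j)" by (simp add: matmul_def)
  also have "\<dots> = (if i = j then 1 else 0)" using assms(2-4) by (simp add: mutual_inverses_def)
  finally show ?thesis .
qed

text \<open>\<open>generic_span\<close> is applied to the cone over \<open>Z\<close>. The entry
  \<open>h (i, 0)\<close> is the coefficient of \<open>w\<^sub>0\<close> in the \<open>i\<close>-th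
  spanning point; its nonvanishing keeps that point off the span of the other
  \<open>w\<^sub>l\<close>. \<open>Q\<close> carries any further open condition on the spanning
  points.\<close>

lemma generic_section:
  fixes Z :: "('v::finite \<Rightarrow> 'a::field_char_0) set"
  assumes ac: "alg_closed TYPE('a)" and Z: "proj_irreducible Z" "nondegenerate Z" "dim_ge Z n"
    and card: "card (UNIV :: 'v set) = n + c + 1"
    and Q: "Q \<in> polyfun ({..c} \<times> UNIV)" "\<forall>i\<le>c. block u0 i \<in> insert 0 Z" "Q u0 \<noteq> 0"
  shows "\<exists>P\<in>polyfun UNIV. (\<exists>w. P w \<noteq> 0) \<and> (\<forall>w. P w \<noteq> 0 \<longrightarrow>
      (\<exists>x g h. (\<forall>i\<le>c. block x i \<in> insert 0 Z) \<and> Q x \<noteq> 0 \<and> mutual_inverses c g h \<and>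
        (\<forall>i\<le>c. h (i, 0) \<noteq> 0) \<and> (\<forall>i\<le>c. \<forall>v. w (i, v) = (\<Sum>l\<le>c. g (i, l) * x (l, v)))))"
proof -
  have pc: "proj_closed Z" "Z \<noteq> {}" using Z(1) by (auto simp: proj_irreducible_def)
  obtain g0 :: "nat \<times> nat \<Rightarrow> 'a" where g0: "good_det c g0 \<noteq> 0" using good_det_nonzero by blast
  have card': "Suc n + c = card (UNIV :: 'v set)" using card by simp
  obtain P where P: "P \<in> polyfun ({..c} \<times> UNIV)" "\<exists>w. P w \<noteq> 0"
    "\<And>w. P w \<noteq> 0 \<Longrightarrow> \<exists>x g. (\<forall>i\<le>c. block x i \<in> insert 0 Z) \<and> Q x \<noteq> 0 \<and> good_det c g \<noteq> 0 \<and>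
       (\<forall>i\<le>c. \<forall>v. w (i, v) = (\<Sum>l\<le>c. g (i, l) * x (l, v)))"
    using generic_span[OF ac irr_cone[OF Z(1)] zclosed_cone[OF pc] spans_cone[OF Z(2)] adim_ge_cone[OF Z(3)] card' Q good_det_polyfun g0]
    by blast
  show ?thesis
  proof (intro bexI[of _ P] conjI allI impI)
    show "P \<in> polyfun UNIV" by (rule polyfun_mono[OF P(1)]) simp
    show "\<exists>w. P w \<noteq> 0" by (rule P(2))
    fix w assume "P w \<noteq> 0"
    then obtain x g where x: "\<forall>i\<le>c. block x i \<in> insert 0 Z" "Q x \<noteq> 0" "good_det c g \<noteq> 0"
       "\<forall>i\<le>c. \<forall>v. w (i, v) = (\<Sum>l\<le>c. g (i, l) * x (l, v))" using P(3) by blast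
    obtain h where h: "\<And>a b. a \<le> c \<Longrightarrow> b \<le> c \<Longrightarrow> (\<Sum>l\<le>c. g (a, l) * h (l, b)) = (if a = b then 1 else 0)"
      "\<And>a b. a \<le> c \<Longrightarrow> b \<le> c \<Longrightarrow> (\<Sum>l\<le>c. h (a, l) * g (l, b)) = (if a = b then 1 else 0)"
      "\<And>i. i \<le> c \<Longrightarrow> h (i, 0) \<noteq> 0"
      by (rule good_det_inverse[OF x(3)]) (rule that)
    have "mutual_inverses c g h" using h(1,2) by (simp add: mutual_inverses_def matmul_def)
    then show "\<exists>x g h. (\<forall>i\<le>c. block x i \<in> insert 0 Z) \<and> Q x \<noteq> 0 \<and> mutual_inverses c g h \<and>
        (\<forall>i\<le>c. h (i, 0) \<noteq> 0) \<and> (\<forall>i\<le>c. \<forall>v. w (i, v) = (\<Sum>l\<le>c. g (i, l) * x (l, v)))"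
      using x h(3) by blast
  qed
qed

text \<open>A quadric containing \<open>Z\<close> and the span \<open>L\<close> of \<open>w\<^sub>1, \<dots>, w\<^sub>c\<close> restricts to the span of
  \<open>w\<^sub>0, \<dots>, w\<^sub>c\<close> as a product of two linear forms, one of them defining \<open>L\<close>; the other one vanishes at
  spanning points of \<open>Z\<close> outside \<open>L\<close>, hence is zero. Letting \<open>w\<^sub>0\<close> vary, the quadric vanishes identically.\<close>

lemma quadric_containing_section:
  fixes w :: "nat \<times> 'v::finite \<Rightarrow> 'a::field_char_0"
  assumes P: "P \<in> polyfun UNIV" "P w \<noteq> 0"
    and sec: "\<And>w. P w \<noteq> 0 \<Longrightarrow> \<exists>x g h. (\<forall>i\<le>c. block x i \<in> insert 0 Z) \<and> mutual_inverses c g h \<and>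
        (\<forall>i\<le>c. h (i, 0) \<noteq> 0) \<and> (\<forall>i\<le>c. \<forall>v. w (i, v) = (\<Sum>l\<le>c. g (i, l) * x (l, v)))"
    and f: "\<And>x. x \<in> Z \<Longrightarrow> heval 2 f x = 0"
    and L: "\<And>u. heval 2 f (\<lambda>v. \<Sum>l\<in>{1..c}. u l * w (l, v)) = 0"
  shows "heval 2 f y = 0"
proof -
  have fZ: "heval 2 f x = 0" if "x \<in> insert 0 Z" for x
    using f that heval_two_zero[of f] by (auto simp: zero_fun_def)
  have main: "heval 2 f y = 0" if Py: "P (set_block w 0 y) \<noteq> 0" for y
  proof -
    let ?w = "set_block w 0 y"
    obtain x g h where x: "\<forall>i\<le>c. block x i \<in> insert 0 Z" and gh: "mutual_inverses c g h"
      and h0: "\<forall>i\<le>c. h (i, 0) \<noteq> 0" and wx: "\<forall>i\<le>c. \<forall>v. ?w (i, v) = (\<Sum>l\<le>c. g (i, l) * x (l, v))"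
      using sec[OF Py] by blast
    \<comment> \<open>The coefficients of the second linear form: at the point with coordinates
      \<open>h (i, l)\<close> the quadric has the value \<open>h (i, 0)\<close> times the sum of the
      \<open>h (i, l) * \<mu> l\<close>.\<close>
    define \<mu> where "\<mu> l = (if l = 0 then heval 2 f y else polar f y (block w l))" for l
    have split: "{..c} = insert 0 {1..c}" by auto
    have "(\<Sum>l\<le>c. h (i, l) * \<mu> l) = 0" if i: "i \<le> c" for i
    proof -
      define r where "r = (\<lambda>v. \<Sum>l\<in>{1..c}. h (i, l) * w (l, v))"
      have "x (i, v) = h (i, 0) * y v + r v" for v
      proof -
        have "x (i, v) = (\<Sum>l\<le>c. h (i, l) * ?w (l, v))"
          by (rule sum_inverse[OF _ gh i]) (use wx in blast)
        also have "\<dots> = h (i, 0) * y v + r v"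
          unfolding split r_def by (subst sum.insert) (auto simp: set_block_def intro!: sum.cong)
        finally show ?thesis .
      qed
      then have "block x i = (\<lambda>v. h (i, 0) * y v + r v)" by (auto simp: block_def)
      then have "0 = heval 2 f (\<lambda>v. h (i, 0) * y v + r v)" using fZ x i by metis
      also have "\<dots> = (h (i, 0))\<^sup>2 * heval 2 f y + heval 2 f r + h (i, 0) * polar f y r"
        unfolding heval_add by (simp add: heval_scale polar_scale)
      also have "heval 2 f r = 0" unfolding r_def by (rule L)
      also have "polar f y r = (\<Sum>l\<in>{1..c}. h (i, l) * polar f y (block w l))"
        unfolding r_def polar_commute[of f y] by (subst polar_sum[symmetric]) (auto simp: block_def)
      finally have "h (i, 0) * (h (i, 0) * heval 2 f y + (\<Sum>l\<in>{1..c}. h (i, l) * polar f y (block w l))) = 0"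
        by (simp add: power2_eq_square algebra_simps)
      then have "h (i, 0) * heval 2 f y + (\<Sum>l\<in>{1..c}. h (i, l) * polar f y (block w l)) = 0"
        using h0 i by auto
      moreover have "(\<Sum>l\<le>c. h (i, l) * \<mu> l) = h (i, 0) * heval 2 f y + (\<Sum>l\<in>{1..c}. h (i, l) * polar f y (block w l))"
        unfolding split by (subst sum.insert) (auto simp: \<mu>_def intro!: sum.cong)
      ultimately show ?thesis by simp
    qed
    moreover have hg: "mutual_inverses c h g" using gh by (auto simp: mutual_inverses_def)
    \<comment> \<open>The second form vanishes at all spanning points, so applying \<open>g\<close>
      recovers \<open>\<mu> = 0\<close>; its entry at \<open>0\<close> is the value of the quadric
      at \<open>y\<close>.\<close>
    ultimately have "\<mu> 0 = (\<Sum>l\<le>c. g (0, l) * 0)"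
      by (intro sum_inverse[OF _ hg]) auto
    then show ?thesis by (simp add: \<mu>_def)
  qed
  show ?thesis
  proof (rule ccontr)
    assume n: "heval 2 f y \<noteq> 0"
    let ?p = "\<lambda>y. P (set_block w 0 y)"
    have p: "?p \<in> polyfun UNIV" by (rule polyfun_set_block[OF P(1)]; intro polyfun_intros UNIV_I)
    have 1: "\<exists>x\<in>UNIV. ?p x \<noteq> 0" using P(2) by (intro bexI[of _ "block w 0"]) auto
    have 2: "\<exists>x\<in>UNIV. heval 2 f x \<noteq> 0" using n by blast
    obtain z where "?p z \<noteq> 0" "heval 2 f z \<noteq> 0"
      by (rule irrD[OF irr_UNIV p heval_polyfun 1 2])
    then show False using main by blast
  qed
qed

lemma card_pairs: "card {(i, j). i < j \<and> j \<le> (c::nat)} = (c + 1) choose 2"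
proof -
  have "{(i, j). i < j \<and> j \<le> c} = (\<lambda>(j, i). (i, j)) ` (SIGMA j:{..c}. {..<j})" by force
  moreover have "inj_on (\<lambda>(j, i). (i, j)) (SIGMA j:{..c}. {..<j})" by (auto simp: inj_on_def)
  ultimately have "card {(i, j). i < j \<and> j \<le> c} = (\<Sum>j\<le>c. j)" by (simp add: card_image)
  also have "\<dots> = (c + 1) choose 2"
    by (induction c) (simp_all add: numeral_2_eq_2)
  finally show ?thesis .
qed

lemma finite_pairs: "finite {(i, j). i < j \<and> j \<le> (c::nat)}"
  by (rule finite_subset[of _ "{..c} \<times> {..c}"]) auto

lemma sum_pairs: "(\<Sum>(i, j)\<in>{(i, j). i < j \<and> j \<le> (c::nat)}. F i j) = (\<Sum>j\<le>c. \<Sum>i<j. F i j)"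
proof -
  have "(\<Sum>j\<le>c. \<Sum>i<j. F i j) = (\<Sum>(j, i)\<in>(SIGMA j:{..c}. {..<j}). F i j)"
    by (subst sum.Sigma) auto
  also have "\<dots> = (\<Sum>(i, j)\<in>{(i, j). i < j \<and> j \<le> c}. F i j)"
    by (rule sum.reindex_bij_witness[of _ "\<lambda>(i, j). (j, i)" "\<lambda>(j, i). (i, j)"]) auto
  finally show ?thesis by simp
qed

subsection \<open>Relations among products of coordinates\<close>

text \<open>Each independent relation, solved for a pivot \<open>p0\<close>, makes one coordinate of
  \<open>s\<close> redundant. The surviving indices \<open>J\<close> supply the functionals for
  \<open>a2_le_functionals\<close>.\<close>

lemma eliminate_functionals:
  fixes t :: "'l \<Rightarrow> 'p \<Rightarrow> 'a::field"
  assumes "finite I" "finite P"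
    "\<And>\<alpha>. \<forall>p\<in>P. (\<Sum>l\<in>I. \<alpha> l * t l p) = 0 \<Longrightarrow> \<forall>l\<in>I. \<alpha> l = 0"
  shows "\<exists>J\<subseteq>P. card J + card I = card P \<and>
    (\<forall>s. (\<forall>l\<in>I. (\<Sum>p\<in>P. t l p * s p) = 0) \<longrightarrow> (\<forall>p\<in>J. s p = 0) \<longrightarrow> (\<forall>p\<in>P. s p = 0))"
  using assms
proof (induction I arbitrary: P t rule: finite_induct)
  case empty
  then show ?case by (intro exI[of _ P]) simp
next
  case (insert k I)
  have "\<exists>p\<in>P. t k p \<noteq> 0"
  proof (rule ccontr)
    assume n: "\<not> ?thesis"
    have "(\<Sum>l\<in>insert k I. (if l = k then 1 else 0) * t l p) = t k p" for p
    proof -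
      have "(\<Sum>l\<in>I. (if l = k then 1 else 0) * t l p) = 0"
        using insert.hyps(2) by (intro sum.neutral) auto
      then show ?thesis using insert.hyps by simp
    qed
    then have "\<forall>p\<in>P. (\<Sum>l\<in>insert k I. (if l = k then 1 else 0) * t l p) = 0" using n by simp
    then have "\<forall>l\<in>insert k I. (if l = k then 1 else 0) = (0::'a)" by (rule insert.prems(2))
    then show False by simp
  qed
  then obtain p0 where p0: "p0 \<in> P" "t k p0 \<noteq> 0" by blast
  define P' where "P' = P - {p0}"
  define r where "r l = t l p0 / t k p0" for l
  define t' where "t' l p = t l p - r l * t k p" for l p
  have t'0: "t' l p0 = 0" for l using p0 by (simp add: t'_def r_def)
  have finP': "finite P'" using insert.prems(1) by (simp add: P'_def)
  have sumP: "(\<Sum>p\<in>P. F p) = F p0 + (\<Sum>p\<in>P'. F p)" for F :: "'p \<Rightarrow> 'a"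
    unfolding P'_def by (rule sum.remove[OF insert.prems(1) p0(1)])
  have ind: "\<forall>l\<in>I. \<alpha> l = 0" if a: "\<forall>p\<in>P'. (\<Sum>l\<in>I. \<alpha> l * t' l p) = 0" for \<alpha>
  proof -
    define \<beta> where "\<beta> l = (if l = k then - (\<Sum>l\<in>I. \<alpha> l * r l) else \<alpha> l)" for l
    have "(\<Sum>l\<in>insert k I. \<beta> l * t l p) = (\<Sum>l\<in>I. \<alpha> l * t' l p)" for p
    proof -
      have "(\<Sum>l\<in>I. \<beta> l * t l p) = (\<Sum>l\<in>I. \<alpha> l * t l p)"
        using insert.hyps(2) by (intro sum.cong) (auto simp: \<beta>_def)
      then have "(\<Sum>l\<in>insert k I. \<beta> l * t l p) = (\<Sum>l\<in>I. \<alpha> l * t l p) - (\<Sum>l\<in>I. \<alpha> l * r l) * t k p"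
        using insert.hyps by (simp add: \<beta>_def)
      also have "\<dots> = (\<Sum>l\<in>I. \<alpha> l * t' l p)"
        unfolding sum_distrib_right sum_subtractf[symmetric] t'_def
        by (intro sum.cong refl) (simp add: algebra_simps)
      finally show ?thesis .
    qed
    moreover have "(\<Sum>l\<in>I. \<alpha> l * t' l p) = 0" if "p \<in> P" for p
      using a that t'0 by (cases "p = p0") (simp_all add: P'_def)
    ultimately have "\<forall>p\<in>P. (\<Sum>l\<in>insert k I. \<beta> l * t l p) = 0" by simp
    then have "\<forall>l\<in>insert k I. \<beta> l = 0" by (rule insert.prems(2))
    then show ?thesis using insert.hyps(2) by (auto simp: \<beta>_def split: if_splits)
  qed
  obtain J where J: "J \<subseteq> P'" "card J + card I = card P'"
    "\<And>s. \<forall>l\<in>I. (\<Sum>p\<in>P'. t' l p * s p) = 0 \<Longrightarrow> \<forall>p\<in>J. s p = 0 \<Longrightarrow> \<forall>p\<in>P'. s p = 0"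
    using insert.IH[OF finP' ind] by blast
  show ?case
  proof (intro exI[of _ J] conjI allI impI)
    show "J \<subseteq> P" using J(1) by (auto simp: P'_def)
    have "card P = Suc (card P')" unfolding P'_def using card.remove[OF insert.prems(1) p0(1)] .
    then show "card J + card (insert k I) = card P" using J(2) insert.hyps by simp
    fix s assume s: "\<forall>l\<in>insert k I. (\<Sum>p\<in>P. t l p * s p) = 0" "\<forall>p\<in>J. s p = 0"
    have "(\<Sum>p\<in>P'. t' l p * s p) = 0" if "l \<in> I" for l
    proof -
      have "(\<Sum>p\<in>P. t' l p * s p) = (\<Sum>p\<in>P. t l p * s p) - r l * (\<Sum>p\<in>P. t k p * s p)"
        unfolding sum_distrib_left sum_subtractf[symmetric] t'_def
        by (intro sum.cong refl) (simp add: algebra_simps)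
      then have "(\<Sum>p\<in>P. t' l p * s p) = 0" using s(1) that by simp
      then show ?thesis unfolding sumP by (simp add: t'0)
    qed
    then have z: "\<forall>p\<in>P'. s p = 0" using J(3) s(2) by blast
    have "(\<Sum>p\<in>P. t k p * s p) = 0" using s(1) by simp
    then have "s p0 = 0" unfolding sumP using z p0(2) by simp
    then show "\<forall>p\<in>P. s p = 0" using z by (auto simp: P'_def)
  qed
qed

text \<open>If \<open>\<Sum>\<^sub>l \<alpha>\<^sub>l a\<^sub>l\<^sub>i a\<^sub>l\<^sub>j = 0\<close> for \<open>i \<noteq> j\<close>, then \<open>A\<^sup>T diag(\<alpha>) A\<close> is a diagonal matrix \<open>diag(\<delta>)\<close>, that is
  \<open>\<alpha>\<^sub>l a\<^sub>l\<^sub>i = \<delta>\<^sub>i b\<^sub>i\<^sub>l\<close> with \<open>B = A\<^sup>-\<^sup>1\<close>. So \<open>\<alpha>\<^sub>l = 0\<close> when \<open>a\<^sub>l\<^sub>i \<noteq> 0 = b\<^sub>i\<^sub>l\<close> for some \<open>i\<close>, and for the other rows the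
  vanishing of \<open>\<alpha>\<^sub>l\<close> propagates to every row whose support meets that of row \<open>l\<close>.\<close>

lemma few_rows_determine_relation:
  fixes a b :: "nat \<times> nat \<Rightarrow> 'a::field"
  assumes ab: "\<And>l l'. l \<le> c \<Longrightarrow> l' \<le> c \<Longrightarrow> matmul c a b (l, l') = (if l = l' then 1 else 0)"
    and supp: "\<And>l. l \<le> c \<Longrightarrow> 3 \<le> card {i. i \<le> c \<and> a (l, i) \<noteq> 0}"
  obtains R where "R \<subseteq> {..c}" "3 * card R \<le> c + 1"
    "\<And>\<alpha>. \<forall>l\<in>R. \<alpha> l = 0 \<Longrightarrow>
       \<forall>i j. i < j \<longrightarrow> j \<le> c \<longrightarrow> (\<Sum>l\<le>c. \<alpha> l * (a (l, i) * a (l, j))) = 0 \<Longrightarrow> \<forall>l\<le>c. \<alpha> l = 0"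
proof -
  define S where "S l = {i. i \<le> c \<and> a (l, i) \<noteq> 0}" for l
  have finS: "finite (S l)" for l by (simp add: S_def)
  define live where "live = {l. l \<le> c \<and> (\<forall>i\<in>S l. b (i, l) \<noteq> 0)}"
  \<comment> \<open>In a maximal such family, disjointness with at least three columns per row
    bounds the size, and maximality makes every other live row meet a chosen one.\<close>
  define ok where "ok R \<longleftrightarrow> R \<subseteq> live \<and> (\<forall>l\<in>R. \<forall>l'\<in>R. l \<noteq> l' \<longrightarrow> S l \<inter> S l' = {})" for R
  have "finite live" by (simp add: live_def)
  then have finok: "finite {R. ok R}" by (rule finite_subset[rotated, OF finite_Pow_iff[THEN iffD2]]) (auto simp: ok_def)
  have "{} \<in> {R. ok R}" by (simp add: ok_def)
  then obtain R where R: "ok R" and max: "\<And>R'. ok R' \<Longrightarrow> R \<subseteq> R' \<Longrightarrow> R' = R"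
    using finite_has_maximal2[OF finok] by (metis mem_Collect_eq)
  have Rl: "R \<subseteq> live" using R by (simp add: ok_def)
  have Rc: "R \<subseteq> {..c}" using Rl by (auto simp: live_def)
  then have finR: "finite R" using finite_subset by blast
  have "card (\<Union>l\<in>R. S l) = (\<Sum>l\<in>R. card (S l))"
    by (rule card_UN_disjoint[OF finR]) (use R finS in \<open>auto simp: ok_def\<close>)
  moreover have "(\<Sum>l\<in>R. card (S l)) \<ge> (\<Sum>l\<in>R. 3)"
    using supp Rc by (intro sum_mono) (auto simp: S_def)
  moreover have "card (\<Union>l\<in>R. S l) \<le> card {..c}" by (rule card_mono) (auto simp: S_def)
  ultimately have card: "3 * card R \<le> c + 1" by simp
  show ?thesis
  proof (rule that[OF Rc card], intro allI impI)
    fix \<alpha> l assume R0: "\<forall>l\<in>R. \<alpha> l = 0"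
      and rel: "\<forall>i j. i < j \<longrightarrow> j \<le> c \<longrightarrow> (\<Sum>l\<le>c. \<alpha> l * (a (l, i) * a (l, j))) = 0" and l: "l \<le> c"
    define \<delta> where "\<delta> i = (\<Sum>l\<le>c. \<alpha> l * (a (l, i) * a (l, i)))" for i
    have offdiag: "(\<Sum>l\<le>c. \<alpha> l * (a (l, i) * a (l, j))) = (if i = j then \<delta> i else 0)" if "i \<le> c" "j \<le> c" for i j
    proof (cases i j rule: linorder_cases)
      case less
      then show ?thesis using rel that by simp
    next
      case greater
      then have "(\<Sum>l\<le>c. \<alpha> l * (a (l, j) * a (l, i))) = 0" using rel that by simp
      then show ?thesis using greater by (simp add: mult.commute)
    qed (simp add: \<delta>_def)
    have key: "\<alpha> l * a (l, i) = \<delta> i * b (i, l)" if il: "i \<le> c" "l \<le> c" for i l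
    proof -
      have "(\<Sum>j\<le>c. (\<Sum>r\<le>c. \<alpha> r * (a (r, i) * a (r, j))) * b (j, l)) = (\<Sum>j\<le>c. if i = j then \<delta> i * b (j, l) else 0)"
        by (intro sum.cong refl) (simp add: offdiag il)
      also have "\<dots> = \<delta> i * b (i, l)" using il by simp
      finally have 1: "(\<Sum>j\<le>c. (\<Sum>r\<le>c. \<alpha> r * (a (r, i) * a (r, j))) * b (j, l)) = \<delta> i * b (i, l)" .
      have "(\<Sum>j\<le>c. (\<Sum>r\<le>c. \<alpha> r * (a (r, i) * a (r, j))) * b (j, l)) = (\<Sum>r\<le>c. \<Sum>j\<le>c. \<alpha> r * a (r, i) * (a (r, j) * b (j, l)))"
        unfolding sum_distrib_right by (subst sum.swap) (simp add: mult.assoc)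
      also have "\<dots> = (\<Sum>r\<le>c. \<alpha> r * a (r, i) * matmul c a b (r, l))"
        by (simp add: matmul_def sum_distrib_left)
      also have "\<dots> = (\<Sum>r\<le>c. if r = l then \<alpha> r * a (r, i) else 0)"
        by (intro sum.cong refl) (simp add: ab il)
      also have "\<dots> = \<alpha> l * a (l, i)" using il by simp
      finally show ?thesis using 1 by simp
    qed
    show "\<alpha> l = 0"
    proof (cases "l \<in> live")
      case False
      then obtain i where "i \<in> S l" "b (i, l) = 0" using l by (auto simp: live_def)
      then show ?thesis using key[of i l] l by (auto simp: S_def)
    next
      case True
      show ?thesis
      proof (cases "l \<in> R")
        case False
        then have "insert l R \<noteq> R" by blast
        then have "\<not> ok (insert l R)" using max[of "insert l R"] by blast
        then obtain l' where l': "l' \<in> R" "S l \<inter> S l' \<noteq> {}" using R True unfolding ok_def by blast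
        then obtain i where i: "i \<in> S l" "i \<in> S l'" by blast
        have "b (i, l') \<noteq> 0" "l' \<le> c" using l'(1) i(2) Rl by (auto simp: live_def)
        then have "\<delta> i = 0" using key[of i l'] R0 l'(1) i by (auto simp: S_def)
        then show ?thesis using key[of i l] l i(1) by (auto simp: S_def)
      qed (use R0 in blast)
    qed
  qed
qed

lemma dim_ge_Suc_psubset:
  assumes "dim_ge X n" "X \<subset> Y" "proj_irreducible Y"
  shows "dim_ge Y (Suc n)"
proof -
  obtain Z where Z: "\<forall>i\<le>n. proj_irreducible (Z i) \<and> Z i \<subseteq> X" "\<forall>i<n. Z i \<subset> Z (Suc i)"
    using assms(1) unfolding dim_ge_def by blast
  define Z' where "Z' i = (if i \<le> n then Z i else Y)" for i
  have 1: "proj_irreducible (Z' i) \<and> Z' i \<subseteq> Y" for i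
  proof (cases "i \<le> n")
    case True
    then show ?thesis using Z(1) assms(2) by (auto simp: Z'_def)
  qed (use assms(3) in \<open>simp add: Z'_def\<close>)
  have 2: "Z' i \<subset> Z' (Suc i)" if "i < Suc n" for i
  proof (cases "i = n")
    case True
    then have "Z' i \<subseteq> X" "Z' (Suc i) = Y" using Z(1) by (auto simp: Z'_def)
    then show ?thesis using assms(2) by blast
  next
    case False
    then show ?thesis using that Z(2) by (simp add: Z'_def)
  qed
  show ?thesis unfolding dim_ge_def using 1 2 by blast
qed

lemma quadrics_throughD:
  "f \<in> quadrics_through X \<Longrightarrow> hom_form 2 f"
  "f \<in> quadrics_through X \<Longrightarrow> Y \<subseteq> quadric_hull X \<Longrightarrow> x \<in> insert 0 Y \<Longrightarrow> heval 2 f x = 0"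
  using heval_two_zero[of f] by (auto simp: quadrics_through_def quadric_hull_def zero_fun_def)

text \<open>Quadrics through \<open>X\<close> vanish on \<open>Y\<close>, so spanning points may be
  taken from \<open>Y\<close>, and it suffices to detect vanishing on the span of
  \<open>w\<^sub>1, \<dots>, w\<^sub>c\<close>. A hull component larger than \<open>X\<close> enters
  with \<open>c - 1\<close> in place of \<open>c\<close>.\<close>

lemma a2_bound_hull:
  fixes X Y :: "('v::finite \<Rightarrow> 'a::field_char_0) set"
  assumes ac: "alg_closed TYPE('a)" and Y: "proj_irreducible Y" "nondegenerate Y" "dim_ge Y n"
    and card: "card (UNIV :: 'v set) = n + c + 1" and hull: "Y \<subseteq> quadric_hull X"
  shows "a2 X \<le> (c + 1) choose 2"
proof -
  have "Y \<noteq> {}" using Y(1) by (simp add: proj_irreducible_def)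
  have 0: "\<forall>i\<le>c. block (\<lambda>_. 0) i \<in> insert 0 Y" by (simp add: block_def zero_fun_def)
  \<comment> \<open>The spanning points need satisfy no extra condition, so the constant
    \<open>1\<close> and the zero tuple serve.\<close>
  define Q where "Q = (\<lambda>_ :: nat \<times> 'v \<Rightarrow> 'a. 1 :: 'a)"
  have Q: "Q \<in> polyfun ({..c} \<times> UNIV)" "Q (\<lambda>_. 0) \<noteq> 0" unfolding Q_def by (rule polyfun_const) simp
  obtain P where P: "P \<in> polyfun UNIV" "\<exists>w. P w \<noteq> 0"
    "\<And>w. P w \<noteq> 0 \<Longrightarrow> \<exists>x g h. (\<forall>i\<le>c. block x i \<in> insert 0 Y) \<and> Q x \<noteq> 0 \<and> mutual_inverses c g h \<and>
        (\<forall>i\<le>c. h (i, 0) \<noteq> 0) \<and> (\<forall>i\<le>c. \<forall>v. w (i, v) = (\<Sum>l\<le>c. g (i, l) * x (l, v)))"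
    using generic_section[OF ac Y card Q(1) 0 Q(2)] by blast
  obtain w where w: "P w \<noteq> 0" using P(2) by blast
  let ?J = "{(i, j). i < j \<and> j \<le> c}"
  define \<phi> where "\<phi> = (\<lambda>(i, j) f. if i = 0 then heval 2 f (block w j) else polar f (block w i) (block w j))"
  have "a2 X \<le> card ?J"
  proof (rule a2_le_functionals[OF finite_pairs, of c \<phi>])
    fix p B and d :: "(('v \<Rightarrow> nat) \<Rightarrow> 'a) \<Rightarrow> 'a"
    show "\<phi> p (\<lambda>m. \<Sum>f\<in>B. d f * f m) = (\<Sum>f\<in>B. d f * \<phi> p f)"
      by (cases p) (simp add: \<phi>_def heval_lincomb polar_lincomb)
  next
    fix f assume f: "f \<in> quadrics_through X" and z: "\<forall>p\<in>?J. \<phi> p f = 0"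
    have h0: "heval 2 f (block w j) = 0" if "1 \<le> j" "j \<le> c" for j
      using bspec[OF z, of "(0, j)"] that by (simp add: \<phi>_def)
    have p0: "polar f (block w i) (block w j) = 0" if "1 \<le> i" "i < j" "j \<le> c" for i j
      using bspec[OF z, of "(i, j)"] that by (simp add: \<phi>_def)
    have "heval 2 f y = 0" for y
    proof (rule quadric_containing_section[OF P(1) w, of c Y f])
      show "\<exists>x g h. (\<forall>i\<le>c. block x i \<in> insert 0 Y) \<and> mutual_inverses c g h \<and>
        (\<forall>i\<le>c. h (i, 0) \<noteq> 0) \<and> (\<forall>i\<le>c. \<forall>v. w (i, v) = (\<Sum>l\<le>c. g (i, l) * x (l, v)))" if "P w \<noteq> 0" for w
        using P(3)[OF that] by blast
      show "heval 2 f x = 0" if "x \<in> Y" for x using quadrics_throughD(2)[OF f hull] that by blast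
      fix u :: "nat \<Rightarrow> 'a"
      define u' where "u' l = (if l = 0 then 0 else u l)" for l
      have "(\<Sum>l\<in>{1..c}. u l * w (l, v)) = (\<Sum>l\<le>c. u' l * block w l v)" for v
        by (rule sum.mono_neutral_cong_left) (auto simp: u'_def block_def)
      moreover have "heval 2 f (\<lambda>v. \<Sum>l\<le>c. u' l * block w l v) = 0"
      proof -
        have "(\<Sum>i\<le>c. (u' i)\<^sup>2 * heval 2 f (block w i)) = 0"
          by (rule sum.neutral) (auto simp: u'_def h0)
        moreover have "(\<Sum>j\<le>c. \<Sum>i<j. u' i * u' j * polar f (block w i) (block w j)) = 0"
          by (intro sum.neutral ballI) (auto simp: u'_def p0)
        ultimately show ?thesis unfolding heval_combination by simp
      qed
      ultimately show "heval 2 f (\<lambda>v. \<Sum>l\<in>{1..c}. u l * w (l, v)) = 0" by simp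
    qed
    then show "f = 0" by (rule quadratic_form_zero[OF quadrics_throughD(1)[OF f]])
  qed
  then show ?thesis unfolding card_pairs .
qed

lemma choose_two_Suc: "Suc c choose 2 = (c choose 2) + c"
  by (simp add: numeral_2_eq_2)

text \<open>Vanishing on pairs from a spanning set extends to all pairs, one argument at a time, and
  the diagonal of the polar form is twice the quadratic form.\<close>

lemma polar_nonzero_on:
  fixes X :: "('v::finite \<Rightarrow> 'a::field_char_0) set"
  assumes "nondegenerate X" "hom_form 2 f" "f \<noteq> 0"
  shows "\<exists>x\<in>insert 0 X. \<exists>y\<in>insert 0 X. polar f x y \<noteq> 0"
proof (rule ccontr)
  assume n: "\<not> ?thesis"
  let ?A = "insert 0 X"
  have lc: "lin_closed {x. \<forall>y\<in>T. polar f x y = 0}" for T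
    by (auto simp: lin_closed_def polar_linear)
  have sp: "T = UNIV" if "lin_closed T" "?A \<subseteq> T" for T
    using spans_cone[OF assms(1)] that unfolding spans_def by blast
  have "{x. \<forall>y\<in>?A. polar f x y = 0} = UNIV" by (rule sp[OF lc]) (use n in blast)
  then have 1: "polar f x y = 0" if "y \<in> ?A" for x y using that by blast
  have "{x. \<forall>y\<in>UNIV. polar f x y = 0} = UNIV"
  proof (rule sp[OF lc])
    show "?A \<subseteq> {x. \<forall>y\<in>UNIV. polar f x y = 0}"
    proof
      fix x assume "x \<in> ?A"
      then have "polar f x y = 0" for y unfolding polar_commute[of f x y] by (rule 1)
      then show "x \<in> {x. \<forall>y\<in>UNIV. polar f x y = 0}" by blast
    qed
  qed
  then have "polar f x x = 0" for x by blast
  then have "heval 2 f x = 0" for x using polar_self[of f x] by simp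
  then show False using quadratic_form_zero[OF assms(2)] assms(3) by blast
qed

subsection \<open>Two components of maximal dimension\<close>

lemma polyfun_polar:
  assumes "\<And>v. (\<lambda>u. \<phi> u v) \<in> polyfun C" "\<And>v. (\<lambda>u. \<psi> u v) \<in> polyfun C"
  shows "(\<lambda>u. polar f (\<phi> u) (\<psi> u)) \<in> polyfun C"
  unfolding polar_def
proof (intro polyfun_diff)
  show "(\<lambda>u. heval 2 f (\<lambda>v. \<phi> u v + \<psi> u v)) \<in> polyfun C"
    by (rule polyfun_compose[OF heval_polyfun]) (rule polyfun_add[OF assms])
  show "(\<lambda>u. heval 2 f (\<phi> u)) \<in> polyfun C" "(\<lambda>u. heval 2 f (\<psi> u)) \<in> polyfun C"
    by (rule polyfun_compose[OF heval_polyfun assms(1)], rule polyfun_compose[OF heval_polyfun assms(2)])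
qed

text \<open>\<open>Q\<close> is the product of all conditions. Tuples form an irreducible set, so it
  is enough that each factor is nonzero somewhere: \<open>h\<close> at one point,
  \<open>polar\<close> at one pair. When \<open>f\<close> vanishes at both points, a nonzero polar
  value says that it does not vanish on their line.\<close>

lemma generic_basis_function:
  fixes X :: "('v::finite \<Rightarrow> 'a::field_char_0) set"
  assumes X: "proj_irreducible X" "nondegenerate X"
    and h: "h \<in> polyfun UNIV" "\<exists>x\<in>insert 0 X. h x \<noteq> 0" and f: "hom_form 2 f" "f \<noteq> 0"
  shows "\<exists>Q\<in>polyfun ({..c} \<times> UNIV). (\<exists>u. (\<forall>i\<le>c. block u i \<in> insert 0 X) \<and> Q u \<noteq> 0) \<and>
    (\<forall>u. Q u \<noteq> 0 \<longrightarrow> (\<forall>i\<le>c. h (block u i) \<noteq> 0) \<and> (\<forall>i j. i < j \<longrightarrow> j \<le> c \<longrightarrow> polar f (block u i) (block u j) \<noteq> 0))"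
proof -
  let ?A = "insert 0 X" let ?S = "{b. \<forall>i<Suc c. block (xs_of b) i \<in> ?A}"
  let ?P = "{(i, j). i < j \<and> j \<le> c}"
  define Q where "Q u = (\<Prod>i\<le>c. h (block u i)) * (\<Prod>p\<in>?P. polar f (block u (fst p)) (block u (snd p)))" for u
  have block_poly: "(\<lambda>u. block u i v) \<in> polyfun ({..c} \<times> UNIV)" if "i \<le> c" for i and v :: 'v
    using that by (auto simp: block_def intro: polyfun_var)
  have hp: "(\<lambda>u. h (block u i)) \<in> polyfun ({..c} \<times> UNIV)" if "i \<le> c" for i
    by (rule polyfun_compose[OF h(1) block_poly[OF that]])
  have pp: "(\<lambda>u. polar f (block u i) (block u j)) \<in> polyfun ({..c} \<times> UNIV)" if "i \<le> c" "j \<le> c" for i j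
    by (rule polyfun_polar[OF block_poly[OF that(1)] block_poly[OF that(2)]])
  have Qp: "Q \<in> polyfun ({..c} \<times> UNIV)"
  proof -
    have "(\<lambda>u. Q u) \<in> polyfun ({..c} \<times> UNIV)"
      unfolding Q_def
    proof (intro polyfun_mult polyfun_prod)
      show "(\<lambda>u. h (block u i)) \<in> polyfun ({..c} \<times> UNIV)" if "i \<in> {..c}" for i using hp that by simp
      show "(\<lambda>u. polar f (block u (fst p)) (block u (snd p))) \<in> polyfun ({..c} \<times> UNIV)" if "p \<in> ?P" for p
        by (rule pp) (use that in auto)
    qed
    then show ?thesis .
  qed
  let ?I = "Inl ` {..c} \<union> Inr ` ?P"
  define F where "F k b = (case k of Inl i \<Rightarrow> h (block (xs_of b) i)
      | Inr p \<Rightarrow> polar f (block (xs_of b) (fst p)) (block (xs_of b) (snd p)))" for k and b :: "'v idx \<Rightarrow> 'a"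
  have "\<exists>b\<in>?S. \<forall>k\<in>?I. F k b \<noteq> 0"
  proof (rule irr_prod[OF irr_tuples[OF irr_cone[OF X(1)]]])
    show "finite ?I" by (intro finite_UnI finite_imageI finite_pairs finite_atMost)
    fix k assume k: "k \<in> ?I"
    have bp: "(\<lambda>b. block (xs_of b) i v) \<in> polyfun UNIV" for i and v :: 'v
      by (simp add: block_def xs_of_def polyfun_var)
    show "F k \<in> polyfun UNIV"
    proof (cases k)
      case (Inl i)
      have "(\<lambda>b. h (block (xs_of b) i)) \<in> polyfun UNIV" by (rule polyfun_compose[OF h(1) bp])
      then show ?thesis by (simp add: F_def[abs_def] Inl)
    next
      case (Inr p)
      have "(\<lambda>b. polar f (block (xs_of b) (fst p)) (block (xs_of b) (snd p))) \<in> polyfun UNIV"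
        by (rule polyfun_polar[OF bp bp])
      then show ?thesis by (simp add: F_def[abs_def] Inr)
    qed
    define mk where "mk y = (\<lambda>k :: 'v idx. case k of Wcoord i v \<Rightarrow> 0 | Xcoord i v \<Rightarrow> y i v | Gcoord i l \<Rightarrow> (0::'a))" for y
    have mk: "block (xs_of (mk y)) i = y i" for y i by (simp add: block_def xs_of_def mk_def)
    show "\<exists>b\<in>?S. F k b \<noteq> 0"
    proof (cases k)
      case (Inl i)
      obtain x where "x \<in> ?A" "h x \<noteq> 0" using h(2) by blast
      then show ?thesis by (intro bexI[of _ "mk (\<lambda>_. x)"]) (simp_all add: mk F_def Inl)
    next
      case (Inr p)
      obtain x y where xy: "x \<in> ?A" "y \<in> ?A" "polar f x y \<noteq> 0" using polar_nonzero_on[OF X(2) f] by blast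
      have "fst p \<noteq> snd p" using k Inr by auto
      then show ?thesis using xy
        by (intro bexI[of _ "mk (\<lambda>i. if i = fst p then x else y)"]) (simp_all add: mk F_def Inr)
    qed
  qed
  then obtain b where b: "b \<in> ?S" "\<And>k. k \<in> ?I \<Longrightarrow> F k b \<noteq> 0" by blast
  have Qdest: "(\<forall>i\<le>c. h (block u i) \<noteq> 0) \<and> (\<forall>i j. i < j \<longrightarrow> j \<le> c \<longrightarrow> polar f (block u i) (block u j) \<noteq> 0)"
    if "Q u \<noteq> 0" for u
  proof -
    have 1: "(\<Prod>i\<le>c. h (block u i)) \<noteq> 0" "(\<Prod>p\<in>?P. polar f (block u (fst p)) (block u (snd p))) \<noteq> 0"
      using that unfolding Q_def mult_eq_0_iff by simp_all
    have 2: "\<forall>p\<in>?P. polar f (block u (fst p)) (block u (snd p)) \<noteq> 0"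
      using 1(2) unfolding prod_zero_iff[OF finite_pairs] by blast
    have "polar f (block u i) (block u j) \<noteq> 0" if "i < j" "j \<le> c" for i j
      using bspec[OF 2, of "(i, j)"] that by simp
    moreover have "\<forall>i\<le>c. h (block u i) \<noteq> 0" using 1(1) unfolding prod_zero_iff[OF finite_atMost] by blast
    ultimately show ?thesis by blast
  qed
  have hb: "h (block (xs_of b) i) \<noteq> 0" if "i \<le> c" for i using b(2)[of "Inl i"] that by (simp add: F_def)
  have pb: "polar f (block (xs_of b) (fst p)) (block (xs_of b) (snd p)) \<noteq> 0" if "p \<in> ?P" for p
    using b(2)[of "Inr p"] that by (simp add: F_def)
  have "Q (xs_of b) \<noteq> 0"
    unfolding Q_def mult_eq_0_iff prod_zero_iff[OF finite_atMost] prod_zero_iff[OF finite_pairs] using hb pb by blast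
  moreover have "\<forall>i\<le>c. block (xs_of b) i \<in> ?A" using b(1) by (simp add: less_Suc_eq_le)
  ultimately have "\<exists>u. (\<forall>i\<le>c. block u i \<in> ?A) \<and> Q u \<noteq> 0" by blast
  then show ?thesis using Qdest by (intro bexI[OF _ Qp] conjI allI impI) simp_all
qed

text \<open>The count starts from the pairs \<open>i < j\<close> because the quadrics vanish at the
  \<open>x\<^sub>i\<close> and leave no square terms. \<open>d\<close> bounds the number of
  relations lost to dependence.\<close>

lemma a2_two_components:
  fixes X Y :: "('v::finite \<Rightarrow> 'a::field_char_0) set"
  assumes ac: "alg_closed TYPE('a)"
    and X: "proj_irreducible X" "nondegenerate X" "dim_ge X n"
    and Y: "proj_irreducible Y" "nondegenerate Y" "dim_ge Y n"
    and card: "card (UNIV :: 'v set) = n + c + 1"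
    and XY: "\<not> X \<subseteq> Y" and hull: "X \<subseteq> quadric_hull X" "Y \<subseteq> quadric_hull X"
    and f0: "f0 \<in> quadrics_through X" "f0 \<noteq> 0"
  obtains d where "a2 X + (c + 1) \<le> ((c + 1) choose 2) + d" "3 * d \<le> c + 1"
proof -
  have pcY: "proj_closed Y" "Y \<noteq> {}" using Y(1) by (auto simp: proj_irreducible_def)
  have hom0: "hom_form 2 f0" by (rule quadrics_throughD(1)[OF f0(1)])
  obtain x1 where x1: "x1 \<in> X" "x1 \<notin> Y" using XY by blast
  have "0 \<notin> X" using X(1) zero_notin_proj_closed by (auto simp: proj_irreducible_def)
  then have "x1 \<notin> zcl UNIV (insert 0 Y)"
    using x1 zclosed_cone[OF pcY] unfolding zclosed_def by auto
  \<comment> \<open>Since \<open>h\<close> vanishes on the cone over \<open>Y\<close>, requiring it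
    to be nonzero at every \<open>x\<^sub>i\<close> keeps these points out of
    \<open>Y\<close>.\<close>
  then obtain h where h: "h \<in> polyfun UNIV" "\<And>y. y \<in> insert 0 Y \<Longrightarrow> h y = 0" "h x1 \<noteq> 0"
    unfolding zcl_def by blast
  have hX: "\<exists>x\<in>insert 0 X. h x \<noteq> 0" using x1 h(3) by blast
  obtain Q u0 where Q: "Q \<in> polyfun ({..c} \<times> UNIV)" "\<forall>i\<le>c. block u0 i \<in> insert 0 X" "Q u0 \<noteq> 0"
    "\<And>u. Q u \<noteq> 0 \<Longrightarrow> (\<forall>i\<le>c. h (block u i) \<noteq> 0) \<and> (\<forall>i j. i < j \<longrightarrow> j \<le> c \<longrightarrow> polar f0 (block u i) (block u j) \<noteq> 0)"
    using generic_basis_function[OF X(1,2) h(1) hX hom0 f0(2), of c] by blast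
  obtain P where P: "P \<in> polyfun UNIV" "\<exists>w. P w \<noteq> 0"
    "\<And>w. P w \<noteq> 0 \<Longrightarrow> \<exists>x g h. (\<forall>i\<le>c. block x i \<in> insert 0 X) \<and> Q x \<noteq> 0 \<and> mutual_inverses c g h \<and>
        (\<forall>i\<le>c. h (i, 0) \<noteq> 0) \<and> (\<forall>i\<le>c. \<forall>v. w (i, v) = (\<Sum>l\<le>c. g (i, l) * x (l, v)))"
    using generic_section[OF ac X card Q(1-3)] by blast
  define Q' where "Q' = (\<lambda>_ :: nat \<times> 'v \<Rightarrow> 'a. 1 :: 'a)"
  have Q': "Q' \<in> polyfun ({..c} \<times> UNIV)" "Q' (\<lambda>_. 0) \<noteq> 0" unfolding Q'_def by (rule polyfun_const) simp
  have 0: "\<forall>i\<le>c. block (\<lambda>_. 0) i \<in> insert 0 Y" by (simp add: block_def zero_fun_def)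
  obtain P' where P': "P' \<in> polyfun UNIV" "\<exists>w. P' w \<noteq> 0"
    "\<And>w. P' w \<noteq> 0 \<Longrightarrow> \<exists>x g h. (\<forall>i\<le>c. block x i \<in> insert 0 Y) \<and> Q' x \<noteq> 0 \<and> mutual_inverses c g h \<and>
        (\<forall>i\<le>c. h (i, 0) \<noteq> 0) \<and> (\<forall>i\<le>c. \<forall>v. w (i, v) = (\<Sum>l\<le>c. g (i, l) * x (l, v)))"
    using generic_section[OF ac Y card Q'(1) 0 Q'(2)] by blast
  have PU: "\<exists>w\<in>UNIV. P w \<noteq> 0" "\<exists>w\<in>UNIV. P' w \<noteq> 0" using P(2) P'(2) by blast+
  obtain w where w: "P w \<noteq> 0" "P' w \<noteq> 0" by (rule irrD[OF irr_UNIV P(1) P'(1) PU])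
  obtain x g gi where x: "\<forall>i\<le>c. block x i \<in> insert 0 X" "Q x \<noteq> 0" and g: "mutual_inverses c g gi"
    and wx: "\<forall>i\<le>c. \<forall>v. w (i, v) = (\<Sum>l\<le>c. g (i, l) * x (l, v))" using P(3)[OF w(1)] by blast
  obtain y e ei where y: "\<forall>i\<le>c. block y i \<in> insert 0 Y" and e: "mutual_inverses c e ei"
    and wy: "\<forall>i\<le>c. \<forall>v. w (i, v) = (\<Sum>l\<le>c. e (i, l) * y (l, v))" using P'(3)[OF w(2)] by blast
  \<comment> \<open>Both tuples span the same \<open>w\<close>, so \<open>y\<close> is
    \<open>ei\<close> applied to \<open>w\<close>, which is \<open>ei\<close> times \<open>g\<close>
    applied to \<open>x\<close>; \<open>b\<close> is the inverse change of basis.\<close>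
  define a where "a = matmul c ei g"
  define b where "b = matmul c gi e"
  have ab: "matmul c a b (l, l') = (if l = l' then 1 else 0)" if "l \<le> c" "l' \<le> c" for l l'
    unfolding a_def b_def by (rule matmul_inverse[OF g e that])
  have yx: "block y l = (\<lambda>v. \<Sum>i\<le>c. a (l, i) * block x i v)" if l: "l \<le> c" for l
  proof
    fix v
    have "y (l, v) = (\<Sum>r\<le>c. ei (l, r) * w (r, v))" by (rule sum_inverse[OF _ e l]) (use wy in blast)
    also have "\<dots> = (\<Sum>r\<le>c. \<Sum>i\<le>c. ei (l, r) * g (r, i) * x (i, v))"
      by (intro sum.cong refl) (simp add: wx sum_distrib_left mult.assoc)
    also have "\<dots> = (\<Sum>i\<le>c. a (l, i) * x (i, v))"
      by (subst sum.swap) (simp add: a_def matmul_def sum_distrib_right)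
    finally show "block y l v = (\<Sum>i\<le>c. a (l, i) * block x i v)" by (simp add: block_def)
  qed
  have Qx: "h (block x i) \<noteq> 0" if "i \<le> c" for i using Q(4)[OF x(2)] that by blast
  have Qx2: "polar f0 (block x i) (block x j) \<noteq> 0" if "i < j" "j \<le> c" for i j using Q(4)[OF x(2)] that by blast
  have fx: "heval 2 f (block x i) = 0" if "f \<in> quadrics_through X" "i \<le> c" for f i
    using quadrics_throughD(2)[OF that(1) hull(1)] x(1) that(2) by blast
  have comb: "heval 2 f (\<lambda>v. \<Sum>i\<le>c. u i * block x i v) = (\<Sum>j\<le>c. \<Sum>i<j. u i * u j * polar f (block x i) (block x j))"
    if "f \<in> quadrics_through X" for f u
  proof -
    have "(\<Sum>i\<le>c. (u i)\<^sup>2 * heval 2 f (block x i)) = 0" by (rule sum.neutral) (simp add: fx[OF that])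
    then show ?thesis unfolding heval_combination by simp
  qed
  have rel: "(\<Sum>j\<le>c. \<Sum>i<j. a (l, i) * a (l, j) * polar f (block x i) (block x j)) = 0"
    if "f \<in> quadrics_through X" "l \<le> c" for f l
  proof -
    have "heval 2 f (block y l) = 0" using quadrics_throughD(2)[OF that(1) hull(2)] y that(2) by blast
    then show ?thesis unfolding yx[OF that(2)] comb[OF that(1)] .
  qed
  have supp: "3 \<le> card {i. i \<le> c \<and> a (l, i) \<noteq> 0}" if l: "l \<le> c" for l
  proof (rule ccontr)
    let ?S = "{i. i \<le> c \<and> a (l, i) \<noteq> 0}"
    assume "\<not> 3 \<le> card ?S"
    then have "card ?S = 0 \<or> card ?S = 1 \<or> card ?S = 2" by linarith
    then show False
    proof (elim disjE)
      assume "card ?S = 0"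
      then have "?S = {}" by simp
      then have "matmul c a b (l, l) = 0" unfolding matmul_def by (auto intro!: sum.neutral)
      then show False using ab[OF l l] by simp
    next
      assume "card ?S = 1"
      then obtain i where S: "?S = {i}" by (rule card_1_singletonE)
      then have i: "i \<le> c" "a (l, i) \<noteq> 0" by auto
      have other: "a (l, j) = 0" if "j \<le> c" "j \<noteq> i" for j using S that by blast
      have "(\<Sum>j\<le>c. a (l, j) * block x j v) = a (l, i) * block x i v" for v
      proof -
        have "(\<Sum>j\<le>c. a (l, j) * block x j v) = (\<Sum>j\<le>c. if j = i then a (l, j) * block x j v else 0)"
          by (intro sum.cong refl) (simp add: other)
        then show ?thesis using i by simp
      qed
      then have yl: "block y l = (\<lambda>v. a (l, i) * block x i v)" unfolding yx[OF l] by simp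
      then have xi: "block x i = (\<lambda>v. inverse (a (l, i)) * block y l v)"
        unfolding yl using i(2) by (simp add: mult.assoc[symmetric])
      have "block x i \<in> insert 0 Y"
      proof (cases "block y l = 0")
        case True
        then show ?thesis unfolding xi by (simp add: zero_fun_def)
      next
        case False
        then have "block y l \<in> Y" using y l by blast
        then show ?thesis unfolding xi using proj_closed_scale[OF pcY(1)] i(2) by simp
      qed
      then show False using h(2) Qx[OF i(1)] by blast
    next
      assume "card ?S = 2"
      then obtain i j where S: "?S = {i, j}" "i \<noteq> j" by (meson card_2_iff)
      have "\<exists>i j. ?S = {i, j} \<and> i < j"
      proof (cases "i < j")
        case False
        then have "?S = {j, i}" "j < i" using S by auto
        then show ?thesis by blast
      qed (use S in blast)
      then obtain i j where S: "?S = {i, j}" "i < j" by blast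
      then have ij: "i \<le> c" "j \<le> c" "a (l, i) \<noteq> 0" "a (l, j) \<noteq> 0" by auto
      have other: "a (l, r) = 0" if "r \<le> c" "r \<noteq> i" "r \<noteq> j" for r using S that by blast
      let ?F = "\<lambda>r s. a (l, r) * a (l, s) * polar f0 (block x r) (block x s)"
      have z: "?F r s = 0" if "r < s" "s \<le> c" "(r, s) \<noteq> (i, j)" for r s
      proof (cases "r \<in> {i, j} \<and> s \<in> {i, j}")
        case True
        then have "r = i \<and> s = j" using that(1) S(2) by auto
        then show ?thesis using that(3) by simp
      next
        case False
        then show ?thesis using other[of r] other[of s] that(1,2) by auto
      qed
      have "(\<Sum>s\<le>c. \<Sum>r<s. ?F r s) = (\<Sum>p\<in>{(r, s). r < s \<and> s \<le> c}. case p of (r, s) \<Rightarrow> ?F r s)"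
        by (rule sum_pairs[symmetric])
      also have "\<dots> = (\<Sum>p\<in>{(i, j)}. case p of (r, s) \<Rightarrow> ?F r s)"
      proof (rule sum.mono_neutral_right[OF finite_pairs])
        show "{(i, j)} \<subseteq> {(r, s). r < s \<and> s \<le> c}" using S(2) ij by auto
        show "\<forall>p\<in>{(r, s). r < s \<and> s \<le> c} - {(i, j)}. (case p of (r, s) \<Rightarrow> ?F r s) = 0"
        proof
          fix p assume p: "p \<in> {(r, s). r < s \<and> s \<le> c} - {(i, j)}"
          obtain r s where "p = (r, s)" by fastforce
          then show "(case p of (r, s) \<Rightarrow> ?F r s) = 0" using p z[of r s] by simp
        qed
      qed
      finally have "?F i j = 0" using rel[OF f0(1) l] by simp
      then show False using ij Qx2[OF S(2) ij(2)] by simp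
    qed
  qed
  obtain R where R: "R \<subseteq> {..c}" "3 * card R \<le> c + 1"
    "\<And>\<alpha>. \<forall>l\<in>R. \<alpha> l = 0 \<Longrightarrow>
       \<forall>i j. i < j \<longrightarrow> j \<le> c \<longrightarrow> (\<Sum>l\<le>c. \<alpha> l * (a (l, i) * a (l, j))) = 0 \<Longrightarrow> \<forall>l\<le>c. \<alpha> l = 0"
    using few_rows_determine_relation[OF ab supp] by blast
  let ?P = "{(i, j). i < j \<and> j \<le> c}" let ?I = "{..c} - R"
  define t where "t = (\<lambda>l (i, j). a (l, i) * a (l, j))"
  \<comment> \<open>A dependency among the rows outside \<open>R\<close>, extended by zero on
    \<open>R\<close>, is forced to vanish by the choice of \<open>R\<close>.\<close>
  have indep: "\<forall>l\<in>?I. \<alpha> l = 0" if al: "\<forall>p\<in>?P. (\<Sum>l\<in>?I. \<alpha> l * t l p) = 0" for \<alpha>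
  proof -
    define \<beta> where "\<beta> l = (if l \<in> R then 0 else \<alpha> l)" for l
    have "(\<Sum>l\<le>c. \<beta> l * (a (l, i) * a (l, j))) = 0" if "i < j" "j \<le> c" for i j
    proof -
      have "(\<Sum>l\<le>c. \<beta> l * (a (l, i) * a (l, j))) = (\<Sum>l\<in>?I. \<alpha> l * t l (i, j))"
      proof (rule sum.mono_neutral_cong_right)
        show "\<forall>l\<in>{..c} - ?I. \<beta> l * (a (l, i) * a (l, j)) = 0" by (simp add: \<beta>_def)
        show "\<beta> l * (a (l, i) * a (l, j)) = \<alpha> l * t l (i, j)" if "l \<in> ?I" for l
          using that by (simp add: \<beta>_def t_def)
      qed simp_all
      then show ?thesis using bspec[OF al, of "(i, j)"] that by simp
    qed
    then have "\<forall>i j. i < j \<longrightarrow> j \<le> c \<longrightarrow> (\<Sum>l\<le>c. \<beta> l * (a (l, i) * a (l, j))) = 0" by blast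
    moreover have "\<forall>l\<in>R. \<beta> l = 0" by (simp add: \<beta>_def)
    ultimately have \<beta>0: "\<forall>l\<le>c. \<beta> l = 0" by (rule R(3)[rotated])
    show ?thesis
    proof
      fix l assume "l \<in> ?I"
      then show "\<alpha> l = 0" using \<beta>0[rule_format, of l] by (simp add: \<beta>_def)
    qed
  qed
  have finI: "finite ?I" by simp
  have "\<exists>J\<subseteq>?P. card J + card ?I = card ?P \<and>
    (\<forall>s. (\<forall>l\<in>?I. (\<Sum>p\<in>?P. t l p * s p) = 0) \<longrightarrow> (\<forall>p\<in>J. s p = 0) \<longrightarrow> (\<forall>p\<in>?P. s p = 0))"
    by (rule eliminate_functionals[OF finI finite_pairs]) (rule indep)
  then obtain J where J: "J \<subseteq> ?P" "card J + card ?I = card ?P"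
    "\<And>s. \<forall>l\<in>?I. (\<Sum>p\<in>?P. t l p * s p) = 0 \<Longrightarrow> \<forall>p\<in>J. s p = 0 \<Longrightarrow> \<forall>p\<in>?P. s p = 0"
    by (elim exE conjE) simp
  define \<phi> where "\<phi> = (\<lambda>(i, j) f. polar f (block x i) (block x j))"
  have "a2 X \<le> card J"
  proof (rule a2_le_functionals[of J \<phi>])
    show "finite J" by (rule finite_subset[OF J(1) finite_pairs])
    fix p B and d :: "(('v \<Rightarrow> nat) \<Rightarrow> 'a) \<Rightarrow> 'a"
    show "\<phi> p (\<lambda>m. \<Sum>f\<in>B. d f * f m) = (\<Sum>f\<in>B. d f * \<phi> p f)"
      by (cases p) (simp add: \<phi>_def polar_lincomb)
  next
    fix f assume f: "f \<in> quadrics_through X" and z: "\<forall>p\<in>J. \<phi> p f = 0"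
    have "(\<Sum>p\<in>?P. t l p * \<phi> p f) = 0" if "l \<in> ?I" for l
    proof -
      have "(\<Sum>p\<in>?P. t l p * \<phi> p f) = (\<Sum>(i, j)\<in>?P. a (l, i) * a (l, j) * polar f (block x i) (block x j))"
        by (intro sum.cong) (auto simp: t_def \<phi>_def)
      also have "\<dots> = 0" unfolding sum_pairs using rel[OF f] that by simp
      finally show ?thesis .
    qed
    then have all: "\<forall>p\<in>?P. \<phi> p f = 0" using J(3)[of "\<lambda>p. \<phi> p f"] z by blast
    have pz: "polar f (block x i) (block x j) = 0" if "i < j" "j \<le> c" for i j
      using bspec[OF all, of "(i, j)"] that by (simp add: \<phi>_def)
    have zero: "heval 2 f (\<lambda>v. \<Sum>i\<le>c. u i * block x i v) = 0" for u
      unfolding comb[OF f] by (intro sum.neutral ballI) (simp add: pz)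
    have "heval 2 f z = 0" for z
    proof (rule quadric_containing_section[OF P(1) w(1), of c X f])
      show "\<exists>x g h. (\<forall>i\<le>c. block x i \<in> insert 0 X) \<and> mutual_inverses c g h \<and>
        (\<forall>i\<le>c. h (i, 0) \<noteq> 0) \<and> (\<forall>i\<le>c. \<forall>v. w (i, v) = (\<Sum>l\<le>c. g (i, l) * x (l, v)))" if "P w \<noteq> 0" for w
        using P(3)[OF that] by blast
      show "heval 2 f x = 0" if "x \<in> X" for x using quadrics_throughD(2)[OF f hull(1)] that by blast
      fix u :: "nat \<Rightarrow> 'a"
      \<comment> \<open>The \<open>w\<^sub>l\<close> lie in the span of the
        \<open>x\<^sub>i\<close>, on which \<open>f\<close> is already known to vanish.\<close>
      have "(\<Sum>l\<in>{1..c}. u l * w (l, v)) = (\<Sum>i\<le>c. (\<Sum>l\<in>{1..c}. u l * g (l, i)) * block x i v)" for v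
      proof -
        have "(\<Sum>l\<in>{1..c}. u l * w (l, v)) = (\<Sum>l\<in>{1..c}. \<Sum>i\<le>c. u l * g (l, i) * block x i v)"
          by (intro sum.cong refl) (simp add: wx sum_distrib_left mult.assoc block_def)
        then show ?thesis unfolding sum_distrib_right by (subst (asm) sum.swap)
      qed
      then show "heval 2 f (\<lambda>v. \<Sum>l\<in>{1..c}. u l * w (l, v)) = 0"
        using zero[of "\<lambda>i. \<Sum>l\<in>{1..c}. u l * g (l, i)"] by simp
    qed
    then show "f = 0" by (rule quadratic_form_zero[OF quadrics_throughD(1)[OF f]])
  qed
  moreover have "card ?I + card R = c + 1"
    using card_Diff_subset[of R "{..c}"] R(1) card_mono[OF _ R(1)] finite_subset[OF R(1)] by simp
  ultimately have "a2 X + (c + 1) \<le> ((c + 1) choose 2) + card R"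
    using J(2) unfolding card_pairs by linarith
  then show ?thesis using that R(2) by blast
qed

theorem theorem1p5:
  fixes X :: "('v::finite \<Rightarrow> 'a::field_char_0) set"
    and n c k :: nat
  assumes "alg_closed TYPE('a)"
    and "card (UNIV :: 'v set) = n + c + 1"
    and "k \<le> 3"
    and "c \<ge> k + 1"
    and "proj_irreducible X"
    and "nondegenerate X"
    and "proj_dim_eq X n"
    and "a2 X = ((c + 1) choose 2) - k"
  shows "irred_component X (quadric_hull X) \<and>
         (\<forall>Y. irred_component Y (quadric_hull X) \<and> nondegenerate Y \<and> dim_ge Y n \<longrightarrow> Y = X)"
proof -
  obtain c' where c': "c = Suc c'" using assms(4) by (cases c) auto
  have ch: "(c + 1) choose 2 = (c choose 2) + c" using choose_two_Suc[of c] by simp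
  have dimX: "dim_ge X n" using assms(7) by (simp add: proj_dim_eq_def)
  have "0 \<notin> X" using assms(5) zero_notin_proj_closed by (auto simp: proj_irreducible_def)
  then have hullX: "X \<subseteq> quadric_hull X" by (auto simp: quadric_hull_def quadrics_through_def)
  \<comment> \<open>A strictly larger irreducible set would give
    \<open>a2 X \<le> c choose 2\<close>, whereas \<open>a2 X = (c choose 2) + (c - k)\<close> with
    \<open>k < c\<close>.\<close>
  have max: "Y = X" if Y: "proj_irreducible Y" "X \<subseteq> Y" "Y \<subseteq> quadric_hull X" for Y
  proof (rule ccontr)
    assume "Y \<noteq> X"
    then have "dim_ge Y (Suc n)" using dim_ge_Suc_psubset[OF dimX _ Y(1)] Y(2) by blast
    moreover have "nondegenerate Y" using assms(6) Y(2) unfolding nondegenerate_def by blast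
    moreover have "card (UNIV :: 'v set) = Suc n + c' + 1" using assms(2) c' by simp
    ultimately have "a2 X \<le> (c' + 1) choose 2" by (intro a2_bound_hull[OF assms(1) Y(1) _ _ _ Y(3)])
    then show False using assms(4,8) ch c' by simp
  qed
  have "irred_component X (quadric_hull X)"
    unfolding irred_component_def using assms(5) hullX max by blast
  moreover have "Y = X" if Y: "irred_component Y (quadric_hull X)" "nondegenerate Y" "dim_ge Y n" for Y
  proof (rule ccontr)
    assume "Y \<noteq> X"
    have irY: "proj_irreducible Y" "Y \<subseteq> quadric_hull X" using Y(1) by (auto simp: irred_component_def)
    have nsub: "\<not> X \<subseteq> Y" using max[OF irY(1) _ irY(2)] \<open>Y \<noteq> X\<close> by blast
    have "\<exists>f\<in>quadrics_through X. f \<noteq> 0"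
    proof (rule ccontr)
      assume n: "\<not> ?thesis"
      have "a2 X \<le> card ({} :: nat set)"
        by (rule a2_le_functionals[where \<phi> = "\<lambda>_ _. 0"]) (use n in auto)
      then show False using assms(4,8) ch by simp
    qed
    then obtain f0 where f0: "f0 \<in> quadrics_through X" "f0 \<noteq> 0" by blast
    obtain d where "a2 X + (c + 1) \<le> ((c + 1) choose 2) + d" "3 * d \<le> c + 1"
      by (rule a2_two_components[OF assms(1,5,6) dimX irY(1) Y(2,3) assms(2) nsub hullX irY(2) f0])
    \<comment> \<open>The subtraction does not truncate, because \<open>(c + 1) choose 2\<close> is
      at least \<open>c > k\<close>. Together with the previous facts this gives
      \<open>c + 1 \<le> k + d\<close>.\<close>
    moreover have "a2 X + k = (c + 1) choose 2" using assms(4,8) ch by simp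
    ultimately show False using assms(3,4) by linarith
  qed
  ultimately show ?thesis by blast
qed

end
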